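(* Assume the following statement (a conjecture): for all positive integers $d,f$ and every $n\geq1$, with $W_{n}^{g}:=\bigoplus_{\lambda\vdash n}\bigoplus_{M\in\operatorname{SSYT}_d(\lambda),\ f_M=g}V_M\subseteq\mathbb{Q}[\mathbf{x}_n]_d$ for $g\geq0$, (a) if $\lambda\vdash n$, $M\in\operatorname{SSYT}_d(\lambda)$, $f_M=f$, and $0\neq F\in V_M$, then every $N\in\operatorname{supp}_{n+1}F$ satisfies $f_N\in\{f,f-1\}$; (b) the map $p_n^f:W_n^f\to W_{n+1}^f$ taking $F$ to $\sum_{N\in\operatorname{supp}_{n+1}F,\ f_N=f}F_N$ is injective; (c) for $q_n^f:W_n^f\to W_{n+1}^{f-1}$, $q_n^fF:=F-p_n^fF$, the map $W_n^f\oplus W_n^{f-1}\to W_{n+1}^{f-1}$ given by $(F,G)\mapsto q_n^fF+p_n^{f-1}G$ is injective. Let $d\geq0$ and let $\mu$ be a content consisting of $\ell$ positive integers of sum $d$. Then for every $0\leq f\leq d$ the quotient $\mathbb{Q}[\mathbf{x}_\infty]_d^f/\mathbb{Q}[\mathbf{x}_\infty]_d^{f-1}$ is the maximal completely reducible sub-representation of $\mathbb{Q}[\mathbf{x}_\infty]_d/\mathbb{Q}[\mathbf{x}_\infty]_d^{f-1}$, and for every $0\leq f\leq\ell$ the quotient $\mathbb{Q}[\mathbf{x}_\infty]_\mu^f/\mathbb{Q}[\mathbf{x}_\infty]_\mu^{f-1}$ is the maximal completely reducible sub-representation of $\mathbb{Q}[\mathbf{x}_\infty]_\mu/\mathbb{Q}[\mathbf{x}_\infty]_\mu^{f-1}$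 (as representations of $S_\infty$, or equivalently of $S_{\mathbb{N}}$).
   Context: $\mathbb{Q}[\mathbf{x}_n]_d$: homogeneous polynomials of degree $d$ in $x_1,\ldots,x_n$; $\mathbb{Q}[\mathbf{x}_\infty]_d$: the same in $x_1,x_2,\ldots$. $S_{\mathbb{N}}$: all permutations of $\mathbb{N}=\{1,2,\ldots\}$, acting by permuting variables; $S_\infty$ is the union of the $S_n$ (fixing all $m>n$). A content of sum $d$ is a finite multi-set of positive integers summing to $d$; $\mathbb{Q}[\mathbf{x}_\infty]_\mu$ is the span of the monomials whose multi-set of positive exponents is $\mu$. For $\lambda\vdash n$, $\operatorname{SSYT}_d(\lambda)$ is the set of semi-standard Young tableaux of shape $\lambda$ with non-negative integer entries (rows weakly, columns strictly increasing) of entry sum $d$. For $M\in\operatorname{SSYT}_d(\lambda)$ and a bijective filling $T$ of $\lambda$ by $\{1,\ldots,n\}$, $R(T),C(T)\subseteq S_n$ are the row and column stabilizers, $p_{M,T}=\prod_{i=1}^nx_i^{h_i}$ with $h_i$ the entry of $M$ in the box of $T$ containing $i$, and $F_{M,T}=\sum_{\sigma\in C(T)}\operatorname{sgn}(\sigma)\sigma(\sum_pp)$, $p$ running over the $R(T)$-orbit of $p_{M,T}$. $V_M$ is the span of all $F_{M,T}$; it is an irreducible representation of $S_n$ isomorphic to the Specht module of $\lambda$, and it is known that $\mathbb{Q}[\mathbf{x}_n]_d=\bigoplus_{\lambda\vdash n}\bigoplus_{M\in\operatorname{SSYT}_d(\lambda)}V_M$. $f_M$ is the number of non-zero entries in the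 first row of $M$. For $F\in\mathbb{Q}[\mathbf{x}_n]_d$ write $F=\sum_MF_M$ with $F_M\in V_M$; $\operatorname{supp}_nF$ is the set of $M$ with $F_M\neq0$. A polynomial $F\in\mathbb{Q}[\mathbf{x}_n]_d$ is also an element of $\mathbb{Q}[\mathbf{x}_{n+1}]_d$, and in $\operatorname{supp}_{n+1}F$ and the components $F_N$ above, the decomposition of $\mathbb{Q}[\mathbf{x}_{n+1}]_d$ is used. Set $\mathbb{Q}[\mathbf{x}_n]_d^f=\bigoplus_{\lambda\vdash n}\bigoplus_{M\in\operatorname{SSYT}_d(\lambda),\ f_M\leq f}V_M$, and $\mathbb{Q}[\mathbf{x}_n]_d^{-1}=\{0\}$. For $f\geq0$, $\mathbb{Q}[\mathbf{x}_\infty]_d^f$ is the set of $F\in\mathbb{Q}[\mathbf{x}_\infty]_d$ such that $F\in\mathbb{Q}[\mathbf{x}_n]_d^f$ for $n$ with $F\in\mathbb{Q}[\mathbf{x}_n]_d$ (under the assumed statement this does not depend on the choice of $n$, and these spaces are representations of $S_{\mathbb{N}}$ and $S_\infty$); $\mathbb{Q}[\mathbf{x}_\infty]_d^{-1}=\{0\}$; $\mathbb{Q}[\mathbf{x}_\infty]_\mu^f=\mathbb{Q}[\mathbf{x}_\infty]_d^f\cap\mathbb{Q}[\mathbf{x}_\infty]_\mu$. *)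

theory Defs
  imports Complex_Main "HOL-Library.Poly_Mapping" "HOL-Library.Multiset"
    "HOL-Combinatorics.Permutations"
begin

text \<open>
  The variables are $x_1, x_2, \ldots$: the index $0$ is never used, and \<open>{1..}\<close> and \<open>{1..n}\<close>
  below are the index sets of the infinitely many and of the first $n$ variables.
\<close>

type_synonym monomial = "nat \<Rightarrow>\<^sub>0 nat"
type_synonym qpoly = "monomial \<Rightarrow>\<^sub>0 rat"

definition var :: "nat \<Rightarrow> qpoly" where
  "var i = Poly_Mapping.single (Poly_Mapping.single i 1) 1"

definition qscale :: "rat \<Rightarrow> qpoly \<Rightarrow> qpoly" where
  "qscale c F = Poly_Mapping.single 0 c * F"

global_interpretation qpoly: vector_space qscale
  by unfold_locales
    (simp_all add: qscale_def distrib_left distrib_right Poly_Mapping.single_add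
      mult.assoc[symmetric] Poly_Mapping.mult_single)

definition mon_degree :: "monomial \<Rightarrow> nat" where
  "mon_degree m = (\<Sum>i\<in>Poly_Mapping.keys m. Poly_Mapping.lookup m i)"

definition mon_content :: "monomial \<Rightarrow> nat multiset" where
  "mon_content m = image_mset (Poly_Mapping.lookup m) (mset_set (Poly_Mapping.keys m))"

definition hom_polys :: "nat set \<Rightarrow> nat \<Rightarrow> qpoly set" where
  "hom_polys I d =
     {F. \<forall>m\<in>Poly_Mapping.keys F. Poly_Mapping.keys m \<subseteq> I \<and> mon_degree m = d}"

definition content_polys :: "nat multiset \<Rightarrow> qpoly set" where
  "content_polys \<mu> =
     qpoly.span {Poly_Mapping.single m 1 | m. Poly_Mapping.keys m \<subseteq> {1..} \<and> mon_content m = \<mu>}"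

text \<open>The substitution $x_i \mapsto x_{\sigma(i)}$.\<close>

definition poly_act :: "(nat \<Rightarrow> nat) \<Rightarrow> qpoly \<Rightarrow> qpoly" where
  "poly_act \<sigma> F =
     (\<Sum>m\<in>Poly_Mapping.keys F. qscale (Poly_Mapping.lookup F m)
        (\<Prod>i\<in>Poly_Mapping.keys m. var (\<sigma> i) ^ Poly_Mapping.lookup m i))"

definition Sym_N :: "(nat \<Rightarrow> nat) set" where
  "Sym_N = {\<sigma>. \<sigma> permutes {1..}}"

definition Sym_infty :: "(nat \<Rightarrow> nat) set" where
  "Sym_infty = (\<Union>n. {\<sigma>. \<sigma> permutes {1..n}})"

text \<open>
  A tableau is the list of its rows (row \<open>0\<close> being the first row), so that its shape is determined
  by it.
\<close>

type_synonym tableau = "nat list list"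

definition is_partition :: "nat list \<Rightarrow> nat \<Rightarrow> bool" where
  "is_partition l n \<longleftrightarrow> sorted_wrt (\<ge>) l \<and> 0 \<notin> set l \<and> sum_list l = n"

definition shape :: "tableau \<Rightarrow> nat list" where
  "shape M = map length M"

definition boxes :: "tableau \<Rightarrow> (nat \<times> nat) set" where
  "boxes M = {(r, c). r < length M \<and> c < length (M ! r)}"

definition SSYT :: "nat \<Rightarrow> nat list \<Rightarrow> tableau set" where
  "SSYT d l = {M. shape M = l
     \<and> (\<forall>row\<in>set M. sorted row)
     \<and> (\<forall>r c. (r, c) \<in> boxes M \<and> (Suc r, c) \<in> boxes M \<longrightarrow> M ! r ! c < M ! Suc r ! c)
     \<and> sum_list (concat M) = d}"

definition SSYTs :: "nat \<Rightarrow> nat \<Rightarrow> tableau set" where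
  "SSYTs n d = (\<Union>l\<in>{l. is_partition l n}. SSYT d l)"

definition fillings :: "nat list \<Rightarrow> tableau set" where
  "fillings l = {T. shape T = l \<and> distinct (concat T) \<and> set (concat T) = {1..sum_list l}}"

definition row_stab :: "tableau \<Rightarrow> (nat \<Rightarrow> nat) set" where
  "row_stab T = {\<sigma>. \<sigma> permutes {1..sum_list (shape T)} \<and> (\<forall>row\<in>set T. \<sigma> ` set row = set row)}"

definition column :: "tableau \<Rightarrow> nat \<Rightarrow> nat set" where
  "column T c = {T ! r ! c | r. (r, c) \<in> boxes T}"

definition col_stab :: "tableau \<Rightarrow> (nat \<Rightarrow> nat) set" where
  "col_stab T = {\<sigma>. \<sigma> permutes {1..sum_list (shape T)} \<and> (\<forall>c. \<sigma> ` column T c = column T c)}"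

definition p_mon :: "tableau \<Rightarrow> tableau \<Rightarrow> qpoly" where
  "p_mon M T = (\<Prod>(r, c)\<in>boxes T. var (T ! r ! c) ^ (M ! r ! c))"

definition F_poly :: "tableau \<Rightarrow> tableau \<Rightarrow> qpoly" where
  "F_poly M T =
     (\<Sum>\<sigma>\<in>col_stab T. qscale (of_int (sign \<sigma>))
        (poly_act \<sigma> (\<Sum>p\<in>(\<lambda>\<tau>. poly_act \<tau> (p_mon M T)) ` row_stab T. p)))"

definition V_rep :: "tableau \<Rightarrow> qpoly set" where
  "V_rep M = qpoly.span (F_poly M ` fillings (shape M))"

definition first_row_count :: "tableau \<Rightarrow> nat" where
  "first_row_count M = length (filter (\<lambda>h. h \<noteq> 0) (hd M))"

text \<open>
  \<open>component n d F M\<close> is $F_M$ with respect to the decomposition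
  $\mathbb{Q}[\mathbf{x}_n]_d = \bigoplus_\lambda \bigoplus_M V_M$. The decomposition is made a
  unique function of \<open>M\<close> by letting it vanish outside the index set.
\<close>

definition component :: "nat \<Rightarrow> nat \<Rightarrow> qpoly \<Rightarrow> tableau \<Rightarrow> qpoly" where
  "component n d F = (THE g. (\<forall>M\<in>SSYTs n d. g M \<in> V_rep M) \<and> (\<forall>M. M \<notin> SSYTs n d \<longrightarrow> g M = 0)
     \<and> F = (\<Sum>M\<in>SSYTs n d. g M))"

definition supp :: "nat \<Rightarrow> nat \<Rightarrow> qpoly \<Rightarrow> tableau set" where
  "supp n d F = {M \<in> SSYTs n d. component n d F M \<noteq> 0}"

definition W_space :: "nat \<Rightarrow> nat \<Rightarrow> nat \<Rightarrow> qpoly set" where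
  "W_space d n g = qpoly.span (\<Union>M\<in>{M \<in> SSYTs n d. first_row_count M = g}. V_rep M)"

definition p_map :: "nat \<Rightarrow> nat \<Rightarrow> nat \<Rightarrow> qpoly \<Rightarrow> qpoly" where
  "p_map d n f F =
     (\<Sum>N\<in>{N \<in> supp (Suc n) d F. first_row_count N = f}. component (Suc n) d F N)"

definition q_map :: "nat \<Rightarrow> nat \<Rightarrow> nat \<Rightarrow> qpoly \<Rightarrow> qpoly" where
  "q_map d n f F = F - p_map d n f F"

definition stability_conjecture :: bool where
  "stability_conjecture \<longleftrightarrow> (\<forall>d>0. \<forall>f>0. \<forall>n\<ge>1.
     (\<forall>l M F. is_partition l n \<and> M \<in> SSYT d l \<and> first_row_count M = f \<and> F \<in> V_rep M \<and> F \<noteq> 0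
        \<longrightarrow> (\<forall>N\<in>supp (Suc n) d F. first_row_count N \<in> {f, f - 1})) \<and>
     inj_on (p_map d n f) (W_space d n f) \<and>
     inj_on (\<lambda>(F, G). q_map d n f F + p_map d n (f - 1) G) (W_space d n f \<times> W_space d n (f - 1)))"

text \<open>
  The filtration index is an integer; for \<open>f = -1\<close> the index set below is empty, so the definitions
  give $\{0\}$, as the convention requires.
\<close>

definition filt_n :: "nat \<Rightarrow> nat \<Rightarrow> int \<Rightarrow> qpoly set" where
  "filt_n n d f = qpoly.span (\<Union>M\<in>{M \<in> SSYTs n d. int (first_row_count M) \<le> f}. V_rep M)"

definition filt :: "nat \<Rightarrow> int \<Rightarrow> qpoly set" where
  "filt d f = {F \<in> hom_polys {1..} d. \<exists>n\<ge>1. F \<in> hom_polys {1..n} d \<and> F \<in> filt_n n d f}"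

definition filt_content :: "nat multiset \<Rightarrow> int \<Rightarrow> qpoly set" where
  "filt_content \<mu> f = filt (sum_mset \<mu>) f \<inter> content_polys \<mu>"

record ('g, 'v) representation =
  grp :: "'g set"
  space :: "'v set"
  vzero :: 'v
  vadd :: "'v \<Rightarrow> 'v \<Rightarrow> 'v"
  vscale :: "rat \<Rightarrow> 'v \<Rightarrow> 'v"
  vact :: "'g \<Rightarrow> 'v \<Rightarrow> 'v"

definition subrep :: "('g, 'v) representation \<Rightarrow> 'v set \<Rightarrow> bool" where
  "subrep R U \<longleftrightarrow> U \<subseteq> space R \<and> vzero R \<in> U
     \<and> (\<forall>u\<in>U. \<forall>v\<in>U. vadd R u v \<in> U)
     \<and> (\<forall>c. \<forall>u\<in>U. vscale R c u \<in> U)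
     \<and> (\<forall>g\<in>grp R. \<forall>u\<in>U. vact R g u \<in> U)"

definition irreducible_subrep :: "('g, 'v) representation \<Rightarrow> 'v set \<Rightarrow> bool" where
  "irreducible_subrep R U \<longleftrightarrow> subrep R U \<and> U \<noteq> {vzero R}
     \<and> (\<forall>U'. subrep R U' \<and> U' \<subseteq> U \<longrightarrow> U' = {vzero R} \<or> U' = U)"

text \<open>The (internal) sum of a family of sub-representations; the empty sum is zero.\<close>

definition rep_sum :: "('g, 'v) representation \<Rightarrow> 'v set set \<Rightarrow> 'v set" where
  "rep_sum R \<U> = \<Inter>{U. subrep R U \<and> \<Union>\<U> \<subseteq> U}"

text \<open>A direct sum of a (possibly infinite) family of irreducible sub-representations.\<close>

definition completely_reducible :: "('g, 'v) representation \<Rightarrow> 'v set \<Rightarrow> bool" where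
  "completely_reducible R U \<longleftrightarrow> (\<exists>\<U>. (\<forall>S\<in>\<U>. irreducible_subrep R S)
     \<and> (\<forall>S\<in>\<U>. S \<inter> rep_sum R (\<U> - {S}) = {vzero R})
     \<and> U = rep_sum R \<U>)"

definition maximal_completely_reducible :: "('g, 'v) representation \<Rightarrow> 'v set \<Rightarrow> bool" where
  "maximal_completely_reducible R U \<longleftrightarrow> subrep R U \<and> completely_reducible R U
     \<and> (\<forall>U'. subrep R U' \<and> completely_reducible R U' \<longrightarrow> U' \<subseteq> U)"

definition poly_rep :: "(nat \<Rightarrow> nat) set \<Rightarrow> qpoly set \<Rightarrow> (nat \<Rightarrow> nat, qpoly) representation" where
  "poly_rep G V = \<lparr>grp = G, space = V, vzero = 0, vadd = (+), vscale = qscale, vact = poly_act\<rparr>"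

definition coset :: "('g, 'v) representation \<Rightarrow> 'v set \<Rightarrow> 'v \<Rightarrow> 'v set" where
  "coset R W v = vadd R v ` W"

definition quotient_space :: "('g, 'v) representation \<Rightarrow> 'v set \<Rightarrow> 'v set \<Rightarrow> 'v set set" where
  "quotient_space R U W = coset R W ` U"

text \<open>
  The operations are those induced on representatives: for a sub-representation \<open>W\<close> all the cosets
  in each of the unions coincide.
\<close>

definition quotient_rep ::
    "('g, 'v) representation \<Rightarrow> 'v set \<Rightarrow> ('g, 'v set) representation" where
  "quotient_rep R W = \<lparr>grp = grp R, space = quotient_space R (space R) W, vzero = W,
     vadd = (\<lambda>A B. \<Union>a\<in>A. \<Union>b\<in>B. coset R W (vadd R a b)),
     vscale = (\<lambda>c A. \<Union>a\<in>A. coset R W (vscale R c a)),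
     vact = (\<lambda>g A. \<Union>a\<in>A. coset R W (vact R g a))\<rparr>"

end

theory Submission
  imports Defs
begin

text \<open>
  For a content \<open>\<mu>\<close> with $\ell$ parts and a monomial \<open>q\<close>, call the sum of the coefficients
  in \<open>F\<close> of the monomials of content \<open>\<mu>\<close> that agree with \<open>q\<close> on the variables of \<open>q\<close> the
  contraction coefficient of \<open>F\<close> at \<open>(\<mu>, q)\<close>. The filtration has a description without
  tableaux (\<open>filt_eq\<close>): a homogeneous polynomial of degree \<open>d\<close> lies in \<open>filt d g\<close> if and only if
  its contraction coefficients at those pairs \<open>(\<mu>, q)\<close> vanish for which \<open>q\<close> involves fewer than
  $\ell - g$ variables. The set of all
  polynomials with this property is called \<open>contr_filt g\<close> below. It is visibly independent of the
  number of variables and invariant under all permutations of them.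

  The quotient of \<open>contr_filt f\<close> by \<open>contr_filt (f - 1)\<close> is completely reducible for the following
  reason. Recording the contraction coefficients with exactly $j = \ell - f$ variables embeds, for
  each \<open>\<mu>\<close>, the part of content \<open>\<mu>\<close> of this quotient into a space of polynomials whose monomials
  involve exactly \<open>j\<close> variables and in which all sums over the position of a single variable
  vanish. For such a polynomial \<open>F\<close> and indices $b_1, \ldots, b_j$ of variables that do not occur
  in it, $j!\,F$ is the sum of the products of the operators $1 - (k_i\,b_i)$ applied to \<open>F\<close>, over
  all sequences of distinct indices $k_1, \ldots, k_j$ of variables of \<open>F\<close>. Hence an invariant
  subspace is determined by the restrictions of its elements to the monomials with variables
  exactly $x_1, \ldots, x_j$ (\<open>harmonic_subset_of_part\<close>). These restrictions live in a space of
  finite dimension, and taking orthogonal complements there yields invariant complements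
  (\<open>invariant_complement\<close>).

  The same products of operators show maximality: if an invariant space of homogeneous polynomials is not
  contained in \<open>contr_filt (f - 1)\<close>, they map some element of it into \<open>contr_filt f\<close> but not into
  \<open>contr_filt (f - 1)\<close> (\<open>contr_filt_essential\<close>), so that every irreducible sub-representation of the
  quotient by \<open>contr_filt (f - 1)\<close> is contained in the image of \<open>contr_filt f\<close>.

  It remains to compare \<open>contr_filt\<close> with the spaces \<open>V_rep M\<close>. An antisymmetrization over columns
  makes contraction coefficients with few variables vanish, so \<open>V_rep M\<close> is contained in
  \<open>contr_filt (first_row_count M)\<close> (\<open>F_poly_contr_filt\<close>); the sum over the orbit of the row stabilizer
  decomposes into contraction coefficients, so \<open>V_rep M\<close> is orthogonal to \<open>contr_filt g\<close> for
  \<open>g < first_row_count M\<close> (\<open>F_poly_orthogonal\<close>); and the spaces \<open>V_rep M\<close> together span all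
  homogeneous polynomials (\<open>exists_F_poly_not_orthogonal\<close>). For the last point, let \<open>F \<noteq> 0\<close> and
  label the indices by a column function \<open>c\<close> of least total value whose antisymmetrizer does not
  kill \<open>F\<close>, and then by a row function \<open>r\<close> of least total value whose symmetrizer does not kill
  the result. The sum of all transpositions acts on the outcome by a scalar that can be computed
  from \<open>r\<close> and from \<open>c\<close>; the equality of the two values forces \<open>r\<close> and \<open>c\<close> to be the coordinates
  of a bijective filling of a Young diagram (\<open>young_symmetrizer_exists\<close>). A Garnir relation for
  rows then produces a semi-standard tableau in the support of the outcome (\<open>straighten\<close>).
\<close>

abbreviation keys where "keys \<equiv> Poly_Mapping.keys"
abbreviation lookup where "lookup \<equiv> Poly_Mapping.lookup"

lemma lookup_qscale [simp]: "lookup (qscale c F) m = c * lookup F m"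
  using mult_map_scale_conv_mult[of c F]
  by (simp add: qscale_def flip: mult_map_scale_conv_mult) (simp add: Poly_Mapping.map.rep_eq when_def)

lemma qscale_minus_one [simp]: "qscale (- 1) F = - F"
  by (rule poly_mapping_eqI) simp

lemma poly_eq_sum_single:
  "(\<Sum>m\<in>keys F. Poly_Mapping.single m (lookup F m)) = F"
  by (rule poly_mapping_eqI) (auto simp: lookup_sum lookup_single when_def in_keys_iff sum.delta')

section \<open>Permuting the variables\<close>

text \<open>
  The monomial whose exponent at \<open>i\<close> is \<open>lookup m (\<sigma> i)\<close>; thus the permutation \<open>\<sigma>\<close> acts
  on monomials by \<open>mperm (inv \<sigma>)\<close>.
\<close>

abbreviation mperm :: "(nat \<Rightarrow> nat) \<Rightarrow> monomial \<Rightarrow> monomial" where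
  "mperm \<equiv> Poly_Mapping.map_key"

lemma lookup_mperm [simp]: "bij \<sigma> \<Longrightarrow> lookup (mperm \<sigma> m) i = lookup m (\<sigma> i)"
  by (simp add: Poly_Mapping.map_key.rep_eq bij_is_inj)

lemma keys_mperm: "bij \<sigma> \<Longrightarrow> keys (mperm \<sigma> m) = \<sigma> -` keys m"
  by (simp add: keys_map_key bij_is_inj)

lemma mperm_mperm: "bij \<sigma> \<Longrightarrow> bij \<tau> \<Longrightarrow> mperm \<sigma> (mperm \<tau> m) = mperm (\<tau> \<circ> \<sigma>) m"
  by (rule poly_mapping_eqI) (simp add: bij_comp)

lemma mperm_id [simp]: "mperm id m = m"
  by (rule poly_mapping_eqI) simp

lemma mperm_inv [simp]:
  assumes "bij \<sigma>"
  shows "mperm (inv \<sigma>) (mperm \<sigma> m) = m" "mperm \<sigma> (mperm (inv \<sigma>) m) = m"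
proof -
  have "\<sigma> \<circ> inv \<sigma> = id" "inv \<sigma> \<circ> \<sigma> = id"
    using bij_is_surj[OF assms] bij_is_inj[OF assms] by (simp_all add: surj_iff)
  thus "mperm (inv \<sigma>) (mperm \<sigma> m) = m" "mperm \<sigma> (mperm (inv \<sigma>) m) = m"
    by (simp_all add: mperm_mperm assms bij_imp_bij_inv)
qed

lemma card_keys_mperm: "bij \<sigma> \<Longrightarrow> card (keys (mperm \<sigma> m)) = card (keys m)"
  by (simp add: keys_mperm card_vimage_inj bij_is_inj bij_is_surj)

lemma keys_mperm_inv: "bij \<sigma> \<Longrightarrow> keys (mperm (inv \<sigma>) m) = \<sigma> ` keys m"
  by (simp add: keys_mperm bij_imp_bij_inv bij_vimage_eq_inv_image inv_inv_eq)

lemma mon_content_mperm [simp]: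
  assumes "bij \<sigma>"
  shows "mon_content (mperm \<sigma> m) = mon_content m"
proof -
  have "inj_on \<sigma> (keys (mperm \<sigma> m))"
    using assms by (meson bij_is_inj inj_on_subset subset_UNIV)
  moreover have "\<sigma> ` keys (mperm \<sigma> m) = keys m"
    unfolding keys_mperm[OF assms] by (rule surj_image_vimage_eq) (rule bij_is_surj[OF assms])
  ultimately have "mset_set (keys m) = image_mset \<sigma> (mset_set (keys (mperm \<sigma> m)))"
    by (simp only: image_mset_mset_set)
  moreover have "lookup (mperm \<sigma> m) = lookup m \<circ> \<sigma>" using assms by auto
  ultimately show ?thesis by (simp add: mon_content_def multiset.map_comp)
qed

lemma size_mon_content [simp]: "size (mon_content m) = card (keys m)"
  by (simp add: mon_content_def)

lemma sum_mon_content [simp]: "sum_mset (mon_content m) = mon_degree m"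
  by (simp add: mon_content_def mon_degree_def sum_unfold_sum_mset)

lemma mon_degree_mperm [simp]: "bij \<sigma> \<Longrightarrow> mon_degree (mperm \<sigma> m) = mon_degree m"
  by (metis mon_content_mperm sum_mon_content)

lemma zero_notin_mon_content: "0 \<notin># mon_content m"
  by (auto simp: mon_content_def in_keys_iff)

lemma prod_single_monomials:
  "finite A \<Longrightarrow> (\<Prod>i\<in>A. Poly_Mapping.single (f i) (1::rat)) = Poly_Mapping.single (\<Sum>i\<in>A. f i) 1"
  by (induction A rule: finite_induct) (simp_all add: Poly_Mapping.mult_single)

lemma var_power: "var i ^ e = Poly_Mapping.single (Poly_Mapping.single i e) 1"
  by (induction e) (simp_all add: var_def Poly_Mapping.mult_single
      flip: Poly_Mapping.single_add)

lemma prod_var_power: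
  assumes "bij \<sigma>"
  shows "(\<Prod>i\<in>keys m. var (\<sigma> i) ^ lookup m i) = Poly_Mapping.single (mperm (inv \<sigma>) m) 1"
proof -
  have "(\<Sum>i\<in>keys m. Poly_Mapping.single (\<sigma> i) (lookup m i)) = mperm (inv \<sigma>) m"
  proof (rule poly_mapping_eqI)
    fix k
    have "lookup (\<Sum>i\<in>keys m. Poly_Mapping.single (\<sigma> i) (lookup m i)) k
        = (\<Sum>i\<in>keys m. if i = inv \<sigma> k then lookup m i else 0)"
      unfolding lookup_sum
      by (intro sum.cong refl) (use assms in \<open>auto simp: lookup_single when_def bij_inv_eq_iff\<close>)
    also have "\<dots> = lookup (mperm (inv \<sigma>) m) k"
      using assms by (auto simp: bij_imp_bij_inv in_keys_iff)
    finally show "lookup (\<Sum>i\<in>keys m. Poly_Mapping.single (\<sigma> i) (lookup m i)) k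
        = lookup (mperm (inv \<sigma>) m) k" .
  qed
  thus ?thesis by (simp add: var_power prod_single_monomials)
qed

lemma poly_act_eq:
  assumes "bij \<sigma>"
  shows "poly_act \<sigma> F = (\<Sum>m\<in>keys F. Poly_Mapping.single (mperm (inv \<sigma>) m) (lookup F m))"
  using assms by (simp add: poly_act_def prod_var_power qscale_def Poly_Mapping.mult_single)

lemma lookup_poly_act [simp]:
  assumes "bij \<sigma>"
  shows "lookup (poly_act \<sigma> F) m = lookup F (mperm \<sigma> m)"
proof -
  have eq: "mperm (inv \<sigma>) m' = m \<longleftrightarrow> m' = mperm \<sigma> m" for m'
    using mperm_inv[OF assms] by auto
  have "lookup (poly_act \<sigma> F) m = (\<Sum>m'\<in>keys F. if m' = mperm \<sigma> m then lookup F m' else 0)"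
    unfolding poly_act_eq[OF assms] lookup_sum
    by (intro sum.cong refl) (auto simp: lookup_single when_def eq)
  thus ?thesis by (auto simp: in_keys_iff)
qed

lemma poly_act_add: "bij \<sigma> \<Longrightarrow> poly_act \<sigma> (F + G) = poly_act \<sigma> F + poly_act \<sigma> G"
  by (rule poly_mapping_eqI) (simp add: lookup_add)
lemma poly_act_diff: "bij \<sigma> \<Longrightarrow> poly_act \<sigma> (F - G) = poly_act \<sigma> F - poly_act \<sigma> G"
  by (rule poly_mapping_eqI) (simp add: lookup_minus)
lemma poly_act_uminus: "bij \<sigma> \<Longrightarrow> poly_act \<sigma> (- F) = - poly_act \<sigma> F"
  by (rule poly_mapping_eqI) simp
lemma poly_act_zero [simp]: "poly_act \<sigma> 0 = 0"
  by (simp add: poly_act_def)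
lemma poly_act_qscale: "bij \<sigma> \<Longrightarrow> poly_act \<sigma> (qscale c F) = qscale c (poly_act \<sigma> F)"
  by (rule poly_mapping_eqI) simp
lemma poly_act_sum: "bij \<sigma> \<Longrightarrow> poly_act \<sigma> (\<Sum>i\<in>I. F i) = (\<Sum>i\<in>I. poly_act \<sigma> (F i))"
  by (rule poly_mapping_eqI) (simp add: lookup_sum)
lemma poly_act_comp: "bij \<sigma> \<Longrightarrow> bij \<tau> \<Longrightarrow> poly_act \<sigma> (poly_act \<tau> F) = poly_act (\<sigma> \<circ> \<tau>) F"
  by (rule poly_mapping_eqI) (simp add: mperm_mperm bij_comp)
lemma poly_act_id [simp]: "poly_act id F = F"
  by (rule poly_mapping_eqI) simp
lemma poly_act_inv [simp]:
  "bij \<sigma> \<Longrightarrow> poly_act \<sigma> (poly_act (inv \<sigma>) F) = F" "bij \<sigma> \<Longrightarrow> poly_act (inv \<sigma>) (poly_act \<sigma> F) = F"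
  by (rule poly_mapping_eqI, simp add: bij_imp_bij_inv)+
lemma poly_act_single: "bij \<sigma> \<Longrightarrow>
  poly_act \<sigma> (Poly_Mapping.single m c) = Poly_Mapping.single (mperm (inv \<sigma>) m) c"
  by (simp add: poly_act_eq) 

lemma keys_poly_act: "bij \<sigma> \<Longrightarrow> keys (poly_act \<sigma> F) = mperm \<sigma> -` keys F"
  by (auto simp: in_keys_iff)

section \<open>Linear functionals and the inner product\<close>

text \<open>The linear functional on polynomials with prescribed value \<open>\<phi> m\<close> on each monomial \<open>m\<close>.\<close>

definition pair :: "(monomial \<Rightarrow> rat) \<Rightarrow> qpoly \<Rightarrow> rat" where
  "pair \<phi> F = (\<Sum>m\<in>keys F. lookup F m * \<phi> m)"

lemma pair_superset: "finite S \<Longrightarrow> keys F \<subseteq> S \<Longrightarrow> pair \<phi> F = (\<Sum>m\<in>S. lookup F m * \<phi> m)"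
  unfolding pair_def by (rule sum.mono_neutral_left) (auto simp: in_keys_iff)

lemma pair_add: "pair \<phi> (F + G) = pair \<phi> F + pair \<phi> G"
  using keys_add[of F G]
  by (simp add: pair_superset[of "keys F \<union> keys G"] lookup_add sum.distrib distrib_right)

lemma pair_qscale: "pair \<phi> (qscale c F) = c * pair \<phi> F"
proof -
  have "keys (qscale c F) \<subseteq> keys F" by (auto simp: in_keys_iff)
  thus ?thesis by (simp add: pair_superset[of "keys F"] sum_distrib_left mult.assoc)
qed

lemma pair_zero [simp]: "pair \<phi> 0 = 0" by (simp add: pair_def)
lemma pair_uminus: "pair \<phi> (- F) = - pair \<phi> F"
  using pair_qscale[of \<phi> "-1" F] by simp
lemma pair_diff: "pair \<phi> (F - G) = pair \<phi> F - pair \<phi> G"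
  using pair_add[of \<phi> F "- G"] by (simp add: pair_uminus)
lemma pair_sum: "pair \<phi> (\<Sum>i\<in>I. F i) = (\<Sum>i\<in>I. pair \<phi> (F i))"
  by (induction I rule: infinite_finite_induct) (simp_all add: pair_add)
lemma pair_single [simp]: "pair \<phi> (Poly_Mapping.single m c) = c * \<phi> m"
  by (simp add: pair_def)

lemma pair_poly_act:
  assumes "bij \<sigma>"
  shows "pair \<phi> (poly_act \<sigma> F) = pair (\<lambda>m. \<phi> (mperm (inv \<sigma>) m)) F"
  by (simp add: poly_act_eq[OF assms] pair_sum) (simp add: pair_def)

lemma pair_cong: "(\<And>m. m \<in> keys F \<Longrightarrow> \<phi> m = \<psi> m) \<Longrightarrow> pair \<phi> F = pair \<psi> F"
  by (simp add: pair_def)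

lemma pair_fun_sum: "(\<Sum>i\<in>I. pair (\<phi> i) F) = pair (\<lambda>m. \<Sum>i\<in>I. \<phi> i m) F"
  unfolding pair_def by (subst sum.swap) (simp add: sum_distrib_left)

lemma pair_fun_cmult: "pair (\<lambda>m. c * \<phi> m) F = c * pair \<phi> F"
  by (simp add: pair_def sum_distrib_left mult.left_commute)

lemma pair_eq_0I: "(\<And>m. m \<in> keys F \<Longrightarrow> \<phi> m = 0) \<Longrightarrow> pair \<phi> F = 0"
  by (simp add: pair_def)

text \<open>The inner product for which the monomials are orthonormal.\<close>

definition ip :: "qpoly \<Rightarrow> qpoly \<Rightarrow> rat" where "ip F G = pair (lookup G) F"

lemma ip_commute: "ip F G = ip G F"
  unfolding ip_def
  by (subst (1 2) pair_superset[of "keys F \<union> keys G"]) (auto simp: mult.commute)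

lemma ip_add_left: "ip (F + G) H = ip F H + ip G H" by (simp add: ip_def pair_add)
lemma ip_add_right: "ip H (F + G) = ip H F + ip H G" by (simp add: ip_commute[of H] ip_add_left)
lemma ip_diff_left: "ip (F - G) H = ip F H - ip G H" by (simp add: ip_def pair_diff)
lemma ip_diff_right: "ip H (F - G) = ip H F - ip H G" by (simp add: ip_commute[of H] ip_diff_left)
lemma ip_qscale_left: "ip (qscale c F) H = c * ip F H" by (simp add: ip_def pair_qscale)
lemma ip_qscale_right: "ip H (qscale c F) = c * ip H F" by (simp add: ip_commute[of H] ip_qscale_left)
lemma ip_sum_left: "ip (\<Sum>i\<in>I. F i) H = (\<Sum>i\<in>I. ip (F i) H)" by (simp add: ip_def pair_sum)
lemma ip_sum_right: "ip H (\<Sum>i\<in>I. F i) = (\<Sum>i\<in>I. ip H (F i))" by (simp add: ip_commute[of H] ip_sum_left)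
lemma ip_zero [simp]: "ip 0 F = 0" "ip F 0 = 0" by (simp_all add: ip_def pair_def)

lemma ip_poly_act_left:
  assumes "bij \<sigma>" shows "ip (poly_act \<sigma> F) G = ip F (poly_act (inv \<sigma>) G)"
  using assms by (simp add: ip_def pair_poly_act bij_imp_bij_inv cong: pair_cong)

lemma ip_self_eq_0 [simp]: "ip F F = 0 \<longleftrightarrow> F = 0"
proof
  assume "ip F F = 0"
  hence "\<forall>m\<in>keys F. lookup F m * lookup F m = 0"
    by (subst sum_nonneg_eq_0_iff[symmetric]) (auto simp: ip_def pair_def)
  thus "F = 0" by (metis mult_eq_0_iff not_in_keys_iff_lookup_eq_zero poly_mapping_eqI lookup_zero)
qed simp

lemma ip_single: "ip F (Poly_Mapping.single m 1) = lookup F m"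
  by (subst ip_commute) (simp add: ip_def)

lemma ip_span_right:
  assumes "G \<in> qpoly.span S" "\<And>s. s \<in> S \<Longrightarrow> ip F s = 0" shows "ip F G = 0"
  using assms(1)
  by (induction rule: qpoly.span_induct_alt) (auto simp: ip_add_right ip_qscale_right assms(2))

text \<open>The Gram--Schmidt process, which needs no square roots since the basis is not normalized.\<close>

lemma orth_decomp_finite:
  assumes "finite S"
  shows "\<exists>y0\<in>qpoly.span S. \<forall>s\<in>S. ip (y - y0) s = 0"
  using assms
proof (induction S arbitrary: y rule: finite_induct)
  case empty thus ?case by auto
next
  case (insert s S)
  obtain s0 where s0: "s0 \<in> qpoly.span S" "\<forall>t\<in>S. ip (s - s0) t = 0" using insert.IH by blast
  obtain y0 where y0: "y0 \<in> qpoly.span S" "\<forall>t\<in>S. ip (y - y0) t = 0" using insert.IH by blast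
  define s1 where "s1 = s - s0"
  define c where "c = ip (y - y0) s1 / ip s1 s1"
  define z where "z = y0 + qscale c s1"
  have mono: "qpoly.span S \<subseteq> qpoly.span (insert s S)" by (rule qpoly.span_mono) auto
  have "s1 \<in> qpoly.span (insert s S)" unfolding s1_def
    using mono s0 by (intro qpoly.span_diff) (auto intro: qpoly.span_base)
  hence z: "z \<in> qpoly.span (insert s S)" unfolding z_def
    using mono y0 by (intro qpoly.span_add qpoly.span_scale) auto
  have o1: "ip (y - z) t = 0" if "t \<in> S" for t
    using that y0 s0 by (simp add: z_def s1_def diff_add_eq_diff_diff_swap ip_diff_left ip_add_left ip_qscale_left)
  have o2: "ip (y - z) s1 = 0"
    by (cases "s1 = 0") (simp_all add: z_def c_def ip_diff_left ip_add_left ip_qscale_left)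
  have "ip (y - z) s0 = 0" using ip_span_right[OF s0(1)] o1 by blast
  hence "ip (y - z) s = 0" using o2 by (simp add: s1_def ip_diff_right)
  thus ?case using z o1 by blast
qed

lemma orth_decomp:
  assumes "qpoly.subspace W" "W \<subseteq> qpoly.span B" "finite B"
  shows "\<exists>y0\<in>W. \<forall>w\<in>W. ip (y - y0) w = 0"
proof -
  obtain S where S: "S \<subseteq> W" "qpoly.independent S" "W \<subseteq> qpoly.span S"
    by (metis qpoly.basis_exists)
  have "finite S" using qpoly.independent_span_bound[OF assms(3) S(2)] S(1) assms(2) by blast
  moreover have "qpoly.span S = W" using S assms(1) by (metis qpoly.span_minimal subset_antisym)
  ultimately obtain y0 where "y0 \<in> W" "\<forall>s\<in>S. ip (y - y0) s = 0"
    using orth_decomp_finite[of S y] by blast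
  thus ?thesis using ip_span_right[of _ S "y - y0"] S(3) by blast
qed

lemma dim_strict_mono:
  assumes "qpoly.subspace V" "qpoly.subspace W" "V \<subset> W" "W \<subseteq> qpoly.span B" "finite B"
  shows "qpoly.dim V < qpoly.dim W"
proof -
  obtain S where S: "S \<subseteq> V" "qpoly.independent S" "V \<subseteq> qpoly.span S" "card S = qpoly.dim V"
    using qpoly.basis_exists by blast
  obtain S' where S': "S \<subseteq> S'" "S' \<subseteq> W" "qpoly.independent S'" "W \<subseteq> qpoly.span S'"
    using qpoly.maximal_independent_subset_extend[of S W] S assms(3) by blast
  have fin: "finite S'" using qpoly.independent_span_bound[OF assms(5) S'(3)] S'(2) assms(4) by blast
  have "S \<noteq> S'"
  proof
    assume "S = S'"
    hence "W \<subseteq> V" using S S' assms(1) by (metis qpoly.span_minimal subset_trans)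
    thus False using assms(3) by blast
  qed
  hence "card S < card S'" using fin S'(1) by (simp add: psubset_card_mono psubsetI)
  moreover have "qpoly.dim W = card S'" by (rule qpoly.dim_unique[OF S'(2,4,3)]) simp
  ultimately show ?thesis using S(4) by simp
qed

section \<open>Alternating over disjoint transpositions\<close>

text \<open>The transposition of two indices.\<close>

abbreviation swp :: "nat \<Rightarrow> nat \<Rightarrow> nat \<Rightarrow> nat" where
  "swp \<equiv> Transposition.transpose"

text \<open>The set of indices of the variables that occur in a polynomial.\<close>

definition vars :: "qpoly \<Rightarrow> nat set" where "vars F = (\<Union>m\<in>keys F. keys m)"

lemma finite_vars [simp]: "finite (vars F)" by (simp add: vars_def)

lemma vars_poly_act: "bij \<sigma> \<Longrightarrow> vars (poly_act \<sigma> F) = \<sigma> ` vars F"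
proof -
  assume \<sigma>: "bij \<sigma>"
  have "x \<in> vars (poly_act \<sigma> F) \<longleftrightarrow> inv \<sigma> x \<in> vars F" for x
  proof
    assume "x \<in> vars (poly_act \<sigma> F)"
    then obtain m where "mperm \<sigma> m \<in> keys F" "x \<in> keys m" using \<sigma> by (auto simp: vars_def keys_poly_act)
    moreover from this have "inv \<sigma> x \<in> keys (mperm \<sigma> m)"
      using \<sigma> by (simp add: keys_mperm bij_is_surj surj_f_inv_f)
    ultimately show "inv \<sigma> x \<in> vars F" by (auto simp: vars_def)
  next
    assume "inv \<sigma> x \<in> vars F"
    then obtain m where m: "m \<in> keys F" "inv \<sigma> x \<in> keys m" by (auto simp: vars_def)
    hence "mperm (inv \<sigma>) m \<in> keys (poly_act \<sigma> F)" using \<sigma> by (simp add: keys_poly_act)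
    moreover have "x \<in> keys (mperm (inv \<sigma>) m)" using m \<sigma> by (simp add: keys_mperm bij_imp_bij_inv)
    ultimately show "x \<in> vars (poly_act \<sigma> F)" by (auto simp: vars_def)
  qed
  moreover have "x \<in> \<sigma> ` vars F \<longleftrightarrow> inv \<sigma> x \<in> vars F" for x
    using image_eqI[of x \<sigma> "inv \<sigma> x" "vars F"] \<sigma>
    by (auto simp: bij_is_inj bij_is_surj surj_f_inv_f)
  ultimately show ?thesis by blast
qed

lemma mperm_swp_fixed: "k \<notin> keys m \<Longrightarrow> b \<notin> keys m \<Longrightarrow> mperm (swp k b) m = m"
  by (rule poly_mapping_eqI) (simp add: Transposition.transpose_def in_keys_iff)

text \<open>The product of the operators $1 - (k\,b)$ over the pairs \<open>(k, b)\<close> in the list.\<close>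

fun alternate :: "(nat \<times> nat) list \<Rightarrow> qpoly \<Rightarrow> qpoly" where
  "alternate [] F = F"
| "alternate ((k, b) # ps) F = alternate ps F - poly_act (swp k b) (alternate ps F)"

lemma alternate_diff: "alternate ps (F - G) = alternate ps F - alternate ps G"
  by (induction ps F rule: alternate.induct) (simp_all add: poly_act_diff)

lemma alternate_zero [simp]: "alternate ps 0 = 0"
  using alternate_diff[of ps 0 0] by simp

lemma alternate_add: "alternate ps (F + G) = alternate ps F + alternate ps G"
  using alternate_diff[of ps F "- G"] alternate_diff[of ps 0 G] by simp

lemma alternate_sum: "alternate ps (\<Sum>i\<in>I. F i) = (\<Sum>i\<in>I. alternate ps (F i))"
  by (induction I rule: infinite_finite_induct) (simp_all add: alternate_add)

text \<open>The pairs have no index in common, so that their transpositions commute.\<close>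

definition pairs_disjoint :: "(nat \<times> nat) list \<Rightarrow> bool" where
  "pairs_disjoint ps \<longleftrightarrow> distinct (map fst ps @ map snd ps)"

lemma pairs_disjoint_Cons: "pairs_disjoint ((k, b) # ps) \<longleftrightarrow>
    pairs_disjoint ps \<and> k \<noteq> b \<and> k \<notin> fst ` set ps \<and> b \<notin> fst ` set ps \<and> k \<notin> snd ` set ps \<and> b \<notin> snd ` set ps"
  by (auto simp: pairs_disjoint_def)

lemma swp_commute:
  assumes "{k, b} \<inter> {k', b'} = {}"
  shows "swp k b \<circ> swp k' b' = swp k' b' \<circ> swp k b"
  using assms by (auto simp: fun_eq_iff Transposition.transpose_def)

lemma alternate_commute:
  assumes "bij \<sigma>" "\<And>k b. (k, b) \<in> set ps \<Longrightarrow> \<sigma> \<circ> swp k b = swp k b \<circ> \<sigma>"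
  shows "poly_act \<sigma> (alternate ps F) = alternate ps (poly_act \<sigma> F)"
  using assms(2)
proof (induction ps)
  case (Cons p ps)
  obtain k b where p: "p = (k, b)" by fastforce
  have c: "\<sigma> \<circ> swp k b = swp k b \<circ> \<sigma>" by (rule Cons.prems) (simp add: p)
  have IH: "poly_act \<sigma> (alternate ps F) = alternate ps (poly_act \<sigma> F)" using Cons by auto
  have "poly_act \<sigma> (poly_act (swp k b) (alternate ps F)) = poly_act (swp k b) (poly_act \<sigma> (alternate ps F))"
    by (simp only: poly_act_comp assms(1) bij_transpose c)
  thus ?case by (simp add: p poly_act_diff assms(1) IH)
qed simp

lemma pairs_disjoint_commute:
  assumes "pairs_disjoint ps" "(k, b) \<in> set ps" "(k', b') \<in> set ps"
  shows "swp k b \<circ> swp k' b' = swp k' b' \<circ> swp k b"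
proof (cases "(k, b) = (k', b')")
  case False
  have d: "distinct (map fst ps)" "distinct (map snd ps)" "fst ` set ps \<inter> snd ` set ps = {}"
    using assms(1) by (auto simp: pairs_disjoint_def)
  have "k \<noteq> k'" using d(1) assms(2,3) False by (metis eq_key_imp_eq_value)
  moreover have "b \<noteq> b'" using d(2) assms(2,3) False
    by (metis (no_types, lifting) distinct_map inj_onD snd_conv)
  moreover have "k \<noteq> b'" "b \<noteq> k'" using d(3) assms(2,3) by force+
  ultimately show ?thesis by (intro swp_commute) auto
qed simp

lemma alternate_antisym:
  assumes "pairs_disjoint ps" "(k, b) \<in> set ps"
  shows "poly_act (swp k b) (alternate ps F) = - alternate ps F"
  using assms
proof (induction ps)
  case (Cons p ps)
  obtain k' b' where p: "p = (k', b')" by fastforce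
  have dj: "pairs_disjoint ps" using Cons.prems p by (simp add: pairs_disjoint_Cons)
  show ?case
  proof (cases "(k, b) = (k', b')")
    case True
    thus ?thesis by (simp add: p poly_act_diff poly_act_comp)
  next
    case False
    hence "(k, b) \<in> set ps" using Cons.prems p by auto
    note IH = Cons.IH[OF dj this]
    have c: "swp k b \<circ> swp k' b' = swp k' b' \<circ> swp k b"
      using pairs_disjoint_commute[OF Cons.prems(1,2)] p by simp
    have "poly_act (swp k b) (poly_act (swp k' b') (alternate ps F)) = - poly_act (swp k' b') (alternate ps F)"
      by (simp only: poly_act_comp bij_transpose c flip: poly_act_uminus IH)
    thus ?thesis by (simp add: p poly_act_diff IH)
  qed
qed simp

lemma alternate_eq_0_of_fixed:
  assumes "pairs_disjoint ps" "(k, b) \<in> set ps" "poly_act (swp k b) F = F"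
  shows "alternate ps F = 0"
proof -
  have "alternate ps F = alternate ps (poly_act (swp k b) F)" by (simp add: assms(3))
  also have "\<dots> = poly_act (swp k b) (alternate ps F)"
    using pairs_disjoint_commute[OF assms(1,2)] by (intro alternate_commute[symmetric]) auto
  also have "\<dots> = - alternate ps F" by (rule alternate_antisym[OF assms(1,2)])
  finally have "lookup (alternate ps F) m = - lookup (alternate ps F) m" for m by (metis lookup_uminus)
  thus ?thesis by (intro poly_mapping_eqI) (simp add: eq_neg_iff_add_eq_0 flip: mult_2)
qed

lemma alternate_eq_0:
  assumes "pairs_disjoint ps"
    and "\<And>m. m \<in> keys F \<Longrightarrow> \<exists>(k, b)\<in>set ps. k \<notin> keys m \<and> b \<notin> keys m"
  shows "alternate ps F = 0"
proof -
  have "alternate ps (Poly_Mapping.single m (lookup F m)) = 0" if m: "m \<in> keys F" for m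
  proof -
    obtain k b where kb: "(k, b) \<in> set ps" "k \<notin> keys m" "b \<notin> keys m" using assms(2)[OF m] by auto
    show ?thesis
      by (rule alternate_eq_0_of_fixed[OF assms(1) kb(1)]) (simp add: poly_act_single mperm_swp_fixed kb)
  qed
  hence "alternate ps (\<Sum>m\<in>keys F. Poly_Mapping.single m (lookup F m)) = 0" by (simp add: alternate_sum)
  thus ?thesis by (simp add: poly_eq_sum_single)
qed

lemma keys_minus_poly: "keys (F - G) \<subseteq> keys F \<union> keys (G::qpoly)"
  by (auto simp: in_keys_iff lookup_minus)

lemma vars_alternate: "vars (alternate ps F) \<subseteq> vars F \<union> fst ` set ps \<union> snd ` set ps"
proof (induction ps)
  case (Cons p ps)
  obtain k b where p: "p = (k, b)" by fastforce
  have "vars (alternate (p # ps) F) \<subseteq> vars (alternate ps F) \<union> swp k b ` vars (alternate ps F)"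
    using keys_minus_poly[of "alternate ps F" "poly_act (swp k b) (alternate ps F)"]
      vars_poly_act[of "swp k b" "alternate ps F"] by (auto simp: p vars_def)
  also have "swp k b ` vars (alternate ps F) \<subseteq> vars (alternate ps F) \<union> {k, b}"
    by (auto simp: Transposition.transpose_def)
  finally show ?case using Cons.IH p by auto
qed simp

text \<open>
  If the second components of the pairs are indices of variables that do not occur in \<open>F\<close>, then
  every monomial of \<open>alternate ps F\<close> involves exactly one variable of each pair.
\<close>

lemma alternate_support:
  assumes "pairs_disjoint ps" "snd ` set ps \<inter> vars F = {}" "m \<in> keys (alternate ps F)" "(k, b) \<in> set ps"
  shows "(k \<in> keys m) \<noteq> (b \<in> keys m)"
  using assms
proof (induction ps arbitrary: m)
  case (Cons p ps)
  obtain k' b' where p: "p = (k', b')" by fastforce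
  have dj: "pairs_disjoint ps" "snd ` set ps \<inter> vars F = {}" "b' \<notin> vars F"
    "k' \<noteq> b'" "k' \<notin> fst ` set ps" "b' \<notin> fst ` set ps" "k' \<notin> snd ` set ps" "b' \<notin> snd ` set ps"
    using Cons.prems p by (auto simp: pairs_disjoint_Cons)
  have b': "b' \<notin> vars (alternate ps F)" using vars_alternate[of ps F] dj by auto
  have or: "m \<in> keys (alternate ps F) \<or> mperm (swp k' b') m \<in> keys (alternate ps F)"
    using Cons.prems(3) by (auto simp: p in_keys_iff lookup_minus)
  show ?case
  proof (cases "(k, b) = (k', b')")
    case True
    have "mperm (swp k' b') m \<noteq> m"
      using Cons.prems(3) by (auto simp: p in_keys_iff lookup_minus)
    hence "\<not> (k' \<notin> keys m \<and> b' \<notin> keys m)" using mperm_swp_fixed by blast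
    moreover have "\<not> (k' \<in> keys m \<and> b' \<in> keys m)"
    proof
      assume a: "k' \<in> keys m \<and> b' \<in> keys m"
      hence "b' \<in> keys (mperm (swp k' b') m)" by (simp add: keys_mperm)
      thus False using or a b' by (auto simp: vars_def)
    qed
    ultimately show ?thesis using True by auto
  next
    case False
    hence kb: "(k, b) \<in> set ps" using Cons.prems p by auto
    hence "k \<in> fst ` set ps" "b \<in> snd ` set ps" by force+
    hence ne: "k \<noteq> k'" "k \<noteq> b'" "b \<noteq> k'" "b \<noteq> b'" using dj by blast+
    from or show ?thesis
    proof
      assume "mperm (swp k' b') m \<in> keys (alternate ps F)"
      from Cons.IH[OF dj(1,2) this kb] show ?thesis using ne by (simp add: keys_mperm)
    qed (use Cons.IH dj kb in blast)
  qed
qed simp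

text \<open>
  A functional that only sees monomials involving all the first components does not notice the
  terms with a transposition: these involve a second component instead.
\<close>

lemma pair_alternate:
  assumes "pairs_disjoint ps" "snd ` set ps \<inter> vars F = {}"
    and "\<And>m. \<phi> m \<noteq> 0 \<Longrightarrow> fst ` set ps \<subseteq> keys m"
  shows "pair \<phi> (alternate ps F) = pair \<phi> F"
  using assms
proof (induction ps)
  case (Cons p ps)
  obtain k b where p: "p = (k, b)" by fastforce
  have dj: "pairs_disjoint ps" "snd ` set ps \<inter> vars F = {}" "b \<notin> vars F" "b \<notin> fst ` set ps" "b \<notin> snd ` set ps"
    using Cons.prems p by (auto simp: pairs_disjoint_Cons)
  have b: "b \<notin> vars (alternate ps F)" using vars_alternate[of ps F] dj by auto
  have "pair \<phi> (poly_act (swp k b) (alternate ps F)) = 0"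
    unfolding pair_poly_act[OF bij_transpose]
  proof (rule pair_eq_0I, rule ccontr)
    fix m assume m: "m \<in> keys (alternate ps F)" "\<phi> (mperm (inv (swp k b)) m) \<noteq> 0"
    hence "k \<in> keys (mperm (swp k b) m)" using Cons.prems(3)[OF m(2)] p by simp
    thus False using b m(1) by (auto simp: vars_def keys_mperm)
  qed
  moreover have "pair \<phi> (alternate ps F) = pair \<phi> F" using Cons.IH[OF dj(1,2)] Cons.prems(3) by auto
  ultimately show ?case by (simp add: p pair_diff)
qed simp

lemma lookup_eq_pair: "lookup F m = pair (\<lambda>m'. if m' = m then 1 else 0) F"
  by (simp add: pair_def in_keys_iff sum.delta' if_distrib cong: if_cong)

lemma lookup_alternate:
  assumes "pairs_disjoint ps" "snd ` set ps \<inter> vars F = {}" "fst ` set ps \<subseteq> keys m"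
  shows "lookup (alternate ps F) m = lookup F m"
  unfolding lookup_eq_pair by (rule pair_alternate[OF assms(1,2)]) (use assms(3) in \<open>auto split: if_splits\<close>)

section \<open>Groups of permutations of the variables\<close>

text \<open>The properties of \<open>Sym_infty\<close> and \<open>Sym_N\<close> that are used for both of them.\<close>

locale var_group =
  fixes G :: "(nat \<Rightarrow> nat) set"
  assumes G_permutes: "\<sigma> \<in> G \<Longrightarrow> \<sigma> permutes {1..}"
    and G_finitary: "\<sigma> permutes {1..n} \<Longrightarrow> \<sigma> \<in> G"
    and G_comp: "\<sigma> \<in> G \<Longrightarrow> \<tau> \<in> G \<Longrightarrow> \<sigma> \<circ> \<tau> \<in> G"
    and G_inv: "\<sigma> \<in> G \<Longrightarrow> inv \<sigma> \<in> G"
begin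

lemma G_bij [simp]: "\<sigma> \<in> G \<Longrightarrow> bij \<sigma>"
  using G_permutes permutes_bij by blast

lemma G_swp: "0 < k \<Longrightarrow> 0 < b \<Longrightarrow> swp k b \<in> G"
  by (rule G_finitary[of _ "max k b"]) (auto intro!: permutes_swap_id)

text \<open>Sub-representations of the space of all polynomials.\<close>

definition invariant :: "qpoly set \<Rightarrow> bool" where
  "invariant U \<longleftrightarrow> qpoly.subspace U \<and> (\<forall>g\<in>G. \<forall>F\<in>U. poly_act g F \<in> U)"

lemma invariant_subspace: "invariant U \<Longrightarrow> qpoly.subspace U" by (simp add: invariant_def)
lemma invariant_act: "invariant U \<Longrightarrow> g \<in> G \<Longrightarrow> F \<in> U \<Longrightarrow> poly_act g F \<in> U" by (simp add: invariant_def)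

lemma invariant_alternate:
  assumes "invariant U" "F \<in> U" "\<And>k b. (k, b) \<in> set ps \<Longrightarrow> 0 < k \<and> 0 < b"
  shows "alternate ps F \<in> U"
  using assms(3)
proof (induction ps)
  case (Cons p ps)
  obtain k b where p: "p = (k, b)" by fastforce
  have "alternate ps F \<in> U" "swp k b \<in> G" using Cons p by (auto intro!: G_swp)
  thus ?case using assms(1) by (simp add: p qpoly.subspace_diff invariant_subspace invariant_act)
qed (simp add: assms)

end

section \<open>Polynomials with vanishing one-step sums\<close>

text \<open>The sum of the terms of \<open>F\<close> whose monomials satisfy \<open>P\<close>.\<close>

definition part :: "(monomial \<Rightarrow> bool) \<Rightarrow> qpoly \<Rightarrow> qpoly" where
  "part P F = (\<Sum>m\<in>{m \<in> keys F. P m}. Poly_Mapping.single m (lookup F m))"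

lemma lookup_part [simp]: "lookup (part P F) m = (if P m then lookup F m else 0)"
  by (auto simp: part_def lookup_sum lookup_single when_def in_keys_iff sum.delta')

lemma keys_part: "keys (part P F) = {m \<in> keys F. P m}"
  by (auto simp: in_keys_iff split: if_splits)

lemma part_add: "part P (F + G) = part P F + part P G"
  by (rule poly_mapping_eqI) (simp add: lookup_add)
lemma part_diff: "part P (F - G) = part P F - part P G"
  by (rule poly_mapping_eqI) (simp add: lookup_minus)
lemma part_qscale: "part P (qscale c F) = qscale c (part P F)"
  by (rule poly_mapping_eqI) simp
lemma part_zero [simp]: "part P 0 = 0"
  by (rule poly_mapping_eqI) simp
lemma part_part [simp]: "part P (part P F) = part P F"
  by (rule poly_mapping_eqI) simp

lemma part_poly_act: "bij \<sigma> \<Longrightarrow> part P (poly_act \<sigma> F) = poly_act \<sigma> (part (\<lambda>m. P (mperm (inv \<sigma>) m)) F)"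
  by (rule poly_mapping_eqI) (simp add: bij_imp_bij_inv)

lemma pair_part: "pair \<phi> (part P F) = pair (\<lambda>m. if P m then \<phi> m else 0) F"
  by (subst (1 2) pair_superset[of "keys F"]) (auto simp: keys_part intro!: sum.cong)

lemma ip_part: "ip (part P F) G = ip F (part P G)"
  unfolding ip_def pair_part by (rule pair_cong) simp

lemma subspace_part_image: "qpoly.subspace U \<Longrightarrow> qpoly.subspace (part P ` U)"
  unfolding qpoly.subspace_def
  by (auto simp flip: part_add part_qscale) (metis image_eqI part_zero)

lemma finite_monomials:
  assumes "finite K"
  shows "finite {m. keys m \<subseteq> K \<and> mon_degree m \<le> D}"
proof (rule finite_subset)
  let ?S = "{f. \<forall>i. (i \<in> K \<longrightarrow> f i \<in> {..D}) \<and> (i \<notin> K \<longrightarrow> f i = 0)}"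
  show "{m. keys m \<subseteq> K \<and> mon_degree m \<le> D} \<subseteq> Abs_poly_mapping ` ?S"
  proof
    fix m assume m: "m \<in> {m. keys m \<subseteq> K \<and> mon_degree m \<le> D}"
    have "lookup m i \<le> D" for i
    proof (cases "i \<in> keys m")
      case True
      hence "lookup m i \<le> mon_degree m" unfolding mon_degree_def
        by (intro member_le_sum) auto
      thus ?thesis using m by simp
    qed (simp add: in_keys_iff)
    hence "lookup m \<in> ?S" using m by (auto simp: in_keys_iff subset_iff)
    thus "m \<in> Abs_poly_mapping ` ?S" by (intro image_eqI[of _ _ "lookup m"]) (simp_all only: lookup_inverse)
  qed
  show "finite (Abs_poly_mapping ` ?S)"
    by (intro finite_imageI finite_set_of_finite_funs assms) auto
qed

lemma span_singles:
  assumes "keys F \<subseteq> S"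
  shows "F \<in> qpoly.span ((\<lambda>m. Poly_Mapping.single m 1) ` S)"
proof -
  have "(\<Sum>m\<in>keys F. qscale (lookup F m) (Poly_Mapping.single m 1)) \<in> qpoly.span ((\<lambda>m. Poly_Mapping.single m 1) ` S)"
    using assms by (intro qpoly.span_sum qpoly.span_scale qpoly.span_base) auto
  moreover have "qscale c (Poly_Mapping.single m 1) = Poly_Mapping.single m c" for c m
    by (simp add: qscale_def Poly_Mapping.mult_single)
  ultimately show ?thesis by (simp add: poly_eq_sum_single)
qed

lemma ex_permutes_image:
  assumes "finite A" "K \<subseteq> A" "L \<subseteq> A" "card K = card L"
  obtains g where "g permutes A" "g ` K = L"
proof -
  have fin: "finite K" "finite L" using assms finite_subset by auto
  obtain f where f: "bij_betw f K L" using finite_same_card_bij[OF fin assms(4)] by blast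
  have "card (A - K) = card (A - L)" using assms fin by (simp add: card_Diff_subset)
  then obtain h where h: "bij_betw h (A - K) (A - L)"
    using finite_same_card_bij assms(1) by blast
  define g where "g x = (if x \<in> K then f x else if x \<in> A then h x else x)" for x
  have gK: "bij_betw g K L" using f by (rule bij_betw_cong[THEN iffD1, rotated]) (simp add: g_def)
  have gA: "bij_betw g (A - K) (A - L)" using h by (rule bij_betw_cong[THEN iffD1, rotated]) (simp add: g_def)
  have "bij_betw g (K \<union> (A - K)) (L \<union> (A - L))"
    by (rule bij_betw_combine[OF gK gA]) auto
  hence "bij_betw g A A" using assms by (simp add: Un_absorb1)
  hence "g permutes A" by (rule bij_imp_permutes) (use assms in \<open>auto simp: g_def\<close>)
  moreover have "g ` K = L" using gK by (simp add: bij_betw_def)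
  ultimately show ?thesis using that by blast
qed

text \<open>The monomial \<open>m\<close> arises from \<open>q\<close> by multiplication with the \<open>h\<close>-th power of a new variable.\<close>

definition one_step :: "monomial \<Rightarrow> nat \<Rightarrow> monomial \<Rightarrow> bool" where
  "one_step q h m \<longleftrightarrow> (\<exists>v. v \<notin> keys q \<and> m = q + Poly_Mapping.single v h)"

text \<open>
  Polynomials of degree at most \<open>D\<close> whose monomials involve exactly \<open>j\<close> variables and in which,
  for all \<open>q\<close> and \<open>h > 0\<close>, the coefficients of the products of \<open>q\<close> with the \<open>h\<close>-th power of a
  further variable add up to zero.
\<close>

definition harmonic :: "nat \<Rightarrow> nat \<Rightarrow> qpoly set" where
  "harmonic j D = {F. (\<forall>m\<in>keys F. keys m \<subseteq> {1..} \<and> card (keys m) = j \<and> mon_degree m \<le> D)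
     \<and> (\<forall>q h. h > 0 \<longrightarrow> pair (\<lambda>m. if one_step q h m then 1 else 0) F = 0)}"

lemma card_pairs_choice:
  assumes "pairs_disjoint ps" "\<And>k b. (k, b) \<in> set ps \<Longrightarrow> (k \<in> A) \<noteq> (b \<in> A)"
  shows "card (A \<inter> (fst ` set ps \<union> snd ` set ps)) = length ps"
  using assms
proof (induction ps)
  case (Cons p ps)
  obtain k b where p: "p = (k, b)" by fastforce
  let ?B = "A \<inter> (fst ` set ps \<union> snd ` set ps)"
  have dj: "pairs_disjoint ps" "k \<notin> ?B" "b \<notin> ?B"
    using Cons.prems(1) by (auto simp: p pairs_disjoint_Cons)
  have IH: "card ?B = length ps" using Cons dj by auto
  have "(k \<in> A) \<noteq> (b \<in> A)" using Cons.prems(2) p by auto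
  hence "A \<inter> (fst ` set (p # ps) \<union> snd ` set (p # ps)) = insert (if k \<in> A then k else b) ?B"
    by (auto simp: p)
  thus ?case using dj IH by simp
qed simp

lemma single_add_inj: "h > 0 \<Longrightarrow> q + Poly_Mapping.single v h = q + Poly_Mapping.single v' h \<Longrightarrow> v = v'"
  for h :: nat
  by (metis add_left_cancel keys_single less_numeral_extra(3) singleton_inject)

lemma keys_add_single: "v \<notin> keys q \<Longrightarrow> h > 0 \<Longrightarrow> keys (q + Poly_Mapping.single v h) = insert v (keys q)"
  for q :: monomial
  by (auto simp: in_keys_iff lookup_add lookup_single when_def split: if_splits)

text \<open>
  Let every monomial of \<open>X\<close> involve exactly one variable of each pair in \<open>ps\<close>, and let \<open>b\<close> be the
  index of a variable that does not occur in \<open>X\<close>. In the sum of the operators $1 - (k\,b)$ over all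
  \<open>k\<close> outside the pairs, the terms involving \<open>b\<close> cancel by the vanishing of the one-step sums, while
  each monomial survives once for each of its \<open>j - length ps\<close> variables outside the pairs.
\<close>

lemma harmonic_step:
  assumes X: "X \<in> harmonic j D" and dj: "pairs_disjoint ps"
    and supp: "\<And>m k b. m \<in> keys X \<Longrightarrow> (k, b) \<in> set ps \<Longrightarrow> (k \<in> keys m) \<noteq> (b \<in> keys m)"
    and vars: "vars X \<subseteq> V \<union> snd ` set ps" and V: "finite V" "fst ` set ps \<subseteq> V" "snd ` set ps \<inter> V = {}"
    and b: "b \<notin> V" "b \<notin> snd ` set ps"
  shows "(\<Sum>k\<in>V - fst ` set ps. X - poly_act (swp k b) X) = qscale (of_nat (j - length ps)) X"
proof (rule poly_mapping_eqI)
  fix m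
  let ?W = "V - fst ` set ps"
  have bX: "lookup X m' = 0" if "b \<in> keys m'" for m'
    using that vars b by (auto simp: vars_def not_in_keys_iff_lookup_eq_zero[symmetric])
  have L: "lookup (\<Sum>k\<in>?W. X - poly_act (swp k b) X) m
      = (\<Sum>k\<in>?W. lookup X m - lookup X (mperm (swp k b) m))"
    by (simp add: lookup_sum lookup_minus)
  show "lookup (\<Sum>k\<in>?W. X - poly_act (swp k b) X) m = lookup (qscale (of_nat (j - length ps)) X) m"
  proof (cases "b \<in> keys m")
    case False
    have "(\<Sum>k\<in>?W. lookup X m - lookup X (mperm (swp k b) m)) = (\<Sum>k\<in>?W. if k \<in> keys m then lookup X m else 0)"
    proof (intro sum.cong refl)
      fix k assume "k \<in> ?W"
      show "lookup X m - lookup X (mperm (swp k b) m) = (if k \<in> keys m then lookup X m else 0)"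
      proof (cases "k \<in> keys m")
        case True
        hence "b \<in> keys (mperm (swp k b) m)" by (simp add: keys_mperm)
        thus ?thesis using True bX by simp
      next
        case k: False
        thus ?thesis using mperm_swp_fixed[OF k False] by simp
      qed
    qed
    also have "\<dots> = of_nat (card (?W \<inter> keys m)) * lookup X m"
      using V by (simp flip: sum.inter_restrict)
    also have "\<dots> = of_nat (j - length ps) * lookup X m"
    proof (cases "lookup X m = 0")
      case False
      hence m: "m \<in> keys X" by (simp add: in_keys_iff)
      let ?P = "fst ` set ps \<union> snd ` set ps"
      have "keys m \<subseteq> V \<union> snd ` set ps" using vars m by (auto simp: vars_def)
      hence "keys m = (?W \<inter> keys m) \<union> (keys m \<inter> ?P)" by auto
      moreover have "(?W \<inter> keys m) \<inter> (keys m \<inter> ?P) = {}" using V by auto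
      ultimately have "card (keys m) = card (?W \<inter> keys m) + card (keys m \<inter> ?P)"
        by (metis card_Un_disjoint finite_Int finite_keys)
      moreover have "card (keys m \<inter> ?P) = length ps" using supp[OF m] by (intro card_pairs_choice dj) auto
      moreover have "card (keys m) = j" using X m by (simp add: harmonic_def)
      ultimately show ?thesis by simp
    qed simp
    finally show ?thesis using L by simp
  next
    case True
    define h where "h = lookup m b"
    define q where "q = Poly_Mapping.update b 0 m"
    have h: "h > 0" using True by (simp add: h_def in_keys_iff)
    have q: "keys q = keys m - {b}" by (simp add: q_def keys_update)
    have swp: "mperm (swp k b) m = q + Poly_Mapping.single k h" if "k \<notin> keys q" "k \<in> ?W" for k
      using that b by (intro poly_mapping_eqI)
        (auto simp: lookup_add lookup_single when_def q_def h_def lookup_update keys_update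
          Transposition.transpose_def in_keys_iff)
    have "(\<Sum>k\<in>?W. lookup X (mperm (swp k b) m)) = (\<Sum>k\<in>?W - keys q. lookup X (mperm (swp k b) m))"
    proof (rule sum.mono_neutral_right)
      show "\<forall>k\<in>?W - (?W - keys q). lookup X (mperm (swp k b) m) = 0"
        using q by (auto intro!: bX simp: keys_mperm)
    qed (use V in auto)
    also have "\<dots> = (\<Sum>k\<in>?W - keys q. lookup X (q + Poly_Mapping.single k h))"
      by (intro sum.cong refl) (simp add: swp)
    also have "\<dots> = 0"
    proof (cases "\<forall>(k, b)\<in>set ps. (k \<in> keys q) \<noteq> (b \<in> keys q)")
      case good: True
      have "(\<Sum>k\<in>?W - keys q. lookup X (q + Poly_Mapping.single k h))
          = pair (\<lambda>m'. \<Sum>k\<in>?W - keys q. if m' = q + Poly_Mapping.single k h then 1 else 0) X"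
        unfolding lookup_eq_pair by (rule pair_fun_sum)
      also have "\<dots> = pair (\<lambda>m. if one_step q h m then 1 else 0) X"
      proof (rule pair_cong)
        fix m' assume m': "m' \<in> keys X"
        show "(\<Sum>k\<in>?W - keys q. if m' = q + Poly_Mapping.single k h then 1 else 0)
            = (if one_step q h m' then 1 else 0 :: rat)"
        proof (cases "one_step q h m'")
          case True
          then obtain v where v: "v \<notin> keys q" "m' = q + Poly_Mapping.single v h"
            by (auto simp: one_step_def)
          have km: "keys m' = insert v (keys q)" using v h by (simp add: keys_add_single)
          have "v \<notin> fst ` set ps" "v \<notin> snd ` set ps"
            using good supp[OF m'] v(1) unfolding km by fastforce+
          moreover have "v \<in> V \<union> snd ` set ps" using vars m' km by (auto simp: vars_def)
          ultimately have "v \<in> ?W - keys q" using v(1) by blast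
          moreover have "m' = q + Poly_Mapping.single k h \<longleftrightarrow> k = v" for k
            unfolding v(2) using single_add_inj[OF h, of q v k] by blast
          ultimately show ?thesis using True V by simp
        qed (auto simp: one_step_def intro!: sum.neutral)
      qed
      also have "\<dots> = 0" using X h by (simp add: harmonic_def)
      finally show ?thesis .
    next
      case False
      then obtain k' b' where kb: "(k', b') \<in> set ps" "(k' \<in> keys q) = (b' \<in> keys q)" by auto
      hence kb': "k' \<in> fst ` set ps" "b' \<in> snd ` set ps" by force+
      show ?thesis
      proof (rule sum.neutral, intro ballI)
        fix k assume k: "k \<in> ?W - keys q"
        have "k \<noteq> k'" "k \<noteq> b'" using k kb' V by auto
        hence "(k' \<in> keys (q + Poly_Mapping.single k h)) = (b' \<in> keys (q + Poly_Mapping.single k h))"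
          using k h kb by (simp add: keys_add_single)
        thus "lookup X (q + Poly_Mapping.single k h) = 0"
          using supp kb(1) by (metis not_in_keys_iff_lookup_eq_zero)
      qed
    qed
    finally show ?thesis unfolding L using bX[OF True] by (simp add: sum_negf)
  qed
qed

lemma finite_single_monomials:
  "finite K \<Longrightarrow> finite ((\<lambda>m. Poly_Mapping.single m (1::rat)) ` {m. keys m \<subseteq> K \<and> mon_degree m \<le> D})"
  by (intro finite_imageI finite_monomials)

lemma part_harmonic_span:
  assumes "W \<subseteq> harmonic j D"
  shows "part (\<lambda>m. keys m = {1..j}) ` W
    \<subseteq> qpoly.span ((\<lambda>m. Poly_Mapping.single m 1) ` {m. keys m \<subseteq> {1..j} \<and> mon_degree m \<le> D})"
proof (rule image_subsetI)
  fix F assume "F \<in> W"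
  hence "F \<in> harmonic j D" using assms by blast
  thus "part (\<lambda>m. keys m = {1..j}) F
      \<in> qpoly.span ((\<lambda>m. Poly_Mapping.single m 1) ` {m. keys m \<subseteq> {1..j} \<and> mon_degree m \<le> D})"
    by (intro span_singles) (auto simp: keys_part harmonic_def)
qed

lemma ex_fresh: 
  assumes "finite (A :: nat set)"
  obtains b where "b > 0" "b \<notin> A"
proof -
  obtain b where "b \<notin> insert 0 A" using ex_new_if_finite[of "insert 0 A"] assms by auto
  thus ?thesis using that by auto
qed

context var_group
begin

text \<open>
  An invariant space of harmonic polynomials is determined by its restrictions to the monomials with
  variables exactly $x_1, \ldots, x_j$.
\<close>

lemma harmonic_subset_of_part:
  assumes U: "invariant U" "U \<subseteq> harmonic j D" and U': "invariant U'"
  and U'h: "U' \<subseteq> harmonic j D"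
    and part: "part (\<lambda>m. keys m = {1..j}) ` U \<subseteq> part (\<lambda>m. keys m = {1..j}) ` U'"
  shows "U \<subseteq> U'"
proof
  fix F assume F: "F \<in> U"
  hence Fh: "F \<in> harmonic j D" using U by blast
  have vF: "vars F \<subseteq> {1..}" using Fh by (auto simp: harmonic_def vars_def)
  have "\<exists>F'\<in>U'. part (\<lambda>m. keys m = K) F' = part (\<lambda>m. keys m = K) F"
    if K: "K \<subseteq> vars F" "card K = j" for K
  proof -
    define N where "N = Max (insert j (vars F))"
    have "vars F \<subseteq> {1..N}" using vF by (auto simp: N_def intro!: Max_ge)
    moreover have "j \<le> N" by (auto simp: N_def intro!: Max_ge)
    moreover have "K \<subseteq> {1..N}" using K calculation by blast
    ultimately obtain g where g: "g permutes {1..N}" "g ` K = {1..j}"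
      using ex_permutes_image[of "{1..N}" K "{1..j}"] K by (metis atLeastatMost_subset_iff card_atLeastAtMost diff_Suc_1 finite_atLeastAtMost order_refl)
    have gG: "g \<in> G" using g(1) by (rule G_finitary)
    hence bg: "bij g" by simp
    have kk: "keys (mperm (inv g) m) = {1..j} \<longleftrightarrow> keys m = K" for m
      using g(2) bg by (simp add: keys_mperm_inv) (metis bij_is_inj inj_image_eq_iff)
    have "poly_act g F \<in> U" using U F gG by (simp add: invariant_act)
    then obtain F'' where F'': "F'' \<in> U'"
        "part (\<lambda>m. keys m = {1..j}) (poly_act g F) = part (\<lambda>m. keys m = {1..j}) F''"
      using part by blast
    define F' where "F' = poly_act (inv g) F''"
    have "F'' = poly_act g F'" using bg by (simp add: F'_def)
    hence "poly_act g (part (\<lambda>m. keys m = K) F) = poly_act g (part (\<lambda>m. keys m = K) F')"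
      using F''(2) by (simp only: part_poly_act[OF bg] kk)
    hence "part (\<lambda>m. keys m = K) F = part (\<lambda>m. keys m = K) F'"
      using poly_act_inv(2)[OF bg] by metis
    moreover have "F' \<in> U'" using F''(1) U' gG by (simp add: F'_def invariant_act G_inv)
    ultimately show ?thesis by auto
  qed
  then obtain A where A: "A K \<in> U'" "part (\<lambda>m. keys m = K) (A K) = part (\<lambda>m. keys m = K) F"
    if "K \<subseteq> vars F" "card K = j" for K by metis
  define V where "V = vars F \<union> (\<Union>K\<in>Pow (vars F). vars (A K))"
  have finV: "finite V" by (simp add: V_def)
  have main: "alternate ps F \<in> U'"
    if "pairs_disjoint ps" "fst ` set ps \<subseteq> vars F" "snd ` set ps \<inter> V = {}" "0 \<notin> snd ` set ps"
      "length ps \<le> j" for ps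
    using that
  proof (induction "j - length ps" arbitrary: ps)
    case 0
    define K where "K = fst ` set ps"
    have len: "length ps = j" using 0 by simp
    have K: "K \<subseteq> vars F" "card K = j"
      using 0 len by (auto simp: K_def pairs_disjoint_def distinct_card simp flip: set_map)
    have pos: "0 < k \<and> 0 < b" if "(k, b) \<in> set ps" for k b
      using that 0 vF by (metis (no_types, lifting) One_nat_def atLeast_iff fst_conv gr0I image_eqI not_one_le_zero snd_conv subsetD)
    have "alternate ps (F - A K) = 0"
    proof (rule alternate_eq_0[OF 0(2)])
      fix m assume m: "m \<in> keys (F - A K)"
      hence m': "m \<in> keys F \<or> m \<in> keys (A K)" using keys_minus_poly by blast
      have "card (keys m) = j" using m' Fh A(1)[OF K] U'h by (auto simp: harmonic_def)
      moreover have "keys m \<noteq> K"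
        using A(2)[OF K] m by (auto simp: in_keys_iff lookup_minus dest!: arg_cong[where f="\<lambda>F. lookup F m"])
      ultimately have "\<not> K \<subseteq> keys m" using K(2) by (metis card_subset_eq finite_keys)
      then obtain k b where kb: "(k, b) \<in> set ps" "k \<notin> keys m" by (force simp: K_def)
      have "keys m \<subseteq> V" using m' K(1) by (auto simp: V_def vars_def)
      hence "b \<notin> keys m" using kb 0 by force
      thus "\<exists>(k, b)\<in>set ps. k \<notin> keys m \<and> b \<notin> keys m" using kb by blast
    qed
    hence "alternate ps F = alternate ps (A K)" by (simp add: alternate_diff)
    thus ?case using invariant_alternate[OF U' A(1)[OF K] pos] by simp
  next
    case (Suc i)
    \<comment> \<open>By \<open>harmonic_step\<close>, it suffices to treat all lists with one more pair \<open>(k, b)\<close>.\<close>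
    obtain b where b: "b > 0" "b \<notin> V \<union> snd ` set ps" using ex_fresh[of "V \<union> snd ` set ps"] finV by auto
    let ?X = "alternate ps F"
    have pos: "0 < k \<and> 0 < b" if "(k, b) \<in> set ps" for k b
      using that Suc.prems vF by (metis (no_types, lifting) One_nat_def atLeast_iff fst_conv gr0I image_eqI not_one_le_zero snd_conv subsetD)
    have sub: "vars F \<subseteq> V" by (simp add: V_def)
    have "?X \<in> U" by (rule invariant_alternate[OF U(1) F pos])
    hence Xh: "?X \<in> harmonic j D" using U by blast
    have step: "(\<Sum>k\<in>vars F - fst ` set ps. ?X - poly_act (swp k b) ?X) = qscale (of_nat (j - length ps)) ?X"
    proof (rule harmonic_step[OF Xh Suc.prems(1)])
      show "(k \<in> keys m) \<noteq> (b \<in> keys m)" if "m \<in> keys ?X" "(k, b) \<in> set ps" for m k b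
        using alternate_support[OF Suc.prems(1) _ that] Suc.prems sub by blast
      show "vars ?X \<subseteq> vars F \<union> snd ` set ps" using vars_alternate[of ps F] Suc.prems by auto
    qed (use Suc.prems sub b in auto)
    have "?X - poly_act (swp k b) ?X \<in> U'" if k: "k \<in> vars F - fst ` set ps" for k
    proof -
      have "alternate ((k, b) # ps) F \<in> U'"
      proof (rule Suc.hyps(1))
        show "pairs_disjoint ((k, b) # ps)"
          using Suc.prems k b sub by (auto simp: pairs_disjoint_Cons)
      qed (use Suc k b sub in auto)
      thus ?thesis by simp
    qed
    hence "qscale (of_nat (j - length ps)) ?X \<in> U'"
      unfolding step[symmetric] by (intro qpoly.subspace_sum invariant_subspace[OF U'])
    hence "qscale (inverse (of_nat (j - length ps))) (qscale (of_nat (j - length ps)) ?X) \<in> U'"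
      by (rule qpoly.subspace_scale[OF invariant_subspace[OF U']])
    moreover have "qscale (inverse c) (qscale c Y) = Y" if "c \<noteq> 0" for c Y
      by (rule poly_mapping_eqI) (simp add: that)
    moreover have "rat_of_nat (j - length ps) \<noteq> 0" using Suc.hyps(2) by (metis Zero_not_Suc of_nat_eq_0_iff)
    ultimately show ?case by metis
  qed
  show "F \<in> U'" using main[of "[]"] by (simp add: pairs_disjoint_def)
qed

lemma invariant_complement:
  assumes U: "invariant U" "U \<subseteq> harmonic j D" and U0: "invariant U0" "U0 \<subseteq> U"
  obtains U1 where "invariant U1" "U1 \<subseteq> U" "U0 \<inter> U1 = {0}" "\<And>F. F \<in> U \<Longrightarrow> \<exists>F0\<in>U0. \<exists>F1\<in>U1. F = F0 + F1"
proof -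
  let ?r = "part (\<lambda>m. keys m = {1..j})"
  \<comment> \<open>The complement consists of those elements all of whose translates restrict to something
      orthogonal to the restrictions of \<open>U0\<close>.\<close>
  define Q where "Q = {Y. \<forall>g\<in>G. \<forall>F0\<in>U0. ip (?r (poly_act g Y)) F0 = 0}"
  have Q_inv: "invariant Q" unfolding invariant_def
  proof (intro conjI ballI)
    show "qpoly.subspace Q"
      by (auto simp: Q_def qpoly.subspace_def poly_act_add poly_act_qscale part_add part_qscale
          ip_add_left ip_qscale_left)
    fix g F assume "g \<in> G" "F \<in> Q"
    thus "poly_act g F \<in> Q" by (auto simp: Q_def poly_act_comp G_comp)
  qed
  define U1 where "U1 = U \<inter> Q"
  have U1: "invariant U1" using U(1) Q_inv by (auto simp: U1_def invariant_def qpoly.subspace_inter)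
  have U1U: "U1 \<subseteq> U" by (simp add: U1_def)
  have idG: "id \<in> G" by (rule G_finitary[of _ 0]) (simp add: permutes_def)
  have zero: "F = 0" if F: "F \<in> U0" "F \<in> U1" for F
  proof -
    define O1 where "O1 = qpoly.span ((\<lambda>g. poly_act g F) ` G)"
    have O1: "invariant O1" unfolding invariant_def
    proof (intro conjI ballI)
      fix g H assume g: "g \<in> G" and "H \<in> O1"
      from this(2) show "poly_act g H \<in> O1" unfolding O1_def
      proof (induction rule: qpoly.span_induct_alt)
        case (step c x y)
        then obtain g' where "g' \<in> G" "x = poly_act g' F" by blast
        hence "poly_act g x \<in> qpoly.span ((\<lambda>g. poly_act g F) ` G)"
          using g by (auto simp: poly_act_comp intro!: qpoly.span_base imageI G_comp)
        thus ?case using step g by (simp add: poly_act_add poly_act_qscale qpoly.span_add qpoly.span_scale)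
      qed (simp add: qpoly.span_zero)
    qed (simp add: O1_def)
    have sub: "O1 \<subseteq> W" if "invariant W" "F \<in> W" for W
      unfolding O1_def using that by (intro qpoly.span_minimal invariant_subspace) (auto simp: invariant_act)
    note sub = sub[OF U0(1) F(1)] sub[OF U1 F(2)]
    have "?r H = 0" if "H \<in> O1" for H
    proof -
      have "H \<in> Q" "H \<in> U0" using that sub by (auto simp: U1_def)
      hence "ip (?r (poly_act id H)) H = 0" using idG unfolding Q_def by blast
      hence "ip (?r H) (?r H) = 0" by (simp flip: ip_part)
      thus ?thesis by simp
    qed
    hence "?r ` O1 \<subseteq> ?r ` {0}" by auto
    moreover have "invariant {0}" by (auto simp: invariant_def)
    moreover have "O1 \<subseteq> harmonic j D" using sub U U0 by blast
    moreover have "{0} \<subseteq> harmonic j D" by (simp add: harmonic_def)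
    ultimately have "O1 \<subseteq> {0}" using O1 harmonic_subset_of_part by blast
    moreover have "F \<in> O1" unfolding O1_def by (rule qpoly.span_base) (use idG in \<open>force\<close>)
    ultimately show ?thesis by blast
  qed
  define S where "S = {F0 + F1 | F0 F1. F0 \<in> U0 \<and> F1 \<in> U1}"
  have S: "invariant S" unfolding invariant_def S_def
    using qpoly.subspace_sums[OF invariant_subspace[OF U0(1)] invariant_subspace[OF U1]] U0(1) U1
    by (auto simp: poly_act_add) (metis invariant_act)
  have SU: "S \<subseteq> U" unfolding S_def using U0(2) U1U invariant_subspace[OF U(1)]
    by (auto intro!: qpoly.subspace_add)
  have "?r ` U \<subseteq> ?r ` S"
  proof (rule image_subsetI)
    fix F assume F: "F \<in> U"
    have "U0 \<subseteq> harmonic j D" using U0 U by blast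
    from orth_decomp[OF subspace_part_image[OF invariant_subspace[OF U0(1)]] part_harmonic_span[OF this]
        finite_single_monomials]
    obtain y0 where y0: "y0 \<in> ?r ` U0" "\<forall>w\<in>?r ` U0. ip (?r F - y0) w = 0" by blast
    then obtain F0 where F0: "F0 \<in> U0" "y0 = ?r F0" by blast
    define F1 where "F1 = F - F0"
    define y1 where "y1 = ?r F1"
    have F1: "F1 \<in> U" using F F0 U0 invariant_subspace[OF U(1)] by (auto simp: F1_def intro!: qpoly.subspace_diff)
    have y1: "ip y1 H = 0" if "H \<in> U0" for H
    proof -
      have "ip y1 (?r H) = 0" using y0(2) that by (simp add: y1_def F1_def part_diff F0)
      thus ?thesis by (simp add: y1_def flip: ip_part)
    qed
    have y1Q: "y1 \<in> Q" unfolding Q_def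
    proof (intro CollectI ballI)
      fix g H assume g: "g \<in> G" and H: "H \<in> U0"
      hence bg: "bij g" by simp
      show "ip (?r (poly_act g y1)) H = 0"
      proof (cases "g ` {1..j} = {1..j}")
        case True
        have kk: "keys (mperm (inv g) m) = {1..j} \<longleftrightarrow> keys m = {1..j}" for m
          using bg True by (simp add: keys_mperm_inv) (metis bij_is_inj inj_image_eq_iff)
        have "?r (poly_act g y1) = poly_act g y1"
          by (simp only: part_poly_act[OF bg] kk) (simp add: y1_def)
        hence "ip (?r (poly_act g y1)) H = ip y1 (poly_act (inv g) H)" by (simp add: ip_poly_act_left bg)
        also have "\<dots> = 0" using H U0(1) g by (intro y1) (simp add: invariant_act G_inv)
        finally show ?thesis .
      next
        case False
        have "?r (poly_act g y1) = 0"
        proof (rule poly_mapping_eqI)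
          fix m
          have "keys (mperm g m) \<noteq> {1..j}" if "keys m = {1..j}"
          proof
            assume "keys (mperm g m) = {1..j}"
            hence "g -` {1..j} = {1..j}" using that bg by (simp add: keys_mperm)
            hence "g ` {1..j} = {1..j}"
              using surj_image_vimage_eq[OF bij_is_surj[OF bg], of "{1..j}"] by (simp only:)
            thus False using False by (rule notE[rotated])
          qed
          thus "lookup (?r (poly_act g y1)) m = lookup 0 m" using bg by (simp add: y1_def)
        qed
        thus ?thesis by simp
      qed
    qed
    have v1: "vars F1 \<subseteq> {1..}" using F1 U(2) by (auto simp: harmonic_def vars_def subset_iff)
    define N where "N = Max (insert j (vars F1))"
    have N: "j \<le> N" "vars F1 \<subseteq> {1..N}" using v1 by (auto simp: N_def intro!: Max_ge)
    define ps where "ps = map (\<lambda>i. (i, N + i)) [1..<Suc j]"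
    have fst_ps: "fst ` set ps = {1..j}" by (force simp: ps_def image_iff)
    have snd_ps: "x \<in> snd ` set ps \<Longrightarrow> x > N" for x by (auto simp: ps_def)
    have dj: "pairs_disjoint ps" using N
      by (auto simp: pairs_disjoint_def ps_def distinct_map inj_on_def o_def)
    have fresh: "snd ` set ps \<inter> vars F1 = {}" using snd_ps N by fastforce
    have PF: "alternate ps F1 \<in> U" by (rule invariant_alternate[OF U(1) F1]) (auto simp: ps_def)
    \<comment> \<open>The terms of \<open>F1\<close> outside \<open>y1\<close> miss one of the first \<open>j\<close> variables, so only \<open>y1\<close> matters.\<close>
    have "alternate ps (F1 - y1) = 0"
    proof (rule alternate_eq_0[OF dj])
      fix m assume "m \<in> keys (F1 - y1)"
      hence m: "m \<in> keys F1" "keys m \<noteq> {1..j}" by (auto simp: y1_def in_keys_iff lookup_minus split: if_splits)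
      moreover have "card (keys m) = j" using m F1 U(2) by (auto simp: harmonic_def)
      ultimately have "\<not> {1..j} \<subseteq> keys m"
        by (metis card_atLeastAtMost card_subset_eq diff_Suc_1 finite_keys)
      then obtain k where k: "k \<in> fst ` set ps" "k \<notin> keys m" unfolding fst_ps[symmetric] by blast
      then obtain b where kb: "(k, b) \<in> set ps" "k \<notin> keys m" by auto
      moreover have "b \<notin> keys m" using kb fresh m by (force simp: vars_def)
      ultimately show "\<exists>(k, b)\<in>set ps. k \<notin> keys m \<and> b \<notin> keys m" by blast
    qed
    hence "alternate ps F1 = alternate ps y1" by (simp add: alternate_diff)
    moreover have "alternate ps y1 \<in> Q" by (rule invariant_alternate[OF Q_inv y1Q]) (auto simp: ps_def)
    ultimately have PU1: "alternate ps F1 \<in> U1" using PF by (simp add: U1_def)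
    have "?r (alternate ps F1) = ?r F1"
      by (rule poly_mapping_eqI) (simp add: lookup_alternate[OF dj fresh] fst_ps)
    hence "?r F = ?r (F0 + alternate ps F1)" by (simp add: part_add) (simp add: F1_def part_diff)
    thus "?r F \<in> ?r ` S" using F0 PU1 by (auto simp: S_def)
  qed
  hence "U \<subseteq> S" using harmonic_subset_of_part[OF U S _] SU U(2) by blast
  hence dec: "\<exists>F0\<in>U0. \<exists>F1\<in>U1. F = F0 + F1" if "F \<in> U" for F
    using that unfolding S_def by blast
  have "U0 \<inter> U1 = {0}"
    using zero qpoly.subspace_0[OF invariant_subspace[OF U0(1)]] qpoly.subspace_0[OF invariant_subspace[OF U1]]
    by blast
  thus ?thesis using that[OF U1 U1U _ dec] by blast
qed

text \<open>Irreducible sub-representations of the space of all polynomials.\<close>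

definition irreducible :: "qpoly set \<Rightarrow> bool" where
  "irreducible S \<longleftrightarrow> invariant S \<and> S \<noteq> {0} \<and> (\<forall>V. invariant V \<and> V \<subseteq> S \<longrightarrow> V = {0} \<or> V = S)"

lemma harmonic_semisimple:
  assumes "invariant U" "U \<subseteq> harmonic j D"
  shows "\<exists>\<S>. finite \<S> \<and> (\<forall>S\<in>\<S>. irreducible S \<and> S \<subseteq> U) \<and> U \<subseteq> qpoly.span (\<Union>\<S>)"
  using assms
proof (induction "qpoly.dim (part (\<lambda>m. keys m = {1..j}) ` U)" arbitrary: U rule: less_induct)
  case (less U)
  let ?r = "part (\<lambda>m. keys m = {1..j})"
  \<comment> \<open>The dimension of the restrictions measures the length of an invariant subspace.\<close>
  have dim: "qpoly.dim (?r ` V) < qpoly.dim (?r ` W)"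
    if "invariant V" "invariant W" "V \<subset> W" "W \<subseteq> harmonic j D" for V W
  proof (rule dim_strict_mono[OF _ _ _ part_harmonic_span[OF that(4)] finite_single_monomials])
    have "\<not> ?r ` W \<subseteq> ?r ` V" using harmonic_subset_of_part[OF that(2,4,1)] that by blast
    thus "?r ` V \<subset> ?r ` W" using that by blast
  qed (use that in \<open>simp_all add: subspace_part_image invariant_subspace\<close>)
  have inv0: "invariant {0}" by (auto simp: invariant_def)
  show ?case
  proof (cases "U = {0}")
    case True
    thus ?thesis by (intro exI[of _ "{}"]) (simp add: qpoly.span_zero)
  next
    case False
    define X where "X = {V. invariant V \<and> V \<subseteq> U \<and> V \<noteq> {0}}"
    have "U \<in> X" using False less.prems by (simp add: X_def)
    then obtain S where S: "S \<in> X" "\<And>V. V \<in> X \<Longrightarrow> qpoly.dim (?r ` S) \<le> qpoly.dim (?r ` V)"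
      using ex_has_least_nat[of "\<lambda>V. V \<in> X" U "\<lambda>V. qpoly.dim (?r ` V)"] by blast
    have Sh: "invariant S" "S \<subseteq> U" "S \<noteq> {0}" using S(1) by (auto simp: X_def)
    have irr: "irreducible S" unfolding irreducible_def
    proof (intro conjI allI impI Sh)
      fix V assume V: "invariant V \<and> V \<subseteq> S"
      show "V = {0} \<or> V = S"
      proof (rule ccontr)
        assume c: "\<not> (V = {0} \<or> V = S)"
        hence "V \<in> X" using V Sh by (auto simp: X_def)
        from S(2)[OF this] dim[of V S] V c Sh less.prems show False by auto
      qed
    qed
    obtain U1 where U1: "invariant U1" "U1 \<subseteq> U" "S \<inter> U1 = {0}"
      "\<And>F. F \<in> U \<Longrightarrow> \<exists>F0\<in>S. \<exists>F1\<in>U1. F = F0 + F1"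
      using invariant_complement[OF less.prems Sh(1,2)] by blast
    have "U1 \<noteq> U" using U1(3) Sh by blast
    hence "qpoly.dim (?r ` U1) < qpoly.dim (?r ` U)" using dim[of U1 U] U1 less.prems by blast
    from less.hyps[OF this U1(1) order.trans[OF U1(2) less.prems(2)]]
    obtain \<S> where \<S>: "finite \<S>" "\<forall>S\<in>\<S>. irreducible S \<and> S \<subseteq> U1" "U1 \<subseteq> qpoly.span (\<Union>\<S>)"
      by (elim exE conjE)
    have "U \<subseteq> qpoly.span (\<Union>(insert S \<S>))"
    proof
      fix F assume "F \<in> U"
      then obtain F0 F1 where F: "F0 \<in> S" "F1 \<in> U1" "F = F0 + F1" using U1(4) by blast
      have "F0 \<in> qpoly.span (\<Union>(insert S \<S>))" using F by (auto intro: qpoly.span_base)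
      moreover have "F1 \<in> qpoly.span (\<Union>(insert S \<S>))"
        using F \<S>(3) qpoly.span_mono[of "\<Union>\<S>" "\<Union>(insert S \<S>)"] by blast
      ultimately show "F \<in> qpoly.span (\<Union>(insert S \<S>))" using F by (simp add: qpoly.span_add)
    qed
    moreover have "\<forall>T\<in>insert S \<S>. irreducible T \<and> T \<subseteq> U" using \<S>(2) irr Sh(2) U1(2) by blast
    moreover have "finite (insert S \<S>)" using \<S>(1) by simp
    ultimately show ?thesis by blast
  qed
qed

end

section \<open>Contraction coefficients\<close>

text \<open>The monomial \<open>m\<close> agrees with \<open>q\<close> on the variables of \<open>q\<close>.\<close>

definition extends :: "monomial \<Rightarrow> monomial \<Rightarrow> bool" where
  "extends q m \<longleftrightarrow> (\<forall>i\<in>keys q. lookup m i = lookup q i)"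

text \<open>
  The contraction coefficient at \<open>(\<mu>, q)\<close>: the sum of the coefficients of the monomials of content
  \<open>\<mu>\<close> that agree with \<open>q\<close> on the variables of \<open>q\<close>.
\<close>

definition contr_coeff :: "nat multiset \<Rightarrow> monomial \<Rightarrow> qpoly \<Rightarrow> rat" where
  "contr_coeff \<mu> q = pair (\<lambda>m. if mon_content m = \<mu> \<and> extends q m then 1 else 0)"

lemma extends_keys: "extends q m \<Longrightarrow> keys q \<subseteq> keys m"
  by (auto simp: extends_def in_keys_iff)

lemma extends_mperm: "bij \<sigma> \<Longrightarrow> extends q (mperm (inv \<sigma>) m) \<longleftrightarrow> extends (mperm \<sigma> q) m"
proof -
  assume \<sigma>: "bij \<sigma>"
  have "keys (mperm \<sigma> q) = inv \<sigma> ` keys q"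
    using keys_mperm_inv[of "inv \<sigma>" q] \<sigma> by (simp add: bij_imp_bij_inv inv_inv_eq)
  thus ?thesis using \<sigma> by (simp add: extends_def bij_imp_bij_inv bij_is_surj surj_f_inv_f)
qed

lemma contr_coeff_poly_act: "bij \<sigma> \<Longrightarrow> contr_coeff \<mu> q (poly_act \<sigma> F) = contr_coeff \<mu> (mperm \<sigma> q) F"
  by (simp add: contr_coeff_def pair_poly_act extends_mperm bij_imp_bij_inv)

lemma contr_coeff_add: "contr_coeff \<mu> q (F + G) = contr_coeff \<mu> q F + contr_coeff \<mu> q G" by (simp add: contr_coeff_def pair_add)
lemma contr_coeff_diff: "contr_coeff \<mu> q (F - G) = contr_coeff \<mu> q F - contr_coeff \<mu> q G" by (simp add: contr_coeff_def pair_diff)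
lemma contr_coeff_uminus: "contr_coeff \<mu> q (- F) = - contr_coeff \<mu> q F" by (simp add: contr_coeff_def pair_uminus)
lemma contr_coeff_qscale: "contr_coeff \<mu> q (qscale c F) = c * contr_coeff \<mu> q F" by (simp add: contr_coeff_def pair_qscale)
lemma contr_coeff_zero [simp]: "contr_coeff \<mu> q 0 = 0" by (simp add: contr_coeff_def)

lemma contr_coeff_nonzero:
  assumes "contr_coeff \<mu> q F \<noteq> 0"
  obtains m where "m \<in> keys F" "mon_content m = \<mu>" "extends q m"
proof -
  have "\<exists>m\<in>keys F. mon_content m = \<mu> \<and> extends q m"
  proof (rule ccontr)
    assume "\<not> ?thesis"
    hence "contr_coeff \<mu> q F = 0" unfolding contr_coeff_def by (intro pair_eq_0I) auto
    thus False using assms by simp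
  qed
  thus ?thesis using that by blast
qed

text \<open>
  The description of the filtration by contraction coefficients; the content \<open>\<mu>\<close> and the monomial
  \<open>q\<close> are arbitrary, as the coefficient vanishes unless some monomial of \<open>F\<close> fits.
\<close>

definition contr_filt :: "int \<Rightarrow> qpoly set" where
  "contr_filt g = {F. \<forall>\<mu> q. int (card (keys q)) < int (size \<mu>) - g \<longrightarrow> contr_coeff \<mu> q F = 0}"

lemma contr_filt_subspace: "qpoly.subspace (contr_filt g)"
  by (auto simp: qpoly.subspace_def contr_filt_def contr_coeff_add contr_coeff_qscale)

lemma contr_filt_poly_act: "bij \<sigma> \<Longrightarrow> F \<in> contr_filt g \<Longrightarrow> poly_act \<sigma> F \<in> contr_filt g"
  by (auto simp: contr_filt_def contr_coeff_poly_act card_keys_mperm)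

lemma contr_filt_mono: "g \<le> g' \<Longrightarrow> contr_filt g \<subseteq> contr_filt g'"
  by (auto simp: contr_filt_def)

lemma contr_coeff_part_content:
  "contr_coeff \<nu> q (part (\<lambda>m. mon_content m = \<mu>) F) = (if \<nu> = \<mu> then contr_coeff \<nu> q F else 0)"
  unfolding contr_coeff_def pair_part by (auto intro!: pair_cong pair_eq_0I)

lemma contr_filt_part: "F \<in> contr_filt g \<Longrightarrow> part (\<lambda>m. mon_content m = \<mu>) F \<in> contr_filt g"
  by (auto simp: contr_filt_def contr_coeff_part_content)

text \<open>The part of the monomial \<open>m\<close> with variables in \<open>K\<close>.\<close>

definition restrict_mon :: "nat set \<Rightarrow> monomial \<Rightarrow> monomial" where
  "restrict_mon K m = (\<Sum>i\<in>keys m \<inter> K. Poly_Mapping.single i (lookup m i))"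

lemma lookup_restrict_mon [simp]: "lookup (restrict_mon K m) i = (if i \<in> K then lookup m i else 0)"
  by (auto simp: restrict_mon_def lookup_sum lookup_single when_def in_keys_iff sum.delta')

lemma keys_restrict_mon: "keys (restrict_mon K m) = keys m \<inter> K"
  by (auto simp: in_keys_iff split: if_splits)

lemma restrict_mon_eq_iff:
  assumes "K \<subseteq> keys m"
  shows "restrict_mon K m = q \<longleftrightarrow> K = keys q \<and> extends q m"
proof
  assume "restrict_mon K m = q"
  hence "keys q = K" "\<And>i. lookup q i = lookup (restrict_mon K m) i" using keys_restrict_mon[of K m] assms by auto
  thus "K = keys q \<and> extends q m" by (auto simp: extends_def)
next
  assume "K = keys q \<and> extends q m"
  thus "restrict_mon K m = q" by (intro poly_mapping_eqI) (auto simp: extends_def in_keys_iff)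
qed

text \<open>
  The polynomial formed by the contraction coefficients for \<open>\<mu>\<close> with exactly \<open>j\<close> variables
  (see \<open>lookup_contraction\<close>): each monomial of content \<open>\<mu>\<close> is replaced by the sum of its parts in \<open>j\<close>
  of its variables.
\<close>

definition contraction :: "nat multiset \<Rightarrow> nat \<Rightarrow> qpoly \<Rightarrow> qpoly" where
  "contraction \<mu> j F = (\<Sum>m\<in>{m \<in> keys F. mon_content m = \<mu>}. \<Sum>K\<in>{K. K \<subseteq> keys m \<and> card K = j}.
      Poly_Mapping.single (restrict_mon K m) (lookup F m))"

lemma pair_contraction: "pair \<phi> (contraction \<mu> j F)
    = pair (\<lambda>m. if mon_content m = \<mu> then \<Sum>K\<in>{K. K \<subseteq> keys m \<and> card K = j}. \<phi> (restrict_mon K m) else 0) F"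
  unfolding contraction_def pair_sum pair_single pair_def[of _ F]
  by (simp add: sum.inter_filter[symmetric] if_distrib sum_distrib_left cong: if_cong)

lemma lookup_contraction [simp]: "lookup (contraction \<mu> j F) q = (if card (keys q) = j then contr_coeff \<mu> q F else 0)"
proof -
  have *: "(\<Sum>K\<in>{K. K \<subseteq> keys m \<and> card K = j}. if restrict_mon K m = q then 1 else 0)
      = (if card (keys q) = j \<and> extends q m then 1 else 0 :: rat)" for m
  proof -
    have fin: "finite {K. K \<subseteq> keys m \<and> card K = j}" by (rule finite_subset[of _ "Pow (keys m)"]) auto
    have "(\<Sum>K\<in>{K. K \<subseteq> keys m \<and> card K = j}. if restrict_mon K m = q then 1 else 0)
        = (\<Sum>K\<in>{K. K \<subseteq> keys m \<and> card K = j}. if K = keys q then (if extends q m then 1 else 0) else 0 :: rat)"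
    proof (intro sum.cong refl)
      fix K assume "K \<in> {K. K \<subseteq> keys m \<and> card K = j}"
      hence "restrict_mon K m = q \<longleftrightarrow> K = keys q \<and> extends q m" by (intro restrict_mon_eq_iff) simp
      thus "(if restrict_mon K m = q then 1 else 0) = (if K = keys q then (if extends q m then 1 else 0) else 0 :: rat)"
        by auto
    qed
    thus ?thesis using fin extends_keys[of q m] by auto
  qed
  have "lookup (contraction \<mu> j F) q
      = pair (\<lambda>m. if mon_content m = \<mu> then if card (keys q) = j \<and> extends q m then 1 else 0 else 0) F"
    unfolding lookup_eq_pair[of "contraction \<mu> j F" q] pair_contraction * ..
  also have "\<dots> = (if card (keys q) = j then contr_coeff \<mu> q F else 0)"
  proof (cases "card (keys q) = j")
    case True
    thus ?thesis unfolding contr_coeff_def by (simp only: if_True simp_thms) (rule pair_cong, simp)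
  qed (auto intro!: pair_eq_0I)
  finally show ?thesis .
qed

lemma contraction_add: "contraction \<mu> j (F + G) = contraction \<mu> j F + contraction \<mu> j G"
  by (rule poly_mapping_eqI) (simp add: lookup_add contr_coeff_add)
lemma contraction_diff: "contraction \<mu> j (F - G) = contraction \<mu> j F - contraction \<mu> j G"
  by (rule poly_mapping_eqI) (simp add: lookup_minus contr_coeff_diff)
lemma contraction_qscale: "contraction \<mu> j (qscale c F) = qscale c (contraction \<mu> j F)"
  by (rule poly_mapping_eqI) (simp add: contr_coeff_qscale)
lemma contraction_zero [simp]: "contraction \<mu> j 0 = 0"
  by (rule poly_mapping_eqI) simp
lemma contraction_poly_act: "bij \<sigma> \<Longrightarrow> contraction \<mu> j (poly_act \<sigma> F) = poly_act \<sigma> (contraction \<mu> j F)"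
  by (rule poly_mapping_eqI) (simp add: contr_coeff_poly_act card_keys_mperm)

lemma contraction_part_content:
  "contraction \<nu> j (part (\<lambda>m. mon_content m = \<mu>) F) = (if \<nu> = \<mu> then contraction \<nu> j F else 0)"
  by (auto intro!: poly_mapping_eqI simp: contr_coeff_part_content)

lemma count_mon_content: "count (mon_content m) h = card {v \<in> keys m. lookup m v = h}"
  by (simp add: mon_content_def count_image_mset' Collect_conj_eq Int_commute vimage_def)
   (simp add: Collect_conj_eq Int_commute eq_commute)

lemma card_one_step:
  assumes "h > 0" "card (keys q) + 1 = j"
  shows "card {K. K \<subseteq> keys m \<and> card K = j \<and> one_step q h (restrict_mon K m)}
    = (if extends q m then count (mon_content m) h - count (mon_content q) h else 0)"
proof (cases "extends q m")
  case True
  have km: "keys q \<subseteq> keys m" using extends_keys[OF True] .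
  let ?V = "{v \<in> keys m. lookup m v = h} - {v \<in> keys q. lookup q v = h}"
  have V: "v \<in> ?V \<longleftrightarrow> v \<in> keys m \<and> lookup m v = h \<and> v \<notin> keys q" for v
    using True by (auto simp: extends_def)
  have "{K. K \<subseteq> keys m \<and> card K = j \<and> one_step q h (restrict_mon K m)} = (\<lambda>v. insert v (keys q)) ` ?V"
  proof (intro equalityI subsetI)
    fix K assume "K \<in> {K. K \<subseteq> keys m \<and> card K = j \<and> one_step q h (restrict_mon K m)}"
    then obtain v where K: "K \<subseteq> keys m" and v: "v \<notin> keys q" "restrict_mon K m = q + Poly_Mapping.single v h"
      by (auto simp: one_step_def)
    have "keys (restrict_mon K m) = insert v (keys q)" using v assms by (simp add: keys_add_single)
    hence Kq: "K = insert v (keys q)" using K by (auto simp: keys_restrict_mon)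
    have "lookup (restrict_mon K m) v = h" using v by (simp add: lookup_add in_keys_iff)
    hence "lookup m v = h" using Kq by simp
    hence "v \<in> ?V" using v K Kq V by blast
    thus "K \<in> (\<lambda>v. insert v (keys q)) ` ?V" using Kq by blast
  next
    fix K assume "K \<in> (\<lambda>v. insert v (keys q)) ` ?V"
    then obtain v where v: "v \<in> keys m" "lookup m v = h" "v \<notin> keys q" "K = insert v (keys q)" using V by blast
    have "restrict_mon K m = q + Poly_Mapping.single v h"
      using v True by (intro poly_mapping_eqI) (auto simp: lookup_add lookup_single when_def extends_def in_keys_iff)
    thus "K \<in> {K. K \<subseteq> keys m \<and> card K = j \<and> one_step q h (restrict_mon K m)}"
      using v km assms by (auto simp: one_step_def)
  qed
  moreover have "inj_on (\<lambda>v. insert v (keys q)) ?V" using V by (auto simp: inj_on_def)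
  ultimately have "card {K. K \<subseteq> keys m \<and> card K = j \<and> one_step q h (restrict_mon K m)} = card ?V"
    by (simp add: card_image)
  also have "{v \<in> keys q. lookup q v = h} \<subseteq> {v \<in> keys m. lookup m v = h}"
    using km True by (auto simp: extends_def)
  hence "card ?V = count (mon_content m) h - count (mon_content q) h"
    by (subst card_Diff_subset) (auto simp: count_mon_content)
  finally show ?thesis using True by simp
next
  case False
  have "\<not> one_step q h (restrict_mon K m)" if "K \<subseteq> keys m" for K
  proof
    assume "one_step q h (restrict_mon K m)"
    then obtain v where v: "v \<notin> keys q" "restrict_mon K m = q + Poly_Mapping.single v h" by (auto simp: one_step_def)
    have "lookup m i = lookup q i" if "i \<in> keys q" for i
    proof -
      have "i \<in> keys (restrict_mon K m)" using v assms that by (simp add: keys_add_single)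
      hence "lookup m i = lookup (restrict_mon K m) i" by (simp add: keys_restrict_mon)
      also have "\<dots> = lookup q i" using v that by (auto simp: lookup_add lookup_single when_def)
      finally show ?thesis .
    qed
    thus False using False by (simp add: extends_def)
  qed
  hence "{K. K \<subseteq> keys m \<and> card K = j \<and> one_step q h (restrict_mon K m)} = {}" by blast
  thus ?thesis using False by simp
qed

text \<open>
  For \<open>m\<close> of content \<open>\<mu>\<close> agreeing with \<open>q\<close> on the variables of \<open>q\<close>, the number of parts of \<open>m\<close>
  that arise from \<open>q\<close> by adjoining a variable with exponent \<open>h\<close> depends on \<open>\<mu>\<close> and \<open>q\<close> only. So a
  one-step sum of the contraction is a multiple of a contraction coefficient with \<open>j - 1\<close>
  variables.
\<close>

lemma contraction_harmonic:
  assumes F: "F \<in> contr_filt g" "F \<in> hom_polys {1..} d" and j: "int (size \<mu>) - g = int j"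
  shows "contraction \<mu> j F \<in> harmonic j d"
  unfolding harmonic_def
proof (intro CollectI conjI ballI allI impI)
  fix q assume q: "q \<in> keys (contraction \<mu> j F)"
  hence "contr_coeff \<mu> q F \<noteq> 0" "card (keys q) = j" by (auto simp: in_keys_iff split: if_splits)
  then obtain m where m: "m \<in> keys F" "extends q m" using contr_coeff_nonzero by blast
  have sub: "keys q \<subseteq> keys m" by (rule extends_keys[OF m(2)])
  have km: "keys m \<subseteq> {1..}" "mon_degree m = d" using F(2) m(1) by (auto simp: hom_polys_def)
  show "keys q \<subseteq> {1..}" using sub km by blast
  have "mon_degree q = (\<Sum>i\<in>keys q. lookup m i)"
    using m(2) by (auto simp: mon_degree_def extends_def intro!: sum.cong)
  also have "\<dots> \<le> mon_degree m" unfolding mon_degree_def using sub by (intro sum_mono2) auto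
  finally show "mon_degree q \<le> d" using km by simp
next
  fix q assume "q \<in> keys (contraction \<mu> j F)"
  thus "card (keys q) = j" by (auto simp: in_keys_iff split: if_splits)
next
  fix q :: monomial and h :: nat assume h: "0 < h"
  show "pair (\<lambda>m. if one_step q h m then 1 else 0) (contraction \<mu> j F) = 0"
  proof (cases "card (keys q) + 1 = j")
    case False
    show ?thesis
    proof (rule pair_eq_0I)
      fix m assume "m \<in> keys (contraction \<mu> j F)"
      hence "card (keys m) = j" by (auto simp: in_keys_iff split: if_splits)
      hence "\<not> one_step q h m" using False h by (auto simp: one_step_def keys_add_single)
      thus "(if one_step q h m then 1 else 0 :: rat) = 0" by simp
    qed
  next
    case True
    define c where "c = rat_of_nat (count \<mu> h - count (mon_content q) h)"
    have "(\<Sum>K\<in>{K. K \<subseteq> keys m \<and> card K = j}. if one_step q h (restrict_mon K m) then 1 else 0)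
        = (if extends q m then c else 0)" if "mon_content m = \<mu>" for m
    proof -
      have fin: "finite {K. K \<subseteq> keys m \<and> card K = j}" by (rule finite_subset[of _ "Pow (keys m)"]) auto
      have "(\<Sum>K\<in>{K. K \<subseteq> keys m \<and> card K = j}. if one_step q h (restrict_mon K m) then 1 else 0)
          = rat_of_nat (card {K. K \<subseteq> keys m \<and> card K = j \<and> one_step q h (restrict_mon K m)})"
        using fin by (simp add: sum.inter_filter[symmetric] conj_assoc)
      thus ?thesis using card_one_step[OF h True, of m] that by (simp add: c_def)
    qed
    hence "pair (\<lambda>m. if one_step q h m then 1 else 0) (contraction \<mu> j F)
        = pair (\<lambda>m. c * (if mon_content m = \<mu> \<and> extends q m then 1 else 0)) F"
      unfolding pair_contraction by (intro pair_cong) auto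
    also have "\<dots> = c * contr_coeff \<mu> q F" by (simp add: pair_fun_cmult contr_coeff_def)
    also have "contr_coeff \<mu> q F = 0" using F(1) j True by (auto simp: contr_filt_def)
    finally show ?thesis by simp
  qed
qed

text \<open>
  Passing from \<open>g\<close> to \<open>g - 1\<close> imposes exactly the additional conditions that the contractions to
  \<open>size \<mu> - g\<close> variables vanish.
\<close>

lemma contr_filt_kernel:
  assumes "F \<in> contr_filt g"
  shows "F \<in> contr_filt (g - 1) \<longleftrightarrow> (\<forall>\<mu> j. int (size \<mu>) - g = int j \<longrightarrow> contraction \<mu> j F = 0)"
proof
  assume F: "F \<in> contr_filt (g - 1)"
  show "\<forall>\<mu> j. int (size \<mu>) - g = int j \<longrightarrow> contraction \<mu> j F = 0"
    using F by (auto intro!: poly_mapping_eqI simp: contr_filt_def)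
next
  assume k: "\<forall>\<mu> j. int (size \<mu>) - g = int j \<longrightarrow> contraction \<mu> j F = 0"
  show "F \<in> contr_filt (g - 1)" unfolding contr_filt_def
  proof (intro CollectI allI impI)
    fix \<mu> :: "nat multiset" and q :: monomial assume q: "int (card (keys q)) < int (size \<mu>) - (g - 1)"
    show "contr_coeff \<mu> q F = 0"
    proof (cases "int (card (keys q)) < int (size \<mu>) - g")
      case True thus ?thesis using assms by (simp add: contr_filt_def)
    next
      case False
      hence "contraction \<mu> (card (keys q)) F = 0" using k q by auto
      hence "lookup (contraction \<mu> (card (keys q)) F) q = 0" by simp
      thus ?thesis by simp
    qed
  qed
qed

text \<open>
  The contraction coefficient at \<open>q\<close> is, up to a positive factor, the sum of those at the monomials
  with one more variable.
\<close>

lemma contr_coeff_extend: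
  assumes "contr_coeff \<mu> q F \<noteq> 0" "card (keys q) < size \<mu>"
  obtains q' where "card (keys q') = Suc (card (keys q))" "contr_coeff \<mu> q' F \<noteq> 0"
proof -
  define S where "S = (\<Union>m\<in>keys F. (\<lambda>v. (v, lookup m v)) ` (keys m - keys q))"
  have S: "finite S" "\<And>v h. (v, h) \<in> S \<Longrightarrow> v \<notin> keys q \<and> h > 0" by (auto simp: S_def in_keys_iff)
  have "(\<Sum>(v, h)\<in>S. contr_coeff \<mu> (q + Poly_Mapping.single v h) F)
      = pair (\<lambda>m. \<Sum>p\<in>S. if mon_content m = \<mu> \<and> extends (q + Poly_Mapping.single (fst p) (snd p)) m then 1 else 0) F"
    unfolding contr_coeff_def case_prod_beta by (rule pair_fun_sum)
  also have "\<dots> = pair (\<lambda>m. rat_of_nat (size \<mu> - card (keys q)) * (if mon_content m = \<mu> \<and> extends q m then 1 else 0)) F"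
  proof (rule pair_cong)
    fix m assume m: "m \<in> keys F"
    have ext: "extends (q + Poly_Mapping.single v h) m \<longleftrightarrow> extends q m \<and> lookup m v = h"
      if "(v, h) \<in> S" for v h
      using S(2)[OF that]
      by (auto simp: extends_def keys_add_single lookup_add lookup_single when_def in_keys_iff)
    show "(\<Sum>p\<in>S. if mon_content m = \<mu> \<and> extends (q + Poly_Mapping.single (fst p) (snd p)) m then 1 else 0)
        = rat_of_nat (size \<mu> - card (keys q)) * (if mon_content m = \<mu> \<and> extends q m then 1 else 0)"
    proof (cases "mon_content m = \<mu> \<and> extends q m")
      case True
      have "{p \<in> S. extends (q + Poly_Mapping.single (fst p) (snd p)) m} = (\<lambda>v. (v, lookup m v)) ` (keys m - keys q)"
      proof (intro equalityI subsetI)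
        fix p assume p: "p \<in> {p \<in> S. extends (q + Poly_Mapping.single (fst p) (snd p)) m}"
        obtain v h where vh: "p = (v, h)" by fastforce
        have "(v, h) \<in> S" using p vh by simp
        moreover from this have "lookup m v = h" using ext[of v h] p vh by simp
        ultimately have "v \<in> keys m - keys q" using S(2)[of v h] by (auto simp: in_keys_iff)
        thus "p \<in> (\<lambda>v. (v, lookup m v)) ` (keys m - keys q)" using vh \<open>lookup m v = h\<close> by blast
      next
        fix p assume "p \<in> (\<lambda>v. (v, lookup m v)) ` (keys m - keys q)"
        then obtain v where v: "v \<in> keys m - keys q" "p = (v, lookup m v)" by blast
        hence "(v, lookup m v) \<in> S" using m unfolding S_def by blast
        thus "p \<in> {p \<in> S. extends (q + Poly_Mapping.single (fst p) (snd p)) m}"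
          using ext[of v "lookup m v"] v True by simp
      qed
      moreover have "card ((\<lambda>v. (v, lookup m v)) ` (keys m - keys q)) = card (keys m - keys q)"
        by (intro card_image) (auto simp: inj_on_def)
      moreover have "card (keys m - keys q) = size \<mu> - card (keys q)"
        using True extends_keys[of q m] by (auto simp: card_Diff_subset)
      ultimately show ?thesis using True S(1) by (simp add: sum.inter_filter[symmetric])
    next
      case False
      thus ?thesis using ext by (auto intro!: sum.neutral)
    qed
  qed
  also have "\<dots> = rat_of_nat (size \<mu> - card (keys q)) * contr_coeff \<mu> q F"
    by (simp add: pair_fun_cmult contr_coeff_def)
  also have "\<dots> \<noteq> 0" using assms by simp
  finally obtain p where p: "p \<in> S" "(case p of (v, h) \<Rightarrow> contr_coeff \<mu> (q + Poly_Mapping.single v h) F) \<noteq> 0"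
    by (rule sum.not_neutral_contains_not_neutral)
  obtain v h where "p = (v, h)" by fastforce
  with p have vh: "(v, h) \<in> S" "contr_coeff \<mu> (q + Poly_Mapping.single v h) F \<noteq> 0" by simp_all
  thus ?thesis using that[of "q + Poly_Mapping.single v h"] S(2)[OF vh(1)] by (simp add: keys_add_single)
qed

lemma contr_coeff_extend_to:
  assumes "contr_coeff \<mu> q F \<noteq> 0" "card (keys q) \<le> j" "j \<le> size \<mu>"
  obtains q' where "card (keys q') = j" "contr_coeff \<mu> q' F \<noteq> 0"
  using assms(2) assms(3) that
proof (induction j arbitrary: thesis rule: dec_induct)
  case base thus ?case using assms(1) by blast
next
  case (step n)
  obtain q' where "card (keys q') = n" "contr_coeff \<mu> q' F \<noteq> 0" using step by (metis Suc_leD)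
  thus ?case using contr_coeff_extend[of \<mu> q' F] step.prems by auto
qed

lemma contr_coeff_alternate_eq_0:
  assumes "\<And>q. card (keys q) = c \<Longrightarrow> contr_coeff \<nu> q F = 0" "card (keys q) = c"
  shows "contr_coeff \<nu> q (alternate ps F) = 0"
  using assms(2)
proof (induction ps arbitrary: q)
  case (Cons p ps)
  obtain k b where p: "p = (k, b)" by fastforce
  show ?case using Cons by (simp add: p contr_coeff_diff contr_coeff_poly_act card_keys_mperm)
qed (use assms(1) in simp)

text \<open>
  If \<open>q\<close> has fewer variables than there are pairs, some pair avoids \<open>q\<close>; its transposition fixes
  \<open>q\<close> but negates \<open>alternate ps F\<close>.
\<close>

lemma contr_coeff_alternate_pigeonhole:
  assumes dj: "pairs_disjoint ps" and "card (keys q) < length ps"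
  shows "contr_coeff \<nu> q (alternate ps F) = 0"
proof -
  have "\<exists>(k, b)\<in>set ps. k \<notin> keys q \<and> b \<notin> keys q"
  proof (rule ccontr)
    assume n: "\<not> ?thesis"
    define c where "c p = (if fst p \<in> keys q then fst p else snd p)" for p :: "nat \<times> nat"
    have "inj_on c (set ps)"
    proof (rule inj_onI)
      fix x y assume xy: "x \<in> set ps" "y \<in> set ps" "c x = c y"
      have d: "distinct (map fst ps)" "distinct (map snd ps)" "fst ` set ps \<inter> snd ` set ps = {}"
        using dj by (auto simp: pairs_disjoint_def)
      have "fst x \<noteq> snd y" "fst y \<noteq> snd x" using d(3) xy by blast+
      hence "fst x = fst y \<or> snd x = snd y" using xy(3) by (auto simp: c_def split: if_splits)
      thus "x = y" using d(1,2) xy(1,2) by (auto simp: distinct_map dest: inj_onD)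
    qed
    moreover have "c ` set ps \<subseteq> keys q" using n by (auto simp: c_def)
    ultimately have "card (set ps) \<le> card (keys q)" by (metis card_inj_on_le finite_keys)
    moreover have "card (set ps) = length ps"
      using dj by (auto simp: pairs_disjoint_def distinct_map distinct_card)
    ultimately show False using assms(2) by simp
  qed
  then obtain k b where kb: "(k, b) \<in> set ps" "k \<notin> keys q" "b \<notin> keys q" by blast
  have "contr_coeff \<nu> q (alternate ps F) = contr_coeff \<nu> (mperm (swp k b) q) (alternate ps F)" by (simp add: mperm_swp_fixed kb)
  also have "\<dots> = contr_coeff \<nu> q (- alternate ps F)" by (simp flip: contr_coeff_poly_act alternate_antisym[OF dj kb(1)])
  finally show ?thesis by (simp add: contr_coeff_uminus)
qed

context var_group
begin

text \<open>
  For \<open>f \<ge> 0\<close>, every invariant space of homogeneous polynomials that is not contained in 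
  \<open>contr_filt (f - 1)\<close> contains an element of \<open>contr_filt f\<close> that is not in \<open>contr_filt (f - 1)\<close>.
\<close>

lemma contr_filt_essential:
  assumes U: "invariant U" "U \<subseteq> hom_polys {1..} d" and F: "F \<in> U" "F \<notin> contr_filt (f - 1)" and f: "f \<ge> 0"
  obtains H where "H \<in> U" "H \<in> contr_filt f" "H \<notin> contr_filt (f - 1)"
proof -
  define bad where "bad = {\<mu>. \<exists>q. int (card (keys q)) < int (size \<mu>) - (f - 1) \<and> contr_coeff \<mu> q F \<noteq> 0}"
  have ne: "bad \<noteq> {}" using F(2) by (auto simp: bad_def contr_filt_def)
  have "bad \<subseteq> mon_content ` keys F" by (auto simp: bad_def elim!: contr_coeff_nonzero)
  hence "finite bad" by (rule finite_subset) (rule finite_imageI[OF finite_keys])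
  hence fin: "finite (size ` bad)" by (rule finite_imageI)
  have "Max (size ` bad) \<in> size ` bad" using fin ne by (intro Max_in) auto
  then obtain \<mu> where \<mu>: "\<mu> \<in> bad" "size \<mu> = Max (size ` bad)" by force
  have \<mu>_max: "size \<nu> \<le> size \<mu>" if "\<nu> \<in> bad" for \<nu>
    unfolding \<mu>(2) using fin that by (intro Max_ge) auto
  from \<mu>(1) obtain q0 where q0: "int (card (keys q0)) < int (size \<mu>) - (f - 1)" "contr_coeff \<mu> q0 F \<noteq> 0"
    by (auto simp: bad_def)
  define j where "j = nat (int (size \<mu>) - f)"
  have j: "int j = int (size \<mu>) - f" "card (keys q0) \<le> j" "j \<le> size \<mu>" using q0(1) f by (auto simp: j_def)
  obtain q where q: "card (keys q) = j" "contr_coeff \<mu> q F \<noteq> 0" using contr_coeff_extend_to[OF q0(2) j(2,3)] .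
  obtain m where m: "m \<in> keys F" "extends q m" using q(2) by (rule contr_coeff_nonzero)
  have qv: "keys q \<subseteq> vars F" using extends_keys[OF m(2)] m(1) by (auto simp: vars_def)
  have v1: "vars F \<subseteq> {1..}" using F(1) U(2) by (fastforce simp: hom_polys_def vars_def)
  define N where "N = Max (insert 0 (vars F))"
  have N: "x \<in> vars F \<Longrightarrow> x \<le> N" for x by (auto simp: N_def intro!: Max_ge)
  \<comment> \<open>The indices \<open>N + k\<close> with \<open>k > 0\<close> are larger than those of all variables of \<open>F\<close>.\<close>
  define ps where "ps = map (\<lambda>k. (k, N + k)) (sorted_list_of_set (keys q))"
  have ps: "fst ` set ps = keys q" "length ps = j" by (auto simp: ps_def q(1) image_image)
  have dj: "pairs_disjoint ps" using N qv v1
    by (fastforce simp: pairs_disjoint_def ps_def distinct_map inj_on_def o_def)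
  have fresh: "snd ` set ps \<inter> vars F = {}" using N qv v1 by (fastforce simp: ps_def)
  have "alternate ps F \<in> U" using qv v1 by (intro invariant_alternate[OF U(1) F(1)]) (auto simp: ps_def)
  moreover have "alternate ps F \<notin> contr_filt (f - 1)"
  proof -
    have "contr_coeff \<mu> q (alternate ps F) = contr_coeff \<mu> q F" unfolding contr_coeff_def
      by (rule pair_alternate[OF dj fresh]) (auto simp: ps split: if_splits dest: extends_keys)
    thus ?thesis using q j(1) by (auto simp: contr_filt_def intro!: exI[of _ \<mu>] exI[of _ q])
  qed
  moreover have "alternate ps F \<in> contr_filt f" unfolding contr_filt_def
  proof (intro CollectI allI impI)
    fix \<nu> :: "nat multiset" and q' :: monomial assume q': "int (card (keys q')) < int (size \<nu>) - f"
    show "contr_coeff \<nu> q' (alternate ps F) = 0"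
    proof (cases "\<nu> \<in> bad")
      case True
      hence "card (keys q') < length ps" using \<mu>_max[OF True] q' j(1) ps(2) by linarith
      thus ?thesis by (rule contr_coeff_alternate_pigeonhole[OF dj])
    next
      case False
      show ?thesis by (rule contr_coeff_alternate_eq_0[OF _ refl]) (use False q' in \<open>auto simp: bad_def\<close>)
    qed
  qed
  ultimately show ?thesis using that by blast
qed

end

section \<open>The lattice of sub-representations above a filtration step\<close>

lemma finite_contents: "finite {\<mu> :: nat multiset. 0 \<notin># \<mu> \<and> sum_mset \<mu> = d}"
proof (induction d rule: less_induct)
  case (less d)
  have "{\<mu> :: nat multiset. 0 \<notin># \<mu> \<and> sum_mset \<mu> = d}
      \<subseteq> insert {#} (\<Union>k\<in>{1..d}. add_mset k ` {\<mu>. 0 \<notin># \<mu> \<and> sum_mset \<mu> = d - k})"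
  proof
    fix \<mu> :: "nat multiset" assume \<mu>: "\<mu> \<in> {\<mu>. 0 \<notin># \<mu> \<and> sum_mset \<mu> = d}"
    show "\<mu> \<in> insert {#} (\<Union>k\<in>{1..d}. add_mset k ` {\<mu>. 0 \<notin># \<mu> \<and> sum_mset \<mu> = d - k})"
    proof (cases \<mu>)
      case (add k \<nu>)
      hence "k \<in> {1..d}" "0 \<notin># \<nu>" "sum_mset \<nu> = d - k" using \<mu> by auto
      thus ?thesis using add by blast
    qed simp
  qed
  moreover have "finite (insert {#} (\<Union>k\<in>{1..d}. add_mset k ` {\<mu>. 0 \<notin># \<mu> \<and> sum_mset \<mu> = d - k}))"
    using less by auto
  ultimately show ?case by (rule finite_subset)
qed

lemma supported_subspace: "qpoly.subspace {F. \<forall>m\<in>keys F. P m}"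
proof -
  let ?S = "{F :: qpoly. \<forall>m\<in>keys F. P m}"
  have "keys (qscale c F) \<subseteq> keys F" for c F by (auto simp: in_keys_iff)
  hence "qscale c F \<in> ?S" if "F \<in> ?S" for c F using that by blast
  moreover have "F + H \<in> ?S" if "F \<in> ?S" "H \<in> ?S" for F H
    using that by (auto dest!: subsetD[OF keys_add])
  moreover have "0 \<in> ?S" by simp
  ultimately show ?thesis unfolding qpoly.subspace_def by blast
qed

lemma keys_mperm_subset:
  assumes "\<sigma> permutes I" "keys (mperm \<sigma> m) \<subseteq> I"
  shows "keys m \<subseteq> I"
proof -
  have "keys m = \<sigma> ` keys (mperm \<sigma> m)"
    unfolding keys_mperm[OF permutes_bij[OF assms(1)]]
    by (rule surj_image_vimage_eq[OF bij_is_surj[OF permutes_bij[OF assms(1)]], symmetric])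
  thus ?thesis using permutes_image[OF assms(1)] assms(2) by blast
qed

lemma hom_polys_subspace: "qpoly.subspace (hom_polys I d)"
  unfolding hom_polys_def by (rule supported_subspace)

lemma hom_polys_act:
  assumes "\<sigma> permutes I" "F \<in> hom_polys I d"
  shows "poly_act \<sigma> F \<in> hom_polys I d"
  using assms(2) keys_mperm_subset[OF assms(1)] permutes_bij[OF assms(1)]
  by (auto simp: hom_polys_def keys_poly_act)

text \<open>
  Homogeneous polynomials of degree \<open>d\<close> in $x_1, x_2, \ldots$ with contents restricted to \<open>M\<close>; the
  choices \<open>UNIV\<close> and \<open>{\<mu>}\<close> give the two ambient representations of interest.
\<close>

definition polys_with :: "nat \<Rightarrow> nat multiset set \<Rightarrow> qpoly set" where
  "polys_with d M = {F \<in> hom_polys {1..} d. \<forall>m\<in>keys F. mon_content m \<in> M}"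

lemma polys_with_iff: "F \<in> polys_with d M \<longleftrightarrow>
    (\<forall>m\<in>keys F. keys m \<subseteq> {1..} \<and> mon_degree m = d \<and> mon_content m \<in> M)"
  by (auto simp: polys_with_def hom_polys_def)

lemma polys_with_subspace: "qpoly.subspace (polys_with d M)"
proof -
  have "polys_with d M = {F. \<forall>m\<in>keys F. keys m \<subseteq> {1..} \<and> mon_degree m = d \<and> mon_content m \<in> M}"
    by (rule set_eqI) (simp only: polys_with_iff mem_Collect_eq)
  thus ?thesis by (simp only: supported_subspace)
qed

lemma polys_with_act:
  assumes "\<sigma> permutes {1..}" "F \<in> polys_with d M"
  shows "poly_act \<sigma> F \<in> polys_with d M"
proof -
  have \<sigma>: "bij \<sigma>" using assms(1) by (rule permutes_bij)
  have "mon_content m \<in> M" if "mperm \<sigma> m \<in> keys F" for m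
  proof -
    have "mon_content (mperm \<sigma> m) \<in> M" using assms(2) that unfolding polys_with_def by blast
    thus ?thesis unfolding mon_content_mperm[OF \<sigma>] .
  qed
  thus ?thesis using assms(2) hom_polys_act[OF assms(1)] \<sigma> by (simp add: polys_with_def keys_poly_act)
qed

lemma polys_with_part: "F \<in> polys_with d M \<Longrightarrow> part P F \<in> polys_with d M"
  by (auto simp: polys_with_iff keys_part)

lemma part_content_sum: "(\<Sum>\<mu>\<in>mon_content ` keys F. part (\<lambda>m. mon_content m = \<mu>) F) = F"
  by (rule poly_mapping_eqI) (auto simp: lookup_sum sum.delta' in_keys_iff)

text \<open>The representation \<open>R\<close> with the consecutive filtration steps \<open>C\<close> and \<open>B\<close>.\<close>

locale filtered_rep = var_group G for G +
  fixes d :: nat and M :: "nat multiset set" and f :: int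
begin

definition R where "R = polys_with d M"
definition C where "C = contr_filt (f - 1) \<inter> R"
definition B where "B = contr_filt f \<inter> R"

text \<open>
  The sub-representations between \<open>C\<close> and \<open>R\<close>, which correspond to those of the quotient
  \<open>R / C\<close>. The irreducible ones of the quotient correspond to the atoms of this lattice, and sums of
  sub-representations to joins.
\<close>

definition intermediate :: "qpoly set \<Rightarrow> bool" where
  "intermediate U \<longleftrightarrow> invariant U \<and> C \<subseteq> U \<and> U \<subseteq> R"

definition atom :: "qpoly set \<Rightarrow> bool" where
  "atom S \<longleftrightarrow> intermediate S \<and> S \<noteq> C \<and> (\<forall>V. intermediate V \<and> V \<subseteq> S \<longrightarrow> V = C \<or> V = S)"

definition join :: "qpoly set set \<Rightarrow> qpoly set" where
  "join \<F> = qpoly.span (C \<union> \<Union>\<F>)"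

lemma R_invariant: "invariant R"
  by (auto simp: invariant_def R_def polys_with_subspace intro: polys_with_act G_permutes)

lemma R_homogeneous: "R \<subseteq> hom_polys {1..} d" by (auto simp: R_def polys_with_def)

lemma contr_filt_R_invariant: "invariant (contr_filt g \<inter> R)"
  using R_invariant by (auto simp: invariant_def contr_filt_subspace qpoly.subspace_inter contr_filt_poly_act)

lemma intermediate_subspace: "intermediate U \<Longrightarrow> qpoly.subspace U" by (simp add: intermediate_def invariant_subspace)
lemma intermediate_act: "intermediate U \<Longrightarrow> g \<in> G \<Longrightarrow> F \<in> U \<Longrightarrow> poly_act g F \<in> U" by (simp add: intermediate_def invariant_act)

lemma intermediate_C: "intermediate C" by (auto simp: intermediate_def C_def contr_filt_R_invariant)
lemma intermediate_B: "intermediate B"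
  using contr_filt_mono[of "f - 1" f] by (auto simp: intermediate_def C_def B_def contr_filt_R_invariant)
lemma intermediate_R: "intermediate R" by (auto simp: intermediate_def C_def R_invariant)

lemma intermediate_Int: "intermediate U \<Longrightarrow> intermediate V \<Longrightarrow> intermediate (U \<inter> V)"
  by (auto simp: intermediate_def invariant_def qpoly.subspace_inter)

lemma invariant_span:
  assumes "\<And>g F. g \<in> G \<Longrightarrow> F \<in> X \<Longrightarrow> poly_act g F \<in> X"
  shows "invariant (qpoly.span X)"
  unfolding invariant_def
proof (intro conjI ballI)
  fix g F assume g: "g \<in> G" and "F \<in> qpoly.span X"
  from this(2) show "poly_act g F \<in> qpoly.span X"
    by (induction rule: qpoly.span_induct_alt)
      (use g assms in \<open>auto simp: poly_act_add poly_act_qscale qpoly.span_zero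
        intro!: qpoly.span_add qpoly.span_scale intro: qpoly.span_base\<close>)
qed simp

lemma intermediate_join:
  assumes "\<And>S. S \<in> \<F> \<Longrightarrow> intermediate S"
  shows "intermediate (join \<F>)"
  unfolding intermediate_def join_def
proof (intro conjI)
  show "invariant (qpoly.span (C \<union> \<Union>\<F>))"
  proof (rule invariant_span)
    fix g F assume "g \<in> G" "F \<in> C \<union> \<Union>\<F>"
    thus "poly_act g F \<in> C \<union> \<Union>\<F>" using intermediate_act[OF intermediate_C] intermediate_act[OF assms] by blast
  qed
  show "C \<subseteq> qpoly.span (C \<union> \<Union>\<F>)" by (auto intro: qpoly.span_base)
  show "qpoly.span (C \<union> \<Union>\<F>) \<subseteq> R"
    using assms intermediate_C by (intro qpoly.span_minimal intermediate_subspace intermediate_R) (auto simp: intermediate_def)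
qed

lemma join_minimal: "intermediate U \<Longrightarrow> (\<And>S. S \<in> \<F> \<Longrightarrow> S \<subseteq> U) \<Longrightarrow> join \<F> \<subseteq> U"
  unfolding join_def by (rule qpoly.span_minimal) (auto simp: intermediate_def invariant_subspace)

lemma join_upper: "S \<in> \<F> \<Longrightarrow> S \<subseteq> join \<F>"
  unfolding join_def by (auto intro: qpoly.span_base)

lemma join_mono: "\<F> \<subseteq> \<F>' \<Longrightarrow> join \<F> \<subseteq> join \<F>'"
  unfolding join_def by (rule qpoly.span_mono) auto

lemma join_insert:
  assumes "intermediate S" "x \<in> join (insert S \<F>)"
  obtains s y where "s \<in> S" "y \<in> join \<F>" "x = s + y"
proof -
  let ?T = "{s + y | s y. s \<in> S \<and> y \<in> join \<F>}"
  have "join (insert S \<F>) \<subseteq> ?T" unfolding join_def[of "insert S \<F>"]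
  proof (rule qpoly.span_minimal)
    show "qpoly.subspace ?T"
      by (rule qpoly.subspace_sums[OF intermediate_subspace[OF assms(1)]]) (simp add: join_def)
    have "0 \<in> S" "0 \<in> join \<F>"
      using qpoly.subspace_0[OF intermediate_subspace[OF assms(1)]] by (simp_all add: join_def qpoly.span_zero)
    moreover have "C \<union> \<Union>\<F> \<subseteq> join \<F>" unfolding join_def by (auto intro: qpoly.span_base)
    moreover have "s = s + 0" "s = 0 + s" for s :: qpoly by simp_all
    ultimately show "C \<union> \<Union>(insert S \<F>) \<subseteq> ?T" unfolding Union_insert by blast
  qed
  thus ?thesis using assms(2) that by blast
qed

text \<open>A finite sum of irreducible representations is the direct sum of some of them.\<close>

lemma independent_subfamily:
  assumes "finite \<F>" "\<And>S. S \<in> \<F> \<Longrightarrow> atom S"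
  shows "\<exists>\<F>'\<subseteq>\<F>. (\<forall>S\<in>\<F>'. S \<inter> join (\<F>' - {S}) = C) \<and> join \<F>' = join \<F>"
  using assms
proof (induction \<F> rule: finite_induct)
  case empty thus ?case by auto
next
  case (insert S \<F>)
  from insert obtain \<F>' where F': "\<F>' \<subseteq> \<F>" "\<forall>S\<in>\<F>'. S \<inter> join (\<F>' - {S}) = C" "join \<F>' = join \<F>"
    by auto
  have at: "atom S" "\<And>T. T \<in> \<F>' \<Longrightarrow> atom T" using insert.prems F'(1) by auto
  have isb: "intermediate S" "\<And>T. T \<in> \<F>' \<Longrightarrow> intermediate T" "\<And>T. T \<in> \<F> \<Longrightarrow> intermediate T"
    using at insert.prems by (auto simp: atom_def)
  have ij: "intermediate (join \<F>')" using isb(2) by (rule intermediate_join)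
  have "S \<inter> join \<F>' = C \<or> S \<inter> join \<F>' = S" using at(1) intermediate_Int[OF isb(1) ij] by (auto simp: atom_def)
  thus ?case
  proof
    assume "S \<inter> join \<F>' = S"
    hence "T \<subseteq> join \<F>'" if "T \<in> insert S \<F>" for T using that F'(3) join_upper[of T \<F>] by blast
    hence "join (insert S \<F>) \<subseteq> join \<F>'" by (rule join_minimal[OF ij])
    moreover have "join \<F>' \<subseteq> join (insert S \<F>)" using F'(1) by (intro join_mono) auto
    ultimately show ?thesis using F'(1,2) by (intro exI[of _ \<F>']) auto
  next
    assume SC: "S \<inter> join \<F>' = C"
    have "S \<notin> \<F>'" using SC join_upper[of S \<F>'] at(1) by (auto simp: atom_def)
    have "T \<inter> join (insert S \<F>' - {T}) = C" if T: "T \<in> insert S \<F>'" for T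
    proof (cases "T = S")
      case True thus ?thesis using SC \<open>S \<notin> \<F>'\<close> by simp
    next
      case False
      hence TF: "T \<in> \<F>'" using T by simp
      have isT: "intermediate (join (insert S \<F>' - {T}))" using isb by (intro intermediate_join) auto
      have "T \<inter> join (insert S \<F>' - {T}) \<subseteq> T \<inter> join (\<F>' - {T})"
      proof
        fix x assume x: "x \<in> T \<inter> join (insert S \<F>' - {T})"
        hence "x \<in> join (insert S (\<F>' - {T}))" using False by (simp add: insert_Diff_if)
        then obtain s y where sy: "s \<in> S" "y \<in> join (\<F>' - {T})" "x = s + y"
          using join_insert[OF isb(1)] by blast
        have "x \<in> join \<F>'" "y \<in> join \<F>'" using x join_upper[OF TF] sy(2) join_mono[of "\<F>' - {T}" \<F>'] by auto
        hence "x - y \<in> join \<F>'" by (simp add: join_def qpoly.span_diff)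
        hence "s \<in> C" using sy SC by auto
        hence "s \<in> join (\<F>' - {T})" unfolding join_def by (intro qpoly.span_base) simp
        hence "x \<in> join (\<F>' - {T})" using sy by (simp add: join_def qpoly.span_add)
        thus "x \<in> T \<inter> join (\<F>' - {T})" using x by simp
      qed
      moreover have "T \<inter> join (\<F>' - {T}) = C" using F'(2) TF by blast
      moreover have "C \<subseteq> T \<inter> join (insert S \<F>' - {T})" using isb(2)[OF TF] isT by (auto simp: intermediate_def)
      ultimately show ?thesis by blast
    qed
    moreover have "join (insert S \<F>') = join (insert S \<F>)"
    proof
      show "join (insert S \<F>') \<subseteq> join (insert S \<F>)" using F'(1) by (intro join_mono) auto
      have "T \<subseteq> join (insert S \<F>')" if "T \<in> insert S \<F>" for T
        using that F'(3) join_upper[of T \<F>] join_mono[of \<F>' "insert S \<F>'"] join_upper[of S "insert S \<F>'"] by blast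
      thus "join (insert S \<F>) \<subseteq> join (insert S \<F>')"
        using isb by (intro join_minimal intermediate_join) auto
    qed
    ultimately show ?thesis using F'(1) by (intro exI[of _ "insert S \<F>'"]) auto
  qed
qed

section \<open>Irreducible sub-representations of a filtration quotient\<close>

text \<open>The elements of \<open>B\<close> whose contents different from \<open>\<mu>\<close> contribute to \<open>C\<close> only.\<close>

definition others :: "nat multiset \<Rightarrow> qpoly set" where
  "others \<mu> = {F \<in> B. \<forall>\<nu> i. \<nu> \<noteq> \<mu> \<and> int (size \<nu>) - f = int i \<longrightarrow> contraction \<nu> i F = 0}"

lemma others_invariant: "invariant (others \<mu>)"
  using intermediate_B by (auto simp: others_def intermediate_def invariant_def qpoly.subspace_def contraction_add contraction_qscale contraction_poly_act)

lemma others_kernel: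
  assumes "F \<in> others \<mu>" "\<And>j. int (size \<mu>) - f = int j \<Longrightarrow> contraction \<mu> j F = 0"
  shows "F \<in> C"
proof -
  have "F \<in> contr_filt f" "F \<in> R" using assms(1) by (auto simp: others_def B_def)
  moreover have "contraction \<nu> i F = 0" if "int (size \<nu>) - f = int i" for \<nu> i
    using assms that by (cases "\<nu> = \<mu>") (auto simp: others_def)
  ultimately show ?thesis using contr_filt_kernel by (simp add: C_def)
qed

lemma C_contraction: "F \<in> C \<Longrightarrow> int (size \<mu>) - f = int j \<Longrightarrow> contraction \<mu> j F = 0"
  using contr_filt_kernel[of F f] contr_filt_mono[of "f - 1" f] by (auto simp: C_def)

lemma C_others: "C \<subseteq> others \<mu>"
  using C_contraction intermediate_B by (auto simp: others_def intermediate_def)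

lemma part_others: "F \<in> B \<Longrightarrow> part (\<lambda>m. mon_content m = \<mu>) F \<in> others \<mu>"
  by (auto simp: others_def B_def R_def contr_filt_part polys_with_part contraction_part_content)

text \<open>
  The preimage of \<open>S\<close> in \<open>others \<mu>\<close> under the contraction for \<open>\<mu>\<close>. If \<open>S\<close> is irreducible and contained in the
  image of \<open>B\<close>, this is an atom.
\<close>

definition lifted :: "nat multiset \<Rightarrow> nat \<Rightarrow> qpoly set \<Rightarrow> qpoly set" where
  "lifted \<mu> j S = {F \<in> others \<mu>. contraction \<mu> j F \<in> S}"

lemma contraction_B: "contraction \<mu> j ` B = contraction \<mu> j ` others \<mu>"
proof
  show "contraction \<mu> j ` B \<subseteq> contraction \<mu> j ` others \<mu>"
  proof (rule image_subsetI)
    fix F assume "F \<in> B"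
    hence "part (\<lambda>m. mon_content m = \<mu>) F \<in> others \<mu>" by (rule part_others)
    hence "contraction \<mu> j (part (\<lambda>m. mon_content m = \<mu>) F) \<in> contraction \<mu> j ` others \<mu>" by (rule imageI)
    thus "contraction \<mu> j F \<in> contraction \<mu> j ` others \<mu>" by (simp add: contraction_part_content)
  qed
qed (auto simp: others_def)

lemma contraction_image_invariant: "invariant U \<Longrightarrow> invariant (contraction \<mu> j ` U)"
  unfolding invariant_def qpoly.subspace_def
  by (auto simp flip: contraction_add contraction_qscale contraction_poly_act) (metis image_eqI contraction_zero)

lemma contraction_lifted:
  assumes "S \<subseteq> contraction \<mu> j ` B"
  shows "contraction \<mu> j ` lifted \<mu> j S = S"
  using assms unfolding contraction_B by (auto simp: lifted_def)

lemma atom_lifted: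
  assumes j: "int (size \<mu>) - f = int j" and S: "irreducible S" "S \<subseteq> contraction \<mu> j ` B"
  shows "atom (lifted \<mu> j S)"
proof -
  have iS: "invariant S" "S \<noteq> {0}" "\<And>V. invariant V \<Longrightarrow> V \<subseteq> S \<Longrightarrow> V = {0} \<or> V = S"
    using S(1) by (auto simp: irreducible_def)
  have 0: "0 \<in> S" using iS(1) by (simp add: invariant_subspace qpoly.subspace_0)
  have im: "contraction \<mu> j ` lifted \<mu> j S = S" by (rule contraction_lifted[OF S(2)])
  have "invariant (lifted \<mu> j S)"
    using others_invariant[of \<mu>] iS(1)
    by (auto simp: lifted_def invariant_def qpoly.subspace_def contraction_add contraction_qscale contraction_poly_act)
  moreover have "C \<subseteq> lifted \<mu> j S" using C_others C_contraction[OF _ j] 0 by (auto simp: lifted_def)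
  moreover have "lifted \<mu> j S \<subseteq> R" by (auto simp: lifted_def others_def B_def)
  ultimately have isb: "intermediate (lifted \<mu> j S)" by (simp add: intermediate_def)
  have ker: "F \<in> C" if "F \<in> lifted \<mu> j S" "contraction \<mu> j F = 0" for F
    using that j by (intro others_kernel[of _ \<mu>]) (auto simp: lifted_def)
  show ?thesis unfolding atom_def
  proof (intro conjI allI impI isb)
    show "lifted \<mu> j S \<noteq> C"
    proof
      assume "lifted \<mu> j S = C"
      hence "S \<subseteq> {0}" using im C_contraction[OF _ j] by auto
      thus False using iS(2) 0 by blast
    qed
    fix V assume V: "intermediate V \<and> V \<subseteq> lifted \<mu> j S"
    have "invariant (contraction \<mu> j ` V)" using V by (intro contraction_image_invariant) (simp add: intermediate_def)
    moreover have "contraction \<mu> j ` V \<subseteq> S" using V im by blast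
    ultimately have "contraction \<mu> j ` V = {0} \<or> contraction \<mu> j ` V = S" by (rule iS(3))
    thus "V = C \<or> V = lifted \<mu> j S"
    proof
      assume "contraction \<mu> j ` V = {0}"
      hence "V \<subseteq> C" using V ker by blast
      thus ?thesis using V by (auto simp: intermediate_def)
    next
      assume VS: "contraction \<mu> j ` V = S"
      have "F \<in> V" if F: "F \<in> lifted \<mu> j S" for F
      proof -
        have "contraction \<mu> j F \<in> contraction \<mu> j ` V" using F VS by (simp add: lifted_def)
        then obtain F' where F': "F' \<in> V" "contraction \<mu> j F = contraction \<mu> j F'" by blast
        have "F - F' \<in> lifted \<mu> j S"
          using F F'(1) V intermediate_subspace[OF isb] by (auto intro!: qpoly.subspace_diff)
        hence "F - F' \<in> C" using F'(2) by (intro ker) (simp_all add: contraction_diff)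
        hence "(F - F') + F' \<in> V"
          using V F'(1) by (intro qpoly.subspace_add intermediate_subspace) (auto simp: intermediate_def)
        thus ?thesis by simp
      qed
      thus ?thesis using V by blast
    qed
  qed
qed

lemma B_join_atoms:
  obtains \<F> where "finite \<F>" "\<And>S. S \<in> \<F> \<Longrightarrow> atom S" "join \<F> = B"
proof -
  define Cn where "Cn = {\<mu> :: nat multiset. 0 \<notin># \<mu> \<and> sum_mset \<mu> = d \<and> f \<le> int (size \<mu>)}"
  define j where "j \<mu> = nat (int (size \<mu>) - f)" for \<mu> :: "nat multiset"
  have j: "int (size \<mu>) - f = int (j \<mu>)" if "\<mu> \<in> Cn" for \<mu> using that by (simp add: j_def Cn_def)
  have "\<exists>\<S>. finite \<S> \<and> (\<forall>S\<in>\<S>. irreducible S \<and> S \<subseteq> contraction \<mu> (j \<mu>) ` B)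
      \<and> contraction \<mu> (j \<mu>) ` B \<subseteq> qpoly.span (\<Union>\<S>)" if "\<mu> \<in> Cn" for \<mu>
  proof (rule harmonic_semisimple)
    show "invariant (contraction \<mu> (j \<mu>) ` B)" using intermediate_B by (intro contraction_image_invariant) (simp add: intermediate_def)
    show "contraction \<mu> (j \<mu>) ` B \<subseteq> harmonic (j \<mu>) d"
      using contraction_harmonic[OF _ _ j[OF that]] R_homogeneous by (auto simp: B_def)
  qed
  then obtain \<S> where \<S>: "\<And>\<mu>. \<mu> \<in> Cn \<Longrightarrow> finite (\<S> \<mu>)"
     "\<And>\<mu> S. \<mu> \<in> Cn \<Longrightarrow> S \<in> \<S> \<mu> \<Longrightarrow> irreducible S \<and> S \<subseteq> contraction \<mu> (j \<mu>) ` B"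
     "\<And>\<mu>. \<mu> \<in> Cn \<Longrightarrow> contraction \<mu> (j \<mu>) ` B \<subseteq> qpoly.span (\<Union>(\<S> \<mu>))"
    by metis
  define \<F> where "\<F> = (\<Union>\<mu>\<in>Cn. lifted \<mu> (j \<mu>) ` \<S> \<mu>)"
  have fin: "finite \<F>" unfolding \<F>_def
  proof (intro finite_UN_I finite_imageI \<S>(1))
    show "finite Cn" by (rule finite_subset[OF _ finite_contents[of d]]) (auto simp: Cn_def)
  qed
  have at: "atom T" if "T \<in> \<F>" for T
  proof -
    from that obtain \<mu> S where T: "\<mu> \<in> Cn" "S \<in> \<S> \<mu>" "T = lifted \<mu> (j \<mu>) S"
      unfolding \<F>_def by blast
    have "irreducible S" "S \<subseteq> contraction \<mu> (j \<mu>) ` B" using \<S>(2)[OF T(1,2)] by simp_all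
    thus ?thesis unfolding T(3) by (rule atom_lifted[OF j[OF T(1)]])
  qed
  have ij: "intermediate (join \<F>)" using at by (intro intermediate_join) (simp add: atom_def)
  have sub: "join \<F> \<subseteq> B"
    by (rule join_minimal[OF intermediate_B]) (auto simp: \<F>_def lifted_def others_def)
  have pt: "part (\<lambda>m. mon_content m = \<mu>) F \<in> join \<F>" if F: "F \<in> B" and \<mu>: "\<mu> \<in> mon_content ` keys F" for F \<mu>
  proof -
    let ?P = "part (\<lambda>m. mon_content m = \<mu>) F"
    have P: "?P \<in> others \<mu>" using F by (rule part_others)
    show ?thesis
    proof (cases "f \<le> int (size \<mu>)")
      case False
      hence "?P \<in> C" by (intro others_kernel[OF P]) auto
      thus ?thesis using ij by (auto simp: intermediate_def)
    next
      case True
      have "0 \<notin># \<mu>" "sum_mset \<mu> = d" using \<mu> F R_homogeneous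
        by (auto simp: zero_notin_mon_content B_def hom_polys_def subset_iff)
      hence Cn: "\<mu> \<in> Cn" using True by (simp add: Cn_def)
      let ?L = "join \<F> \<inter> others \<mu>"
      have L: "qpoly.subspace (contraction \<mu> (j \<mu>) ` ?L)"
        using contraction_image_invariant[of ?L] ij others_invariant[of \<mu>]
        by (auto simp: intermediate_def invariant_def qpoly.subspace_inter)
      have "\<Union>(\<S> \<mu>) \<subseteq> contraction \<mu> (j \<mu>) ` ?L"
      proof (rule Union_least)
        fix S assume S: "S \<in> \<S> \<mu>"
        hence "lifted \<mu> (j \<mu>) S \<in> \<F>" using Cn by (auto simp: \<F>_def)
        hence "lifted \<mu> (j \<mu>) S \<subseteq> ?L" using join_upper by (auto simp: lifted_def)
        thus "S \<subseteq> contraction \<mu> (j \<mu>) ` ?L" using contraction_lifted[of S \<mu> "j \<mu>"] \<S>(2)[OF Cn S] by blast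
      qed
      hence "qpoly.span (\<Union>(\<S> \<mu>)) \<subseteq> contraction \<mu> (j \<mu>) ` ?L" by (rule qpoly.span_minimal[OF _ L])
      moreover have "contraction \<mu> (j \<mu>) ?P \<in> contraction \<mu> (j \<mu>) ` B" using P by (auto simp: others_def)
      ultimately obtain H where H: "H \<in> ?L" "contraction \<mu> (j \<mu>) ?P = contraction \<mu> (j \<mu>) H" using \<S>(3)[OF Cn] by blast
      have "?P - H \<in> others \<mu>"
        using P H(1) by (intro qpoly.subspace_diff invariant_subspace others_invariant) auto
      moreover have "contraction \<mu> i (?P - H) = 0" if "int (size \<mu>) - f = int i" for i
      proof -
        have "i = j \<mu>" using that by (simp add: j_def)
        thus ?thesis using H(2) by (simp add: contraction_diff)
      qed
      ultimately have "?P - H \<in> C" by (rule others_kernel)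
      hence "?P - H \<in> join \<F>" using ij by (auto simp: intermediate_def)
      hence "(?P - H) + H \<in> join \<F>" using H(1) by (intro qpoly.subspace_add intermediate_subspace[OF ij]) auto
      thus ?thesis by simp
    qed
  qed
  have "B \<subseteq> join \<F>"
  proof
    fix F assume F: "F \<in> B"
    have "(\<Sum>\<mu>\<in>mon_content ` keys F. part (\<lambda>m. mon_content m = \<mu>) F) \<in> join \<F>"
      using pt[OF F] by (intro qpoly.subspace_sum intermediate_subspace[OF ij])
    thus "F \<in> join \<F>" by (simp add: part_content_sum)
  qed
  thus ?thesis using that[of \<F>] fin at sub by blast
qed

lemma atom_subset_B:
  assumes f: "f \<ge> 0" and S: "atom S"
  shows "S \<subseteq> B"
proof -
  have isb: "intermediate S" "S \<noteq> C" using S by (auto simp: atom_def)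
  then obtain F where F: "F \<in> S" "F \<notin> C" by (auto simp: intermediate_def)
  have "F \<notin> contr_filt (f - 1)" using F isb(1) by (auto simp: intermediate_def C_def)
  moreover have "invariant S" "S \<subseteq> hom_polys {1..} d" using isb(1) R_homogeneous by (auto simp: intermediate_def)
  ultimately obtain H where H: "H \<in> S" "H \<in> contr_filt f" "H \<notin> contr_filt (f - 1)"
    using contr_filt_essential[of S d F f] F(1) f by blast
  have "H \<in> S \<inter> B" "H \<notin> C" using H isb(1) by (auto simp: B_def C_def intermediate_def)
  hence "S \<inter> B \<noteq> C" by blast
  moreover have "S \<inter> B = C \<or> S \<inter> B = S"
    using S intermediate_Int[OF isb(1) intermediate_B] by (auto simp: atom_def)
  ultimately show ?thesis by blast
qed

section \<open>The maximal completely reducible sub-representation of the quotient\<close>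

text \<open>
  The quotient of \<open>R\<close> by \<open>C\<close>, the image in it of a set of polynomials, and the class of a
  polynomial.
\<close>

abbreviation Q where "Q \<equiv> quotient_rep (poly_rep G R) C"
abbreviation quo where "quo U \<equiv> quotient_space (poly_rep G R) U C"
abbreviation cls where "cls \<equiv> coset (poly_rep G R) C"

lemma cls_def: "cls v = (+) v ` C" by (simp add: coset_def poly_rep_def)

lemma in_cls: "w \<in> cls v \<longleftrightarrow> w - v \<in> C"
  unfolding cls_def by (auto simp: image_iff) (metis add_diff_cancel_left' diff_add_cancel add.commute)

lemma C_subspace: "qpoly.subspace C" using intermediate_C by (rule intermediate_subspace)

lemma cls_eq: "cls v = cls w \<longleftrightarrow> v - w \<in> C"
proof
  assume "cls v = cls w"
  moreover have "v \<in> cls v" using qpoly.subspace_0[OF C_subspace] by (simp add: in_cls)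
  ultimately show "v - w \<in> C" by (simp add: in_cls)
next
  assume vw: "v - w \<in> C"
  have "x - v \<in> C \<longleftrightarrow> x - w \<in> C" for x
  proof
    assume "x - v \<in> C"
    from qpoly.subspace_add[OF C_subspace this vw] show "x - w \<in> C" by simp
  next
    assume "x - w \<in> C"
    from qpoly.subspace_diff[OF C_subspace this vw] show "x - v \<in> C" by simp
  qed
  thus "cls v = cls w" by (auto simp: in_cls)
qed

lemma self_in_cls: "v \<in> cls v" using qpoly.subspace_0[OF C_subspace] by (simp add: in_cls)

lemma Q_add: "vadd Q (cls u) (cls v) = cls (u + v)"
proof -
  have "cls (a + b) = cls (u + v)" if "a \<in> cls u" "b \<in> cls v" for a b
    using that qpoly.subspace_add[OF C_subspace, of "a - u" "b - v"]
    by (simp add: cls_eq in_cls algebra_simps)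
  moreover have "vadd Q (cls u) (cls v) = (\<Union>a\<in>cls u. \<Union>b\<in>cls v. cls (a + b))"
    by (simp add: quotient_rep_def) (simp add: poly_rep_def)
  ultimately show ?thesis using self_in_cls by blast
qed

lemma Q_scale: "vscale Q c (cls v) = cls (qscale c v)"
proof -
  have "cls (qscale c a) = cls (qscale c v)" if "a \<in> cls v" for a
    using that qpoly.subspace_scale[OF C_subspace, of "a - v" c]
    by (simp add: cls_eq in_cls qpoly.scale_right_diff_distrib)
  moreover have "vscale Q c (cls v) = (\<Union>a\<in>cls v. cls (qscale c a))"
    by (simp add: quotient_rep_def) (simp add: poly_rep_def)
  ultimately show ?thesis using self_in_cls by blast
qed

lemma Q_act: "g \<in> G \<Longrightarrow> vact Q g (cls v) = cls (poly_act g v)"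
proof -
  assume g: "g \<in> G"
  have "cls (poly_act g a) = cls (poly_act g v)" if "a \<in> cls v" for a
    using that intermediate_act[OF intermediate_C g, of "a - v"] g by (simp add: cls_eq in_cls poly_act_diff)
  moreover have "vact Q g (cls v) = (\<Union>a\<in>cls v. cls (poly_act g a))"
    by (simp add: quotient_rep_def) (simp add: poly_rep_def)
  ultimately show ?thesis using self_in_cls by blast
qed

lemma Q_simps: "space Q = cls ` R" "vzero Q = C" "grp Q = G"
  by (simp_all add: quotient_rep_def quotient_space_def) (simp_all add: poly_rep_def)

lemma cls_0: "cls 0 = C" by (auto simp: in_cls)

lemma quo_def: "quo U = cls ` U" by (simp add: quotient_space_def)

lemma subrep_quo:
  assumes "intermediate U" shows "subrep Q (quo U)"
  unfolding subrep_def Q_simps quo_def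
proof (intro conjI ballI allI)
  show "cls ` U \<subseteq> cls ` R" using assms by (auto simp: intermediate_def)
  show "C \<in> cls ` U" using qpoly.subspace_0[OF intermediate_subspace[OF assms]] cls_0 by blast
qed (use intermediate_subspace[OF assms] intermediate_act[OF assms] in
    \<open>auto simp: Q_add Q_scale Q_act intro!: imageI qpoly.subspace_add qpoly.subspace_scale\<close>)

lemma subrep_intermediate:
  assumes "subrep Q \<U>"
  obtains U where "intermediate U" "\<U> = quo U"
proof -
  define U where "U = {v \<in> R. cls v \<in> \<U>}"
  have s: "\<U> \<subseteq> cls ` R" "C \<in> \<U>" "\<And>u v. u \<in> \<U> \<Longrightarrow> v \<in> \<U> \<Longrightarrow> vadd Q u v \<in> \<U>"
    "\<And>c u. u \<in> \<U> \<Longrightarrow> vscale Q c u \<in> \<U>" "\<And>g u. g \<in> G \<Longrightarrow> u \<in> \<U> \<Longrightarrow> vact Q g u \<in> \<U>"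
    using assms unfolding subrep_def Q_simps by blast+
  have "\<U> = quo U" unfolding quo_def U_def using s(1) by auto
  moreover have "intermediate U" unfolding intermediate_def invariant_def
  proof (intro conjI ballI)
    have R: "qpoly.subspace R" using R_invariant by (rule invariant_subspace)
    show "qpoly.subspace U" unfolding qpoly.subspace_def
    proof (intro conjI ballI allI)
      show "0 \<in> U" using s(2) qpoly.subspace_0[OF R] by (simp add: U_def cls_0)
      show "x + y \<in> U" if "x \<in> U" "y \<in> U" for x y
        using that s(3)[of "cls x" "cls y"] qpoly.subspace_add[OF R] by (simp add: U_def Q_add)
      show "qscale c x \<in> U" if "x \<in> U" for c x
        using that s(4)[of "cls x" c] qpoly.subspace_scale[OF R] by (simp add: U_def Q_scale)
    qed
    show "poly_act g F \<in> U" if "g \<in> G" "F \<in> U" for g F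
      using that s(5)[of g "cls F"] invariant_act[OF R_invariant] by (simp add: U_def Q_act)
    show "C \<subseteq> U"
    proof
      fix v assume v: "v \<in> C"
      hence "cls v = C" using cls_eq[of v 0] by (simp add: cls_0)
      thus "v \<in> U" using v s(2) intermediate_C by (auto simp: U_def intermediate_def)
    qed
  qed (auto simp: U_def)
  ultimately show ?thesis using that by blast
qed

lemma cls_in_quo: "intermediate U \<Longrightarrow> cls v \<in> quo U \<longleftrightarrow> v \<in> U"
proof
  assume U: "intermediate U" and "cls v \<in> quo U"
  then obtain u where u: "u \<in> U" "v - u \<in> C" by (auto simp: quo_def cls_eq)
  hence "(v - u) + u \<in> U" using U by (intro qpoly.subspace_add intermediate_subspace) (auto simp: intermediate_def)
  thus "v \<in> U" by simp
qed (simp add: quo_def)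

lemma quo_subset_iff: "intermediate V \<Longrightarrow> quo U \<subseteq> quo V \<longleftrightarrow> U \<subseteq> V"
  using cls_in_quo[of V] unfolding quo_def by blast

lemma quo_eq_iff: "intermediate U \<Longrightarrow> intermediate V \<Longrightarrow> quo U = quo V \<longleftrightarrow> U = V"
  by (metis quo_subset_iff subset_antisym order_refl)

lemma quo_C: "quo C = {C}"
proof -
  have "cls v = C" if "v \<in> C" for v using that cls_eq[of v 0] by (simp add: cls_0)
  thus ?thesis using qpoly.subspace_0[OF C_subspace] by (auto simp: quo_def)
qed

lemma quo_Int: "intermediate U \<Longrightarrow> intermediate V \<Longrightarrow> quo U \<inter> quo V = quo (U \<inter> V)"
  using cls_in_quo[of V] by (auto simp: quo_def)

lemma irreducible_quo: "intermediate S \<Longrightarrow> irreducible_subrep Q (quo S) \<longleftrightarrow> atom S"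
proof -
  assume S: "intermediate S"
  have "(\<forall>U'. subrep Q U' \<and> U' \<subseteq> quo S \<longrightarrow> U' = {C} \<or> U' = quo S)
      \<longleftrightarrow> (\<forall>V. intermediate V \<and> V \<subseteq> S \<longrightarrow> V = C \<or> V = S)" (is "?l = ?r")
  proof
    assume l: ?l
    show ?r
    proof (intro allI impI)
      fix V assume V: "intermediate V \<and> V \<subseteq> S"
      hence "quo V = quo C \<or> quo V = quo S" using l subrep_quo[of V] S by (simp add: quo_C quo_subset_iff)
      thus "V = C \<or> V = S" using V S intermediate_C by (simp add: quo_eq_iff)
    qed
  next
    assume r: ?r
    show ?l
    proof (intro allI impI)
      fix \<U> assume U: "subrep Q \<U> \<and> \<U> \<subseteq> quo S"
      obtain V where V: "intermediate V" "\<U> = quo V" using subrep_intermediate U by blast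
      have "V \<subseteq> S" using U V S by (simp add: quo_subset_iff)
      hence "V = C \<or> V = S" using r V by blast
      thus "\<U> = {C} \<or> \<U> = quo S" using V(2) quo_C by blast
    qed
  qed
  moreover have "quo S \<noteq> {C} \<longleftrightarrow> S \<noteq> C" using quo_eq_iff[OF S intermediate_C] by (simp add: quo_C)
  ultimately show ?thesis using subrep_quo[OF S] S by (simp add: irreducible_subrep_def atom_def Q_simps)
qed

lemma rep_sum_quo:
  assumes "\<And>S. S \<in> \<F> \<Longrightarrow> intermediate S"
  shows "rep_sum Q (quo ` \<F>) = quo (join \<F>)"
proof
  have ij: "intermediate (join \<F>)" using assms by (rule intermediate_join)
  have "\<Union>(quo ` \<F>) \<subseteq> quo (join \<F>)" using join_upper by (force simp: quo_def)
  thus "rep_sum Q (quo ` \<F>) \<subseteq> quo (join \<F>)" unfolding rep_sum_def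
    by (intro Inter_lower CollectI conjI subrep_quo[OF ij])
  show "quo (join \<F>) \<subseteq> rep_sum Q (quo ` \<F>)" unfolding rep_sum_def
  proof (rule Inter_greatest)
    fix \<U> assume "\<U> \<in> {U. subrep Q U \<and> \<Union>(quo ` \<F>) \<subseteq> U}"
    hence sub: "subrep Q \<U>" "\<Union>(quo ` \<F>) \<subseteq> \<U>" by simp_all
    obtain U where U: "intermediate U" "\<U> = quo U" using subrep_intermediate[OF sub(1)] .
    have "S \<subseteq> U" if "S \<in> \<F>" for S
    proof -
      have "quo S \<subseteq> quo U" using sub(2) U(2) that by blast
      thus ?thesis by (simp add: quo_subset_iff U(1))
    qed
    hence "join \<F> \<subseteq> U" by (rule join_minimal[OF U(1)])
    thus "quo (join \<F>) \<subseteq> \<U>" using U by (simp add: quo_subset_iff)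
  qed
qed

lemma completely_reducible_B: "completely_reducible Q (quo B)"
proof -
  obtain \<F>0 where F0: "finite \<F>0" "\<And>S. S \<in> \<F>0 \<Longrightarrow> atom S" "join \<F>0 = B"
    by (rule B_join_atoms) blast
  obtain \<F> where F: "\<F> \<subseteq> \<F>0" "\<forall>S\<in>\<F>. S \<inter> join (\<F> - {S}) = C" "join \<F> = B"
    using independent_subfamily[OF F0(1,2)] unfolding F0(3) by blast
  have isb: "intermediate S" "atom S" if "S \<in> \<F>" for S using that F(1) F0(2) by (auto simp: atom_def)
  show ?thesis unfolding completely_reducible_def
  proof (intro exI[of _ "quo ` \<F>"] conjI ballI)
    fix X assume "X \<in> quo ` \<F>"
    then obtain S where S: "S \<in> \<F>" "X = quo S" by blast
    show "irreducible_subrep Q X" using S isb by (simp add: irreducible_quo)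
    have "quo ` \<F> - {X} = quo ` (\<F> - {S})" using S isb quo_eq_iff by blast
    moreover have "rep_sum Q (quo ` (\<F> - {S})) = quo (join (\<F> - {S}))"
      by (rule rep_sum_quo) (use isb in blast)
    ultimately have "X \<inter> rep_sum Q (quo ` \<F> - {X}) = quo S \<inter> quo (join (\<F> - {S}))"
      using S(2) by simp
    also have "\<dots> = quo (S \<inter> join (\<F> - {S}))" using isb S by (intro quo_Int intermediate_join) blast+
    also have "\<dots> = {vzero Q}" using F(2) S by (simp add: quo_C Q_simps)
    finally show "X \<inter> rep_sum Q (quo ` \<F> - {X}) = {vzero Q}" .
  next
    show "quo B = rep_sum Q (quo ` \<F>)" using rep_sum_quo[of \<F>] isb(1) F(3) by simp
  qed
qed

theorem maximal_quo:
  assumes "f \<ge> 0"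
  shows "maximal_completely_reducible Q (quo B)"
  unfolding maximal_completely_reducible_def
proof (intro conjI allI impI)
  show "subrep Q (quo B)" using intermediate_B by (rule subrep_quo)
  show "completely_reducible Q (quo B)" by (rule completely_reducible_B)
  fix \<U> assume "subrep Q \<U> \<and> completely_reducible Q \<U>"
  then obtain \<X> where X: "\<forall>S\<in>\<X>. irreducible_subrep Q S" "\<U> = rep_sum Q \<X>"
    by (auto simp: completely_reducible_def)
  have "S \<subseteq> quo B" if "S \<in> \<X>" for S
  proof -
    have irr: "irreducible_subrep Q S" using X that by blast
    hence "subrep Q S" by (simp add: irreducible_subrep_def)
    then obtain U where U: "intermediate U" "S = quo U" by (rule subrep_intermediate)
    hence "atom U" using irr by (simp add: irreducible_quo)
    thus ?thesis using atom_subset_B[OF assms] U quo_subset_iff[OF intermediate_B] by blast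
  qed
  hence "\<Union>\<X> \<subseteq> quo B" by (rule Union_least)
  thus "\<U> \<subseteq> quo B" unfolding X(2) rep_sum_def
    by (intro Inter_lower CollectI conjI subrep_quo[OF intermediate_B])
qed

end

section \<open>Symmetrizers and antisymmetrizers\<close>

text \<open>
  The permutations of $\{1, \ldots, n\}$ that preserve each fibre of \<open>r\<close>. Row and column stabilizers
  of a filling are of this form, with the row or the column index of an entry in place of \<open>r\<close>.
\<close>

definition fibre_stab :: "nat \<Rightarrow> (nat \<Rightarrow> nat) \<Rightarrow> (nat \<Rightarrow> nat) set" where
  "fibre_stab n r = {\<sigma>. \<sigma> permutes {1..n} \<and> (\<forall>x\<in>{1..n}. r (\<sigma> x) = r x)}"

text \<open>The sign character or the trivial character, according to \<open>s\<close>.\<close>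

definition sign_char :: "bool \<Rightarrow> (nat \<Rightarrow> nat) \<Rightarrow> rat" where
  "sign_char s \<sigma> = (if s then of_int (sign \<sigma>) else 1)"

text \<open>The sum over the stabilizer of the fibres of \<open>r\<close>, weighted with the sign if \<open>s\<close> holds.\<close>

definition symmetrizer :: "bool \<Rightarrow> nat \<Rightarrow> (nat \<Rightarrow> nat) \<Rightarrow> qpoly \<Rightarrow> qpoly" where
  "symmetrizer s n r F = (\<Sum>\<sigma>\<in>fibre_stab n r. qscale (sign_char s \<sigma>) (poly_act \<sigma> F))"

lemma finite_fibre_stab [simp]: "finite (fibre_stab n r)"
  by (rule finite_subset[OF _ finite_permutations[of "{1..n}"]]) (auto simp: fibre_stab_def)

lemma fibre_stab_permutes: "\<sigma> \<in> fibre_stab n r \<Longrightarrow> \<sigma> permutes {1..n}" by (simp add: fibre_stab_def)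
lemma fibre_stab_bij [simp]: "\<sigma> \<in> fibre_stab n r \<Longrightarrow> bij \<sigma>" using fibre_stab_permutes permutes_bij by blast
lemma fibre_stab_id [simp]: "id \<in> fibre_stab n r" by (simp add: fibre_stab_def permutes_id)
lemma fibre_stab_comp: "\<sigma> \<in> fibre_stab n r \<Longrightarrow> \<tau> \<in> fibre_stab n r \<Longrightarrow> \<sigma> \<circ> \<tau> \<in> fibre_stab n r"
  unfolding fibre_stab_def by (auto simp: permutes_compose) (metis atLeastAtMost_iff permutes_in_image)

lemma fibre_stab_inv: assumes "\<sigma> \<in> fibre_stab n r" shows "inv \<sigma> \<in> fibre_stab n r"
proof -
  have p: "\<sigma> permutes {1..n}" using assms by (rule fibre_stab_permutes)
  have "r (inv \<sigma> x) = r x" if "x \<in> {1..n}" for x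
  proof -
    have "inv \<sigma> x \<in> {1..n}" using p that by (metis permutes_in_image permutes_inv)
    hence "r (\<sigma> (inv \<sigma> x)) = r (inv \<sigma> x)" using assms by (simp add: fibre_stab_def)
    thus ?thesis using p by (simp add: permutes_inverses)
  qed
  thus ?thesis using p by (simp add: fibre_stab_def permutes_inv)
qed

lemma perm_permutation: "\<sigma> permutes {1..n::nat} \<Longrightarrow> permutation \<sigma>"
  using permutation_permutes by blast

lemma sign_char_id [simp]: "sign_char s id = 1" by (simp add: sign_char_def)
lemma sign_char_comp: "\<sigma> permutes {1..n} \<Longrightarrow> \<tau> permutes {1..n} \<Longrightarrow> sign_char s (\<sigma> \<circ> \<tau>) = sign_char s \<sigma> * sign_char s \<tau>"
  by (simp add: sign_char_def sign_compose perm_permutation)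
lemma sign_char_inv: "\<sigma> permutes {1..n} \<Longrightarrow> sign_char s (inv \<sigma>) = sign_char s \<sigma>"
  by (simp add: sign_char_def sign_inverse perm_permutation)
lemma sign_char_square [simp]: "sign_char s \<sigma> * sign_char s \<sigma> = 1"
  by (simp add: sign_char_def flip: of_int_mult)
lemma sign_char_swp: "x \<noteq> y \<Longrightarrow> sign_char s (swp x y) = (if s then - 1 else 1)"
  by (simp add: sign_char_def sign_swap_id)

lemma symmetrizer_sum: "symmetrizer s n r (\<Sum>i\<in>A. F i) = (\<Sum>i\<in>A. symmetrizer s n r (F i))"
  unfolding symmetrizer_def
  by (subst sum.swap) (simp add: poly_act_sum qpoly.scale_sum_right cong: sum.cong)
lemma symmetrizer_qscale: "symmetrizer s n r (qscale c F) = qscale c (symmetrizer s n r F)"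
  unfolding symmetrizer_def by (simp add: poly_act_qscale qpoly.scale_sum_right mult.commute cong: sum.cong)

lemma sum_const_qpoly: "(\<Sum>i\<in>A. F) = qscale (of_nat (card A)) (F :: qpoly)"
  by (rule poly_mapping_eqI, subst lookup_sum) simp

lemma symmetrizer_act_right:
  assumes "\<tau> \<in> fibre_stab n r"
  shows "symmetrizer s n r (poly_act \<tau> F) = qscale (sign_char s \<tau>) (symmetrizer s n r F)"
proof -
  have bij: "bij_betw (\<lambda>\<sigma>. \<sigma> \<circ> \<tau>) (fibre_stab n r) (fibre_stab n r)"
  proof (rule bij_betwI[of _ _ _ "\<lambda>\<sigma>. \<sigma> \<circ> inv \<tau>"])
    have "inv \<tau> \<circ> \<tau> = id" "\<tau> \<circ> inv \<tau> = id"
      using fibre_stab_permutes[OF assms] by (auto simp: permutes_inv_o)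
    thus "\<And>x. x \<in> fibre_stab n r \<Longrightarrow> x \<circ> \<tau> \<circ> inv \<tau> = x" "\<And>x. x \<in> fibre_stab n r \<Longrightarrow> x \<circ> inv \<tau> \<circ> \<tau> = x"
      by (simp_all add: comp_assoc)
  qed (use assms in \<open>auto intro: fibre_stab_comp fibre_stab_inv\<close>)
  have "symmetrizer s n r F = (\<Sum>\<sigma>\<in>fibre_stab n r. qscale (sign_char s (\<sigma> \<circ> \<tau>)) (poly_act (\<sigma> \<circ> \<tau>) F))"
    unfolding symmetrizer_def by (rule sum.reindex_bij_betw[OF bij, symmetric])
  also have "\<dots> = (\<Sum>\<sigma>\<in>fibre_stab n r. qscale (sign_char s \<tau>) (qscale (sign_char s \<sigma>) (poly_act \<sigma> (poly_act \<tau> F))))"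
    using assms by (intro sum.cong refl) (simp add: sign_char_comp[OF fibre_stab_permutes fibre_stab_permutes] poly_act_comp mult.commute)
  also have "\<dots> = qscale (sign_char s \<tau>) (symmetrizer s n r (poly_act \<tau> F))"
    by (simp only: symmetrizer_def qpoly.scale_sum_right)
  finally show ?thesis by simp
qed

lemma symmetrizer_act_left:
  assumes "\<tau> \<in> fibre_stab n r"
  shows "poly_act \<tau> (symmetrizer s n r F) = qscale (sign_char s \<tau>) (symmetrizer s n r F)"
proof -
  have bij: "bij_betw (\<lambda>\<sigma>. \<tau> \<circ> \<sigma>) (fibre_stab n r) (fibre_stab n r)"
  proof (rule bij_betwI[of _ _ _ "\<lambda>\<sigma>. inv \<tau> \<circ> \<sigma>"])
    have "inv \<tau> \<circ> \<tau> = id" "\<tau> \<circ> inv \<tau> = id"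
      using fibre_stab_permutes[OF assms] by (auto simp: permutes_inv_o)
    thus "\<And>x. x \<in> fibre_stab n r \<Longrightarrow> inv \<tau> \<circ> (\<tau> \<circ> x) = x" "\<And>x. x \<in> fibre_stab n r \<Longrightarrow> \<tau> \<circ> (inv \<tau> \<circ> x) = x"
      by (simp_all add: comp_assoc[symmetric])
  qed (use assms in \<open>auto intro: fibre_stab_comp fibre_stab_inv\<close>)
  have "symmetrizer s n r F = (\<Sum>\<sigma>\<in>fibre_stab n r. qscale (sign_char s (\<tau> \<circ> \<sigma>)) (poly_act (\<tau> \<circ> \<sigma>) F))"
    unfolding symmetrizer_def by (rule sum.reindex_bij_betw[OF bij, symmetric])
  also have "\<dots> = (\<Sum>\<sigma>\<in>fibre_stab n r. qscale (sign_char s \<tau>) (poly_act \<tau> (qscale (sign_char s \<sigma>) (poly_act \<sigma> F))))"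
    using assms by (intro sum.cong refl) (simp add: sign_char_comp[OF fibre_stab_permutes fibre_stab_permutes] poly_act_comp poly_act_qscale)
  also have "\<dots> = qscale (sign_char s \<tau>) (poly_act \<tau> (symmetrizer s n r F))"
    using assms by (simp only: symmetrizer_def qpoly.scale_sum_right poly_act_sum fibre_stab_bij)
  finally have "qscale (sign_char s \<tau>) (symmetrizer s n r F) = qscale (sign_char s \<tau>) (qscale (sign_char s \<tau>) (poly_act \<tau> (symmetrizer s n r F)))"
    by (rule arg_cong)
  thus ?thesis by simp
qed

lemma symmetrizer_conj:
  assumes g: "g permutes {1..n}"
  shows "symmetrizer s n r (poly_act g F) = poly_act g (symmetrizer s n (r \<circ> g) F)"
proof -
  have bg: "bij g" using g by (rule permutes_bij)
  have ig: "inv g \<circ> g = id" "g \<circ> inv g = id" using g by (auto simp: permutes_inv_o)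
  have in_g: "g x \<in> {1..n} \<longleftrightarrow> x \<in> {1..n}" "inv g x \<in> {1..n} \<longleftrightarrow> x \<in> {1..n}" for x
    using permutes_in_image[OF g] permutes_in_image[OF permutes_inv[OF g]] by blast+
  have bij: "bij_betw (\<lambda>\<sigma>. g \<circ> \<sigma> \<circ> inv g) (fibre_stab n (r \<circ> g)) (fibre_stab n r)"
  proof (rule bij_betwI[of _ _ _ "\<lambda>\<sigma>. inv g \<circ> \<sigma> \<circ> g"])
    show "(\<lambda>\<sigma>. g \<circ> \<sigma> \<circ> inv g) \<in> fibre_stab n (r \<circ> g) \<rightarrow> fibre_stab n r"
    proof (rule funcsetI)
      fix \<sigma> assume s: "\<sigma> \<in> fibre_stab n (r \<circ> g)"
      have "r (g (\<sigma> (inv g x))) = r x" if "x \<in> {1..n}" for x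
      proof -
        have "inv g x \<in> {1..n}" using in_g that by blast
        hence "r (g (\<sigma> (inv g x))) = r (g (inv g x))" using s unfolding fibre_stab_def comp_def by blast
        thus ?thesis using permutes_inverses[OF g] by simp
      qed
      moreover have "g \<circ> \<sigma> \<circ> inv g permutes {1..n}"
        using g s by (intro permutes_compose permutes_inv) (auto simp: fibre_stab_def)
      ultimately show "g \<circ> \<sigma> \<circ> inv g \<in> fibre_stab n r" by (simp add: fibre_stab_def)
    qed
    show "(\<lambda>\<sigma>. inv g \<circ> \<sigma> \<circ> g) \<in> fibre_stab n r \<rightarrow> fibre_stab n (r \<circ> g)"
    proof (rule funcsetI)
      fix \<sigma> assume s: "\<sigma> \<in> fibre_stab n r"
      have "r (g (inv g (\<sigma> (g x)))) = r (g x)" if "x \<in> {1..n}" for x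
      proof -
        have "g x \<in> {1..n}" using in_g that by blast
        hence "r (\<sigma> (g x)) = r (g x)" using s unfolding fibre_stab_def by blast
        thus ?thesis using permutes_inverses[OF g] by simp
      qed
      moreover have "inv g \<circ> \<sigma> \<circ> g permutes {1..n}"
        using g s by (intro permutes_compose permutes_inv) (auto simp: fibre_stab_def)
      ultimately show "inv g \<circ> \<sigma> \<circ> g \<in> fibre_stab n (r \<circ> g)" by (simp add: fibre_stab_def)
    qed
    show "\<And>x. inv g \<circ> (g \<circ> x \<circ> inv g) \<circ> g = x" "\<And>x. g \<circ> (inv g \<circ> x \<circ> g) \<circ> inv g = x"
      using permutes_inverses[OF g] by (simp_all add: fun_eq_iff)
  qed
  have "symmetrizer s n r (poly_act g F)
      = (\<Sum>\<sigma>\<in>fibre_stab n (r \<circ> g). qscale (sign_char s (g \<circ> \<sigma> \<circ> inv g)) (poly_act (g \<circ> \<sigma> \<circ> inv g) (poly_act g F)))"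
    unfolding symmetrizer_def by (rule sum.reindex_bij_betw[OF bij, symmetric])
  also have "\<dots> = (\<Sum>\<sigma>\<in>fibre_stab n (r \<circ> g). poly_act g (qscale (sign_char s \<sigma>) (poly_act \<sigma> F)))"
  proof (intro sum.cong refl)
    fix \<sigma> assume s: "\<sigma> \<in> fibre_stab n (r \<circ> g)"
    have p: "\<sigma> permutes {1..n}" using s by (rule fibre_stab_permutes)
    have "sign_char s (g \<circ> \<sigma> \<circ> inv g) = sign_char s \<sigma> * (sign_char s g * sign_char s g)"
      by (simp only: sign_char_comp[OF permutes_compose[OF p g] permutes_inv[OF g]] sign_char_comp[OF g p] sign_char_inv[OF g] mult_ac)
    moreover have "g \<circ> \<sigma> \<circ> inv g \<circ> g = g \<circ> \<sigma>" by (simp add: comp_assoc ig)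
    moreover have "bij (g \<circ> \<sigma> \<circ> inv g)" "bij \<sigma>" using p bg by (auto simp: permutes_bij bij_comp bij_imp_bij_inv)
    ultimately show "qscale (sign_char s (g \<circ> \<sigma> \<circ> inv g)) (poly_act (g \<circ> \<sigma> \<circ> inv g) (poly_act g F))
        = poly_act g (qscale (sign_char s \<sigma>) (poly_act \<sigma> F))"
      using bg by (simp add: poly_act_comp poly_act_qscale)
  qed
  also have "\<dots> = poly_act g (symmetrizer s n (r \<circ> g) F)"
    by (simp only: symmetrizer_def poly_act_sum[OF bg])
  finally show ?thesis .
qed

lemma ip_sym: "ip (symmetrizer s n r F) G = ip F (symmetrizer s n r G)"
proof -
  have bij: "bij_betw inv (fibre_stab n r) (fibre_stab n r)"
    by (rule bij_betwI[of _ _ _ inv]) (auto simp: fibre_stab_inv inv_inv_eq)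
  have "ip F (symmetrizer s n r G) = (\<Sum>\<sigma>\<in>fibre_stab n r. sign_char s (inv \<sigma>) * ip F (poly_act (inv \<sigma>) G))"
    unfolding symmetrizer_def ip_sum_right ip_qscale_right by (rule sum.reindex_bij_betw[OF bij, symmetric])
  also have "\<dots> = (\<Sum>\<sigma>\<in>fibre_stab n r. sign_char s \<sigma> * ip (poly_act \<sigma> F) G)"
    by (intro sum.cong refl) (simp add: sign_char_inv[OF fibre_stab_permutes] ip_poly_act_left)
  also have "\<dots> = ip (symmetrizer s n r F) G" by (simp add: symmetrizer_def ip_sum_left ip_qscale_left)
  finally show ?thesis ..
qed

section \<open>Moving one index to another fibre\<close>

text \<open>
  Suppose that \<open>u\<close> is symmetric (or antisymmetric) with respect to the fibres of \<open>r\<close>, and becomes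
  zero on symmetrizing again after \<open>y\<close> has been moved to the fibre over \<open>i\<close>. Coset representatives
  of the new stabilizer modulo the permutations in both stabilizers are the transpositions of \<open>y\<close>
  with the elements of the enlarged fibre, which gives a linear relation between the corresponding
  images of \<open>u\<close>.
\<close>

lemma symmetrizer_move:
  fixes r :: "nat \<Rightarrow> nat"
  assumes y: "y \<in> {1..n}" "r y \<noteq> i"
    and u: "\<And>\<tau>. \<tau> \<in> fibre_stab n r \<Longrightarrow> poly_act \<tau> u = qscale (sign_char s \<tau>) u"
    and zero: "symmetrizer s n (r(y := i)) u = 0"
  shows "(\<Sum>x\<in>{x \<in> {1..n}. r x = i}. poly_act (swp x y) u) = qscale (if s then 1 else - 1) u"
proof -
  let ?r = "r(y := i)"
  define X where "X = {x \<in> {1..n}. r x = i}"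
  define K where "K = {\<sigma> \<in> fibre_stab n r. \<sigma> y = y}"
  have finX: "finite X" and yX: "y \<notin> X" using y by (auto simp: X_def)
  have finK: "finite K" by (rule finite_subset[OF _ finite_fibre_stab[of n r]]) (auto simp: K_def)
  have "id \<in> K" by (simp add: K_def)
  hence K0: "card K > 0" using finK by (auto simp: card_gt_0_iff)
  have bij: "bij_betw (\<lambda>(z, \<kappa>). swp z y \<circ> \<kappa>) (insert y X \<times> K) (fibre_stab n ?r)"
  proof (rule bij_betwI[of _ _ _ "\<lambda>\<sigma>. (\<sigma> y, swp (\<sigma> y) y \<circ> \<sigma>)"])
    show "(\<lambda>(z, \<kappa>). swp z y \<circ> \<kappa>) \<in> insert y X \<times> K \<rightarrow> fibre_stab n ?r"
    proof (rule funcsetI, clarify)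
      fix z \<kappa> assume z: "z \<in> insert y X" and k: "\<kappa> \<in> K"
      have kp: "\<kappa> permutes {1..n}" "\<kappa> y = y" and kr: "\<And>x. x \<in> {1..n} \<Longrightarrow> r (\<kappa> x) = r x"
        using k by (auto simp: K_def fibre_stab_def)
      have kx: "\<kappa> x = y \<longleftrightarrow> x = y" for x using kp by (metis permutes_inj injD)
      have "swp z y permutes {1..n}" using z y by (intro permutes_swap_id) (auto simp: X_def)
      hence "swp z y \<circ> \<kappa> permutes {1..n}" using kp by (intro permutes_compose)
      moreover have "?r ((swp z y \<circ> \<kappa>) x) = ?r x" if x: "x \<in> {1..n}" for x
      proof (cases "x = y")
        case True thus ?thesis using kp z by (auto simp: X_def)
      next
        case False
        hence ky: "\<kappa> x \<noteq> y" using kx by simp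
        show ?thesis
        proof (cases "\<kappa> x = z")
          case True
          hence "r x = i" using kr[OF x] z ky by (auto simp: X_def)
          thus ?thesis using True False by simp
        qed (use ky kr[OF x] False in simp)
      qed
      ultimately show "swp z y \<circ> \<kappa> \<in> fibre_stab n ?r" by (simp add: fibre_stab_def del: fun_upd_apply)
    qed
    show "(\<lambda>\<sigma>. (\<sigma> y, swp (\<sigma> y) y \<circ> \<sigma>)) \<in> fibre_stab n ?r \<rightarrow> insert y X \<times> K"
    proof (rule funcsetI)
      fix \<sigma> assume s: "\<sigma> \<in> fibre_stab n ?r"
      have sp: "\<sigma> permutes {1..n}" and sr: "\<And>x. x \<in> {1..n} \<Longrightarrow> ?r (\<sigma> x) = ?r x"
        using s unfolding fibre_stab_def by blast+
      have sy: "\<sigma> y \<in> {1..n}" using permutes_in_image[OF sp] y by blast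
      have zX: "\<sigma> y \<in> insert y X" using sr[OF y(1)] sy by (auto simp: X_def split: if_splits)
      have inj: "\<sigma> a = \<sigma> b \<longleftrightarrow> a = b" for a b using permutes_inj[OF sp] by (simp add: inj_eq)
      have "swp (\<sigma> y) y permutes {1..n}" using sy y by (intro permutes_swap_id)
      hence "swp (\<sigma> y) y \<circ> \<sigma> permutes {1..n}" using sp by (intro permutes_compose)
      moreover have "r ((swp (\<sigma> y) y \<circ> \<sigma>) x) = r x" if x: "x \<in> {1..n}" for x
      proof (cases "x = y")
        case False
        hence ne: "\<sigma> x \<noteq> \<sigma> y" using inj by simp
        show ?thesis
        proof (cases "\<sigma> x = y")
          case True
          hence "r x = i" using sr[OF x] False by simp
          moreover have "r (\<sigma> y) = i" using zX True ne by (auto simp: X_def)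
          ultimately show ?thesis using True by simp
        qed (use ne sr[OF x] False in simp)
      qed simp
      ultimately show "(\<sigma> y, swp (\<sigma> y) y \<circ> \<sigma>) \<in> insert y X \<times> K"
        using zX by (simp add: K_def fibre_stab_def)
    qed
    show "(\<lambda>\<sigma>. (\<sigma> y, swp (\<sigma> y) y \<circ> \<sigma>)) ((\<lambda>(z, \<kappa>). swp z y \<circ> \<kappa>) p) = p" if "p \<in> insert y X \<times> K" for p
      using that by (auto simp: K_def comp_assoc[symmetric])
    show "(\<lambda>(z, \<kappa>). swp z y \<circ> \<kappa>) ((\<lambda>\<sigma>. (\<sigma> y, swp (\<sigma> y) y \<circ> \<sigma>)) \<sigma>) = \<sigma>" for \<sigma>
      by (simp add: comp_assoc[symmetric])
  qed
  define \<epsilon> :: rat where "\<epsilon> = (if s then - 1 else 1)"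
  have term1: "qscale (sign_char s (swp z y \<circ> \<kappa>)) (poly_act (swp z y \<circ> \<kappa>) u) = qscale (sign_char s (swp z y)) (poly_act (swp z y) u)"
    if "z \<in> insert y X" "\<kappa> \<in> K" for z \<kappa>
  proof -
    have k: "\<kappa> \<in> fibre_stab n r" using that by (simp add: K_def)
    have p: "swp z y permutes {1..n}" using that y by (intro permutes_swap_id) (auto simp: X_def)
    have "poly_act (swp z y \<circ> \<kappa>) u = qscale (sign_char s \<kappa>) (poly_act (swp z y) u)"
      using k by (simp add: u poly_act_qscale flip: poly_act_comp)
    thus ?thesis using sign_char_comp[OF p fibre_stab_permutes[OF k]] by simp
  qed
  have "symmetrizer s n ?r u = (\<Sum>p\<in>insert y X \<times> K. case p of (z, \<kappa>) \<Rightarrow>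
      qscale (sign_char s (swp z y \<circ> \<kappa>)) (poly_act (swp z y \<circ> \<kappa>) u))"
    unfolding symmetrizer_def by (subst sum.reindex_bij_betw[OF bij, symmetric]) (simp add: case_prod_beta)
  also have "\<dots> = (\<Sum>z\<in>insert y X. \<Sum>\<kappa>\<in>K. qscale (sign_char s (swp z y)) (poly_act (swp z y) u))"
    unfolding sum.cartesian_product[symmetric] by (intro sum.cong refl term1)
  also have "\<dots> = qscale (of_nat (card K)) (\<Sum>z\<in>insert y X. qscale (sign_char s (swp z y)) (poly_act (swp z y) u))"
    by (simp only: sum_const_qpoly qpoly.scale_sum_right)
  also have "(\<Sum>z\<in>insert y X. qscale (sign_char s (swp z y)) (poly_act (swp z y) u))
      = u + qscale \<epsilon> (\<Sum>z\<in>X. poly_act (swp z y) u)"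
  proof -
    have "sign_char s (swp z y) = \<epsilon>" if "z \<in> X" for z
      using that yX sign_char_swp[of z y s] by (cases "z = y") (simp_all add: \<epsilon>_def)
    hence "(\<Sum>z\<in>X. qscale (sign_char s (swp z y)) (poly_act (swp z y) u)) = (\<Sum>z\<in>X. qscale \<epsilon> (poly_act (swp z y) u))"
      by (intro sum.cong refl) simp
    thus ?thesis using finX yX by (simp add: qpoly.scale_sum_right)
  qed
  finally have "qscale (of_nat (card K)) (u + qscale \<epsilon> (\<Sum>z\<in>X. poly_act (swp z y) u)) = 0"
    unfolding zero by (rule HOL.sym)
  hence "u + qscale \<epsilon> (\<Sum>z\<in>X. poly_act (swp z y) u) = 0" using K0 by simp
  hence "qscale \<epsilon> (\<Sum>z\<in>X. poly_act (swp z y) u) = - u" by (simp add: eq_neg_iff_add_eq_0 add.commute)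
  hence "qscale \<epsilon> (qscale \<epsilon> (\<Sum>z\<in>X. poly_act (swp z y) u)) = qscale (- \<epsilon>) u" by simp
  thus ?thesis by (simp add: X_def \<epsilon>_def split: if_splits)
qed

section \<open>The sum of all transpositions\<close>

text \<open>Twice the sum of all transpositions of $\{1, \ldots, n\}$, which is central in the group algebra.\<close>

definition swap_sum :: "nat \<Rightarrow> qpoly \<Rightarrow> qpoly" where
  "swap_sum n F = (\<Sum>(x, y)\<in>{(x, y). x \<in> {1..n} \<and> y \<in> {1..n} \<and> x \<noteq> y}. poly_act (swp x y) F)"

text \<open>The ordered pairs of distinct indices in the same fibre of \<open>r\<close>.\<close>

definition same_pairs :: "nat \<Rightarrow> (nat \<Rightarrow> nat) \<Rightarrow> (nat \<times> nat) set" where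
  "same_pairs n r = {(x, y). x \<in> {1..n} \<and> y \<in> {1..n} \<and> x \<noteq> y \<and> r x = r y}"

lemma finite_pairs: "finite {(x, y). x \<in> {1..n::nat} \<and> y \<in> {1..n} \<and> P x y}"
  by (rule finite_subset[of _ "{1..n} \<times> {1..n}"]) auto

lemma swap_sum_commute:
  assumes g: "g permutes {1..n}"
  shows "swap_sum n (poly_act g F) = poly_act g (swap_sum n F)"
proof -
  let ?A = "{(x, y). x \<in> {1..n} \<and> y \<in> {1..n} \<and> x \<noteq> y}"
  have bg: "bij g" using g by (rule permutes_bij)
  have inj: "g a = g b \<longleftrightarrow> a = b" for a b using permutes_inj[OF g] by (simp add: inj_eq)
  have in_g: "g x \<in> {1..n} \<longleftrightarrow> x \<in> {1..n}" "inv g x \<in> {1..n} \<longleftrightarrow> x \<in> {1..n}" for x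
    using permutes_in_image[OF g] permutes_in_image[OF permutes_inv[OF g]] by blast+
  have bij: "bij_betw (\<lambda>(x, y). (g x, g y)) ?A ?A"
  proof (rule bij_betwI[of _ _ _ "\<lambda>(x, y). (inv g x, inv g y)"])
    show "(\<lambda>(x, y). (inv g x, inv g y)) \<in> ?A \<rightarrow> ?A"
      using in_g permutes_inv_eq[OF g] permutes_inverses[OF g] by (auto simp del: atLeastAtMost_iff)
  qed (use inj in_g permutes_inverses[OF g] in \<open>auto simp del: atLeastAtMost_iff\<close>)
  have "swap_sum n (poly_act g F) = (\<Sum>(x, y)\<in>?A. poly_act (swp (g x) (g y)) (poly_act g F))"
    unfolding swap_sum_def by (subst sum.reindex_bij_betw[OF bij, symmetric]) (simp add: case_prod_beta)
  also have "\<dots> = (\<Sum>(x, y)\<in>?A. poly_act g (poly_act (swp x y) F))"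
  proof (intro sum.cong refl, clarify)
    fix x y
    have "swp (g x) (g y) \<circ> g = g \<circ> swp x y" by (auto simp: fun_eq_iff Transposition.transpose_def inj)
    thus "poly_act (swp (g x) (g y)) (poly_act g F) = poly_act g (poly_act (swp x y) F)"
      by (simp add: poly_act_comp bg)
  qed
  also have "\<dots> = poly_act g (swap_sum n F)" unfolding swap_sum_def poly_act_sum[OF bg] by (simp add: case_prod_beta)
  finally show ?thesis .
qed

lemma swap_sum_sum: "swap_sum n (\<Sum>i\<in>A. F i) = (\<Sum>i\<in>A. swap_sum n (F i))"
  unfolding swap_sum_def by (subst sum.swap) (simp add: poly_act_sum case_prod_beta cong: sum.cong)

lemma swap_sum_qscale: "swap_sum n (qscale c F) = qscale c (swap_sum n F)"
  unfolding swap_sum_def by (simp add: qpoly.scale_sum_right poly_act_qscale case_prod_beta)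

lemma swap_sum_sym: "swap_sum n (symmetrizer s n r F) = symmetrizer s n r (swap_sum n F)"
  unfolding symmetrizer_def swap_sum_sum
  by (intro sum.cong refl) (simp add: swap_sum_qscale swap_sum_commute[OF fibre_stab_permutes])

text \<open>
  The transpositions within a fibre act by a sign; those between different fibres are summed
  up by \<open>symmetrizer_move\<close>, for all pairs of an index \<open>y\<close> and a smaller label \<open>i < r y\<close>.
\<close>

lemma swap_sum_eigen:
  fixes r :: "nat \<Rightarrow> nat"
  assumes u: "\<And>\<tau>. \<tau> \<in> fibre_stab n r \<Longrightarrow> poly_act \<tau> u = qscale (sign_char s \<tau>) u"
    and zero: "\<And>y i. y \<in> {1..n} \<Longrightarrow> i < r y \<Longrightarrow> symmetrizer s n (r(y := i)) u = 0"
  shows "swap_sum n u = qscale ((if s then - 1 else 1) * (of_nat (card (same_pairs n r)) - 2 * of_nat (\<Sum>x\<in>{1..n}. r x))) u"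
proof -
  define \<epsilon> :: rat where "\<epsilon> = (if s then - 1 else 1)"
  let ?I = "{1..n}"
  let ?E = "same_pairs n r"
  let ?L = "{(x, y). x \<in> ?I \<and> y \<in> ?I \<and> r x < r y}"
  let ?G = "{(x, y). x \<in> ?I \<and> y \<in> ?I \<and> r y < r x}"
  let ?f = "\<lambda>(x, y). poly_act (swp x y) u"
  have fin: "finite ?E" "finite ?L" "finite ?G" unfolding same_pairs_def by (rule finite_pairs)+
  have "{(x, y). x \<in> ?I \<and> y \<in> ?I \<and> x \<noteq> y} = ?E \<union> (?L \<union> ?G)" by (auto simp: same_pairs_def)
  hence "swap_sum n u = sum ?f (?E \<union> (?L \<union> ?G))" by (simp add: swap_sum_def)
  also have "\<dots> = sum ?f ?E + (sum ?f ?L + sum ?f ?G)"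
    using fin by (subst sum.union_disjoint; (subst sum.union_disjoint)?) (auto simp: same_pairs_def)
  also have "sum ?f ?G = sum ?f ?L"
    by (rule sum.reindex_bij_witness[of _ "\<lambda>(x, y). (y, x)" "\<lambda>(x, y). (y, x)"])
      (auto simp: transpose_commute)
  also have "sum ?f ?E = qscale (\<epsilon> * of_nat (card ?E)) u"
  proof -
    have "sum ?f ?E = (\<Sum>p\<in>?E. qscale \<epsilon> u)"
    proof (intro sum.cong refl, clarify)
      fix x y assume xy: "(x, y) \<in> ?E"
      have "swp x y permutes ?I" using xy by (intro permutes_swap_id) (auto simp: same_pairs_def)
      hence "swp x y \<in> fibre_stab n r"
        using xy by (auto simp: fibre_stab_def same_pairs_def Transposition.transpose_def)
      thus "poly_act (swp x y) u = qscale \<epsilon> u"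
        using xy by (simp add: u sign_char_swp same_pairs_def \<epsilon>_def)
    qed
    thus ?thesis by (simp only: sum_const_qpoly) (simp add: mult.commute)
  qed
  also have "sum ?f ?L = qscale (- \<epsilon> * of_nat (\<Sum>x\<in>?I. r x)) u"
  proof -
    have "sum ?f ?L = (\<Sum>(y, i, x)\<in>(SIGMA y:?I. SIGMA i:{..<r y}. {x \<in> ?I. r x = i}). poly_act (swp x y) u)"
      by (rule sum.reindex_bij_witness[of _ "\<lambda>(y, i, x). (x, y)" "\<lambda>(x, y). (y, r x, x)"]) auto
    also have "\<dots> = (\<Sum>y\<in>?I. \<Sum>i\<in>{..<r y}. \<Sum>x\<in>{x \<in> ?I. r x = i}. poly_act (swp x y) u)"
      by (simp add: sum.Sigma)
    also have "\<dots> = (\<Sum>y\<in>?I. \<Sum>i\<in>{..<r y}. qscale (- \<epsilon>) u)"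
    proof (intro sum.cong refl)
      fix y i assume "y \<in> ?I" "i \<in> {..<r y}"
      thus "(\<Sum>x\<in>{x \<in> ?I. r x = i}. poly_act (swp x y) u) = qscale (- \<epsilon>) u"
        using symmetrizer_move[where y = y and n = n and r = r and i = i and s = s and u = u] u zero by (simp add: \<epsilon>_def)
    qed
    also have "\<dots> = qscale (- \<epsilon> * of_nat (\<Sum>x\<in>?I. r x)) u"
      by (intro poly_mapping_eqI)
        (simp only: sum_const_qpoly card_lessThan lookup_sum lookup_qscale of_nat_sum
          sum_distrib_left sum_distrib_right mult_ac)
    finally show ?thesis .
  qed
  finally have eq: "swap_sum n u = qscale (\<epsilon> * of_nat (card ?E)) u
    + (qscale (- \<epsilon> * of_nat (\<Sum>x\<in>?I. r x)) u + qscale (- \<epsilon> * of_nat (\<Sum>x\<in>?I. r x)) u)" .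
  show ?thesis unfolding eq
    by (rule poly_mapping_eqI) (simp only: lookup_add lookup_qscale \<epsilon>_def, simp add: algebra_simps)
qed

text \<open>
  Minimality of the total label of \<open>r\<close> for \<open>w\<close> is inherited by the symmetrization of \<open>w\<close>, since the
  total label does not change when \<open>r'\<close> is composed with a permutation.
\<close>

lemma symmetrizer_symmetrizer_minimal:
  assumes min: "\<And>r'. (\<Sum>x\<in>{1..n}. r' x) < (\<Sum>x\<in>{1..n}. r x) \<Longrightarrow> symmetrizer s n r' w = 0"
    and lt: "(\<Sum>x\<in>{1..n}. r' x) < (\<Sum>x\<in>{1..n}. r x)"
  shows "symmetrizer s n r' (symmetrizer s n r w) = 0"
proof -
  have "symmetrizer s n r' (poly_act \<sigma> w) = 0" if s: "\<sigma> \<in> fibre_stab n r" for \<sigma>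
  proof -
    have p: "\<sigma> permutes {1..n}" using s by (rule fibre_stab_permutes)
    have "(\<Sum>x\<in>{1..n}. (r' \<circ> \<sigma>) x) = (\<Sum>x\<in>{1..n}. r' x)" using sum.permute[OF p, of r'] by simp
    thus ?thesis using min[of "r' \<circ> \<sigma>"] lt by (simp add: symmetrizer_conj[OF p])
  qed
  thus ?thesis by (simp add: symmetrizer_def[of s n r] symmetrizer_sum symmetrizer_qscale)
qed

lemma sum_update_less:
  fixes r :: "nat \<Rightarrow> nat"
  assumes "y \<in> {1..n}" "i < r y"
  shows "(\<Sum>x\<in>{1..n}. (r(y := i)) x) < (\<Sum>x\<in>{1..n}. r x)"
  by (rule sum_strict_mono_ex1) (use assms in auto)

lemma fibre_stab_inj: assumes "inj r" shows "fibre_stab n r = {id}"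
proof -
  have "\<sigma> = id" if "\<sigma> \<in> fibre_stab n r" for \<sigma>
  proof
    fix x
    have "\<sigma> x = x" if "x \<in> {1..n}"
      using that \<open>\<sigma> \<in> fibre_stab n r\<close> assms by (auto simp: fibre_stab_def inj_eq)
    thus "\<sigma> x = id x" using permutes_not_in[OF fibre_stab_permutes[OF \<open>\<sigma> \<in> fibre_stab n r\<close>]] by auto
  qed
  thus ?thesis by auto
qed

lemma symmetrizer_minimal_exists:
  assumes "w \<noteq> 0"
  obtains r where "symmetrizer s n r w \<noteq> 0"
    "swap_sum n (symmetrizer s n r w) = qscale ((if s then - 1 else 1) *
       (of_nat (card (same_pairs n r)) - 2 * of_nat (\<Sum>x\<in>{1..n}. r x))) (symmetrizer s n r w)"
proof -
  have "symmetrizer s n id w = w" by (simp add: symmetrizer_def fibre_stab_inj)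
  hence "symmetrizer s n id w \<noteq> 0" using assms by simp
  then obtain r where r: "symmetrizer s n r w \<noteq> 0"
    "\<And>r'. symmetrizer s n r' w \<noteq> 0 \<Longrightarrow> (\<Sum>x\<in>{1..n}. r x) \<le> (\<Sum>x\<in>{1..n}. r' x)"
    using ex_has_least_nat[of "\<lambda>r. symmetrizer s n r w \<noteq> 0" id "\<lambda>r. \<Sum>x\<in>{1..n}. r x"] by blast
  have "swap_sum n (symmetrizer s n r w) = qscale ((if s then - 1 else 1) *
       (of_nat (card (same_pairs n r)) - 2 * of_nat (\<Sum>x\<in>{1..n}. r x))) (symmetrizer s n r w)"
  proof (rule swap_sum_eigen)
    show "poly_act \<tau> (symmetrizer s n r w) = qscale (sign_char s \<tau>) (symmetrizer s n r w)" if "\<tau> \<in> fibre_stab n r" for \<tau>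
      using that by (rule symmetrizer_act_left)
    show "symmetrizer s n (r(y := i)) (symmetrizer s n r w) = 0" if "y \<in> {1..n}" "i < r y" for y i
      using r(2) by (intro symmetrizer_symmetrizer_minimal sum_update_less[of y n i r, OF that]) (meson not_le)
  qed
  thus ?thesis using that r(1) by blast
qed

text \<open>
  Each unordered pair in a common column consists of an upper entry \<open>x\<close> and a lower entry \<open>y\<close>, and
  is determined by \<open>y\<close> and the row \<open>r x\<close>, which is less than \<open>r y\<close>. Equality means that above each entry of a column there are
  no gaps.
\<close>

lemma same_pairs_bound:
  assumes inj: "inj_on (\<lambda>x. (r x, c x)) {1..n}"
  shows "card (same_pairs n c) \<le> 2 * (\<Sum>x\<in>{1..n}. r x)"
    and "card (same_pairs n c) = 2 * (\<Sum>x\<in>{1..n}. r x) \<Longrightarrow> y \<in> {1..n} \<Longrightarrow> i < r y \<Longrightarrow>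
      \<exists>x\<in>{1..n}. c x = c y \<and> r x = i"
proof -
  let ?A = "{(x, y). x \<in> {1..n} \<and> y \<in> {1..n} \<and> c x = c y \<and> r x < r y}"
  let ?B = "SIGMA y:{1..n}. {..<r y}"
  have finA: "finite ?A" using finite_pairs[of n "\<lambda>x y. c x = c y \<and> r x < r y"] by simp
  have ne: "r x \<noteq> r y" if "x \<in> {1..n}" "y \<in> {1..n}" "c x = c y" "x \<noteq> y" for x y
    using inj that unfolding inj_on_def by blast
  have "same_pairs n c = ?A \<union> prod.swap ` ?A"
  proof (intro equalityI subsetI)
    fix p assume p: "p \<in> same_pairs n c"
    obtain x y where xy: "p = (x, y)" by fastforce
    have h: "x \<in> {1..n}" "y \<in> {1..n}" "x \<noteq> y" "c x = c y" using p xy by (auto simp: same_pairs_def)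
    have "r x < r y \<or> r y < r x" using ne[OF h(1,2,4,3)] by linarith
    hence "(x, y) \<in> ?A \<or> (y, x) \<in> ?A" using h by simp
    thus "p \<in> ?A \<union> prod.swap ` ?A" using xy by force
  qed (auto simp: same_pairs_def)
  moreover have "?A \<inter> prod.swap ` ?A = {}" by auto
  ultimately have cA: "card (same_pairs n c) = 2 * card ?A"
    using finA by (simp add: card_Un_disjoint card_image)
  let ?h = "\<lambda>(x, y). (y, r x)"
  have im: "?h ` ?A \<subseteq> ?B" by auto
  have "inj_on ?h ?A" using ne by (auto simp: inj_on_def) metis
  hence ci: "card (?h ` ?A) = card ?A" by (rule card_image)
  have cB: "card ?B = (\<Sum>x\<in>{1..n}. r x)" by simp
  have "card (?h ` ?A) \<le> card ?B" using im by (intro card_mono) auto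
  thus "card (same_pairs n c) \<le> 2 * (\<Sum>x\<in>{1..n}. r x)" using cA ci cB by simp
  show "\<exists>x\<in>{1..n}. c x = c y \<and> r x = i"
    if "card (same_pairs n c) = 2 * (\<Sum>x\<in>{1..n}. r x)" "y \<in> {1..n}" "i < r y"
  proof -
    have "?h ` ?A = ?B" using im that(1) cA ci cB by (intro card_subset_eq) auto
    moreover have "(y, i) \<in> ?B" using that by simp
    ultimately have "(y, i) \<in> ?h ` ?A" by simp
    then obtain x where "(x, y) \<in> ?A" "r x = i" by auto
    thus ?thesis by auto
  qed
qed

text \<open>
  No non-zero polynomial is killed by all Young symmetrizers. The last two properties say that the
  pairs \<open>(r x, c x)\<close> form a Young diagram.
\<close>

theorem young_symmetrizer_exists:
  assumes "F \<noteq> 0"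
  obtains r c where "symmetrizer False n r (symmetrizer True n c F) \<noteq> 0" "inj_on (\<lambda>x. (r x, c x)) {1..n}"
    "\<And>y i. y \<in> {1..n} \<Longrightarrow> i < r y \<Longrightarrow> \<exists>x\<in>{1..n}. c x = c y \<and> r x = i"
    "\<And>y i. y \<in> {1..n} \<Longrightarrow> i < c y \<Longrightarrow> \<exists>x\<in>{1..n}. r x = r y \<and> c x = i"
proof -
  obtain c where c: "symmetrizer True n c F \<noteq> 0" "swap_sum n (symmetrizer True n c F) =
      qscale (- (of_nat (card (same_pairs n c)) - 2 * of_nat (\<Sum>x\<in>{1..n}. c x))) (symmetrizer True n c F)"
    using symmetrizer_minimal_exists[OF assms, of True n] by auto
  define v where "v = symmetrizer True n c F"
  obtain r where r: "symmetrizer False n r v \<noteq> 0" "swap_sum n (symmetrizer False n r v) =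
      qscale (of_nat (card (same_pairs n r)) - 2 * of_nat (\<Sum>x\<in>{1..n}. r x)) (symmetrizer False n r v)"
    using symmetrizer_minimal_exists[of v False n] c(1) by (auto simp: v_def)
  define u where "u = symmetrizer False n r v"
  have inj: "inj_on (\<lambda>x. (r x, c x)) {1..n}"
  proof (rule inj_onI, rule ccontr)
    fix x y assume xy: "x \<in> {1..n}" "y \<in> {1..n}" "(r x, c x) = (r y, c y)" "x \<noteq> y"
    have p: "swp x y permutes {1..n}" using xy by (intro permutes_swap_id) auto
    have "swp x y \<in> fibre_stab n r" "swp x y \<in> fibre_stab n c"
      using p xy by (auto simp: fibre_stab_def Transposition.transpose_def)
    note fibre_stab = this
    have "poly_act (swp x y) v = - v"
      using symmetrizer_act_left[OF fibre_stab(2), of True F] by (simp add: v_def sign_char_swp[OF xy(4)])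
    moreover have "symmetrizer False n r (poly_act (swp x y) v) = u"
      using symmetrizer_act_right[OF fibre_stab(1), of False v] by (simp add: u_def sign_char_swp[OF xy(4)])
    ultimately have "symmetrizer False n r (qscale (-1) v) = u" by simp
    hence "qscale (- 1) u = u" by (simp only: symmetrizer_qscale u_def)
    hence "- lookup u m = lookup u m" for m by (metis lookup_uminus qscale_minus_one)
    hence "u = 0" by (intro poly_mapping_eqI) (metis lookup_zero neg_equal_zero)
    thus False using r(1) by (simp add: u_def)
  qed
  \<comment> \<open>Comparison of the two eigenvalues on \<open>u\<close>; the inequalities of \<open>same_pairs_bound\<close> then
      become equalities.\<close>
  have "swap_sum n u = qscale (- (of_nat (card (same_pairs n c)) - 2 * of_nat (\<Sum>x\<in>{1..n}. c x))) u"
    unfolding u_def swap_sum_sym by (simp only: v_def c(2) symmetrizer_qscale)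
  hence "of_nat (card (same_pairs n r)) - 2 * of_nat (\<Sum>x\<in>{1..n}. r x)
      = - (of_nat (card (same_pairs n c)) - 2 * of_nat (\<Sum>x\<in>{1..n}. c x) :: rat)"
    using r by (metis qpoly.scale_right_imp_eq u_def)
  hence "rat_of_nat (card (same_pairs n r) + card (same_pairs n c))
      = rat_of_nat (2 * (\<Sum>x\<in>{1..n}. r x) + 2 * (\<Sum>x\<in>{1..n}. c x))" by simp
  hence eq: "card (same_pairs n r) + card (same_pairs n c) = 2 * (\<Sum>x\<in>{1..n}. r x) + 2 * (\<Sum>x\<in>{1..n}. c x)"
    unfolding of_nat_eq_iff .
  have inj': "inj_on (\<lambda>x. (c x, r x)) {1..n}" using inj unfolding inj_on_def by blast
  note b = same_pairs_bound[OF inj] same_pairs_bound[OF inj']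
  show ?thesis
  proof (rule that[of r c])
    show "symmetrizer False n r (symmetrizer True n c F) \<noteq> 0" using r(1) by (simp add: v_def)
    show "inj_on (\<lambda>x. (r x, c x)) {1..n}" by (rule inj)
    show "\<exists>x\<in>{1..n}. c x = c y \<and> r x = i" if "y \<in> {1..n}" "i < r y" for y i
      using b(2)[OF _ that] b(1,3) eq by linarith
    show "\<exists>x\<in>{1..n}. r x = r y \<and> c x = i" if "y \<in> {1..n}" "i < c y" for y i
      using b(4)[OF _ that] b(1,3) eq by linarith
  qed
qed

section \<open>Straightening\<close>

lemma ex_lexi_max:
  fixes f g :: "'a \<Rightarrow> nat"
  assumes "finite K" "K \<noteq> {}"
  obtains m where "m \<in> K" "\<And>m'. m' \<in> K \<Longrightarrow> f m' \<le> f m" "\<And>m'. m' \<in> K \<Longrightarrow> f m' = f m \<Longrightarrow> g m' \<le> g m"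
proof -
  define K1 where "K1 = {m \<in> K. f m = Max (f ` K)}"
  have "Max (f ` K) \<in> f ` K" using assms by (intro Max_in) auto
  hence ne: "K1 \<noteq> {}" by (force simp: K1_def)
  have fin: "finite K1" using assms by (simp add: K1_def)
  have "Max (g ` K1) \<in> g ` K1" using fin ne by (intro Max_in) auto
  then obtain m where m: "m \<in> K1" "g m = Max (g ` K1)" by force
  have "f m' \<le> f m" if "m' \<in> K" for m' using m(1) that assms by (simp add: K1_def)
  moreover have "g m' \<le> g m" if "m' \<in> K" "f m' = f m" for m'
  proof -
    have "m' \<in> K1" using that m(1) by (simp add: K1_def)
    thus ?thesis using fin by (simp add: m(2))
  qed
  moreover have "m \<in> K" using m(1) by (simp add: K1_def)
  ultimately show ?thesis using that[of m] by blast
qed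

lemma lookup_symmetrizer_invariant:
  assumes "\<tau> \<in> fibre_stab n r"
  shows "lookup (symmetrizer False n r v) (mperm \<tau> m) = lookup (symmetrizer False n r v) m"
proof -
  have "lookup (poly_act \<tau> (symmetrizer False n r v)) m = lookup (symmetrizer False n r v) m"
    using symmetrizer_act_left[OF assms, of False v] by (simp add: sign_char_def)
  thus ?thesis using assms by simp
qed

lemma keys_symmetrizer:
  assumes "m \<in> keys (symmetrizer s n r F)"
  obtains \<sigma> where "\<sigma> \<in> fibre_stab n r" "mperm \<sigma> m \<in> keys F"
proof -
  have "lookup (symmetrizer s n r F) m \<noteq> 0" using assms by (simp add: in_keys_iff)
  hence "(\<Sum>\<sigma>\<in>fibre_stab n r. sign_char s \<sigma> * lookup F (mperm \<sigma> m)) \<noteq> 0"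
    by (simp add: symmetrizer_def lookup_sum)
  then obtain \<sigma> where "\<sigma> \<in> fibre_stab n r" "sign_char s \<sigma> * lookup F (mperm \<sigma> m) \<noteq> 0"
    by (rule sum.not_neutral_contains_not_neutral)
  thus ?thesis using that by (simp add: in_keys_iff)
qed

lemma hom_polys_symmetrizer: "F \<in> hom_polys {1..n} d \<Longrightarrow> symmetrizer s n r F \<in> hom_polys {1..n} d"
  unfolding symmetrizer_def
  by (intro qpoly.subspace_sum qpoly.subspace_scale hom_polys_subspace hom_polys_act) (simp_all add: fibre_stab_def)

lemma contr_filt_symmetrizer: "F \<in> contr_filt g \<Longrightarrow> symmetrizer s n r F \<in> contr_filt g"
  unfolding symmetrizer_def
  by (intro qpoly.subspace_sum qpoly.subspace_scale contr_filt_subspace contr_filt_poly_act) simp_all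

text \<open>
  The functions \<open>r\<close> and \<open>c\<close> are the row and the column index of a bijective filling of a Young
  diagram by $1, \ldots, n$.
\<close>

locale young_coords =
  fixes n :: nat and r c :: "nat \<Rightarrow> nat"
  assumes inj: "x \<in> {1..n} \<Longrightarrow> y \<in> {1..n} \<Longrightarrow> r x = r y \<Longrightarrow> c x = c y \<Longrightarrow> x = y"
    and up: "y \<in> {1..n} \<Longrightarrow> i < r y \<Longrightarrow> \<exists>x\<in>{1..n}. c x = c y \<and> r x = i"
    and left: "y \<in> {1..n} \<Longrightarrow> j < c y \<Longrightarrow> \<exists>x\<in>{1..n}. r x = r y \<and> c x = j"
begin

text \<open>The total of the exponents, weighted with \<open>w\<close>.\<close>

definition Phi :: "(nat \<Rightarrow> nat) \<Rightarrow> monomial \<Rightarrow> nat" where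
  "Phi w m = (\<Sum>x\<in>{1..n}. w x * lookup m x)"

text \<open>
  The Garnir relation for the entries of a row from \<open>x\<close> on and the entries of the next row up to
  \<open>y\<close>, which is below \<open>x\<close>. These are more entries than the upper of the two rows has columns. So,
  after any permutation within the rows, two of them are in the same column, and the antisymmetry in
  that column makes the sum vanish.
\<close>

lemma garnir:
  assumes xy: "x \<in> {1..n}" "y \<in> {1..n}" "c x = c y" "r y = Suc (r x)"
    and S: "S = {z \<in> {1..n}. r z = r x \<and> c x \<le> c z} \<union> {z \<in> {1..n}. r z = r y \<and> c z \<le> c y}"
  shows "(\<Sum>g\<in>{g. g permutes S}. poly_act g (symmetrizer False n r (symmetrizer True n c F))) = 0"
proof -
  let ?I = "{1..n}"
  define v where "v = symmetrizer True n c F"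
  define Row where "Row = {z \<in> ?I. r z = r x}"
  define X where "X = {z \<in> ?I. r z = r x \<and> c x \<le> c z}"
  define X' where "X' = {z \<in> ?I. r z = r x \<and> c z < c x}"
  define Y where "Y = {z \<in> ?I. r z = r y \<and> c z \<le> c y}"
  have fin: "finite X" "finite X'" "finite Y" "finite Row" by (auto simp: X_def X'_def Y_def Row_def)
  have SXY: "S = X \<union> Y" "X \<inter> Y = {}" using xy by (auto simp: S X_def Y_def)
  have finS: "finite S" using fin SXY by simp
  have SI: "S \<subseteq> ?I" by (auto simp: S)
  have "card X' \<le> c x"
  proof -
    have "inj_on c X'" using inj by (auto simp: inj_on_def X'_def)
    moreover have "c ` X' \<subseteq> {..<c x}" by (auto simp: X'_def)
    ultimately have "card X' \<le> card {..<c x}" by (intro card_inj_on_le) auto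
    thus ?thesis by simp
  qed
  moreover have "Suc (c y) \<le> card Y"
  proof -
    have "{..c y} \<subseteq> c ` Y"
    proof
      fix j assume "j \<in> {..c y}"
      hence "j = c y \<or> j < c y" by auto
      thus "j \<in> c ` Y"
      proof
        assume "j < c y"
        then obtain z where "z \<in> ?I" "r z = r y" "c z = j" using left xy(2) by blast
        thus ?thesis using \<open>j < c y\<close> by (auto simp: Y_def)
      qed (use xy in \<open>auto simp: Y_def\<close>)
    qed
    hence "card {..c y} \<le> card (c ` Y)" using fin by (intro card_mono) auto
    also have "\<dots> \<le> card Y" by (rule card_image_le[OF fin(3)])
    finally show ?thesis by simp
  qed
  moreover have "card Row = card X + card X'"
  proof -
    have "Row = X \<union> X'" "X \<inter> X' = {}" by (auto simp: Row_def X_def X'_def)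
    thus ?thesis using fin by (simp add: card_Un_disjoint)
  qed
  ultimately have big: "card Row < card S" using SXY fin xy(3) by (simp add: card_Un_disjoint)
  have "(\<Sum>g\<in>{g. g permutes S}. poly_act g (poly_act \<tau> v)) = 0" if \<tau>: "\<tau> \<in> fibre_stab n r" for \<tau>
  proof -
    have \<tau>p: "\<tau> permutes ?I" using \<tau> by (rule fibre_stab_permutes)
    let ?S' = "inv \<tau> ` S"
    have bi: "bij (inv \<tau>)" using \<tau> by (simp add: bij_imp_bij_inv)
    have S'I: "?S' \<subseteq> ?I" using SI permutes_image[OF permutes_inv[OF \<tau>p]] by blast
    have cS': "card ?S' = card S" using bi by (simp add: card_image bij_is_inj inj_on_subset[OF _ subset_UNIV])
    have "c ` ?S' \<subseteq> c ` Row"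
    proof (rule image_subsetI)
      fix z assume z: "z \<in> ?S'"
      then obtain z' where z': "z' \<in> S" "z = inv \<tau> z'" by blast
      have zI: "z \<in> ?I" using z S'I by blast
      have "r z = r z'" using fibre_stab_inv[OF \<tau>] z' SI by (auto simp: fibre_stab_def)
      moreover have "r z' = r x \<or> r z' = Suc (r x)" using z'(1) xy(4) by (auto simp: S)
      ultimately have "r z = r x \<or> r x < r z" by auto
      thus "c z \<in> c ` Row"
      proof
        assume "r x < r z"
        then obtain w where w: "w \<in> ?I" "c w = c z" "r w = r x" using up[OF zI] by blast
        hence "w \<in> Row" by (simp add: Row_def)
        hence "c w \<in> c ` Row" by (rule imageI)
        thus ?thesis by (simp add: w(2))
      qed (use zI in \<open>auto simp: Row_def\<close>)
    qed
    hence "card (c ` ?S') \<le> card (c ` Row)" using fin by (intro card_mono) auto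
    also have "\<dots> \<le> card Row" using fin by (intro card_image_le)
    finally have "card (c ` ?S') < card ?S'" using big cS' by simp
    hence "\<not> inj_on c ?S'" by (rule pigeonhole)
    then obtain p q where pq: "p \<in> ?S'" "q \<in> ?S'" "p \<noteq> q" "c p = c q" by (auto simp: inj_on_def)
    have \<tau>pq: "\<tau> p \<in> S" "\<tau> q \<in> S" using pq permutes_inverses[OF \<tau>p] by auto
    let ?t = "swp (\<tau> p) (\<tau> q)"
    have t: "?t permutes S" using \<tau>pq by (rule permutes_swap_id)
    have "swp p q permutes ?I" using pq S'I by (intro permutes_swap_id) auto
    hence "swp p q \<in> fibre_stab n c" using pq by (auto simp: fibre_stab_def Transposition.transpose_def)
    hence "poly_act (swp p q) v = - v"
      using symmetrizer_act_left[of "swp p q" n c True F] pq(3) by (simp add: v_def sign_char_swp)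
    moreover have "?t \<circ> \<tau> = \<tau> \<circ> swp p q"
      using permutes_inj[OF \<tau>p] by (auto simp: fun_eq_iff Transposition.transpose_def inj_eq)
    ultimately have tv: "poly_act ?t (poly_act \<tau> v) = - poly_act \<tau> v"
      using \<tau> by (simp add: poly_act_comp) (simp flip: poly_act_comp poly_act_uminus)
    let ?w = "poly_act \<tau> v"
    have bij: "bij_betw (\<lambda>g. g \<circ> ?t) {g. g permutes S} {g. g permutes S}"
      by (rule bij_betwI[of _ _ _ "\<lambda>g. g \<circ> ?t"]) (use t in \<open>auto simp: permutes_compose comp_assoc\<close>)
    have "(\<Sum>g\<in>{g. g permutes S}. poly_act g ?w) = (\<Sum>g\<in>{g. g permutes S}. poly_act (g \<circ> ?t) ?w)"
      by (rule sum.reindex_bij_betw[OF bij, symmetric])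
    also have "\<dots> = (\<Sum>g\<in>{g. g permutes S}. - poly_act g ?w)"
      by (intro sum.cong refl) (simp add: permutes_bij tv poly_act_uminus flip: poly_act_comp)
    also have "\<dots> = - (\<Sum>g\<in>{g. g permutes S}. poly_act g ?w)" by (rule sum_negf)
    finally have "lookup (\<Sum>g\<in>{g. g permutes S}. poly_act g ?w) m = - lookup (\<Sum>g\<in>{g. g permutes S}. poly_act g ?w) m" for m
      by (metis lookup_uminus)
    thus ?thesis by (intro poly_mapping_eqI) (metis lookup_zero equal_neg_zero)
  qed
  hence "(\<Sum>\<tau>\<in>fibre_stab n r. \<Sum>g\<in>{g. g permutes S}. poly_act g (poly_act \<tau> v)) = 0" by (simp add: sum.neutral)
  hence "(\<Sum>g\<in>{g. g permutes S}. \<Sum>\<tau>\<in>fibre_stab n r. poly_act g (poly_act \<tau> v)) = 0" by (subst sum.swap)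
  moreover have "poly_act g (symmetrizer False n r v) = (\<Sum>\<tau>\<in>fibre_stab n r. poly_act g (poly_act \<tau> v))" if "g permutes S" for g
    using permutes_bij[OF that] by (simp add: symmetrizer_def sign_char_def poly_act_sum)
  hence "(\<Sum>g\<in>{g. g permutes S}. poly_act g (symmetrizer False n r v))
      = (\<Sum>g\<in>{g. g permutes S}. \<Sum>\<tau>\<in>fibre_stab n r. poly_act g (poly_act \<tau> v))"
    by (intro sum.cong refl) simp
  ultimately show ?thesis unfolding v_def by (rule trans[rotated])
qed

text \<open>
  A monomial of a Young symmetrized polynomial that maximizes the row-weighted, and among these the
  column-weighted, total of exponents is semi-standard.
\<close>

lemma straighten:
  assumes F: "F \<in> hom_polys {1..n} d" and nz: "symmetrizer False n r (symmetrizer True n c F) \<noteq> 0"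
  obtains m where "lookup (symmetrizer False n r (symmetrizer True n c F)) m \<noteq> 0"
    "keys m \<subseteq> {1..n}" "mon_degree m = d"
    "\<And>x y. x \<in> {1..n} \<Longrightarrow> y \<in> {1..n} \<Longrightarrow> r x = r y \<Longrightarrow> c x < c y \<Longrightarrow> lookup m x \<le> lookup m y"
    "\<And>x y. x \<in> {1..n} \<Longrightarrow> y \<in> {1..n} \<Longrightarrow> c x = c y \<Longrightarrow> r y = Suc (r x) \<Longrightarrow> lookup m x < lookup m y"
proof -
  let ?I = "{1..n}"
  define u where "u = symmetrizer False n r (symmetrizer True n c F)"
  have uh: "u \<in> hom_polys ?I d" unfolding u_def by (intro hom_polys_symmetrizer F)
  have u_inv: "lookup u (mperm \<tau> m) = lookup u m" if "\<tau> \<in> fibre_stab n r" for \<tau> m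
    unfolding u_def using that by (rule lookup_symmetrizer_invariant)
  have "u \<noteq> 0" using nz by (simp add: u_def)
  hence "\<exists>m0. lookup u m0 \<noteq> 0" using poly_mapping_eqI[of u 0] by auto
  hence "keys u \<noteq> {}" by (auto simp: in_keys_iff)
  then obtain m where m: "m \<in> keys u" and maxr: "\<And>m'. m' \<in> keys u \<Longrightarrow> Phi r m' \<le> Phi r m"
    and maxc: "\<And>m'. m' \<in> keys u \<Longrightarrow> Phi r m' = Phi r m \<Longrightarrow> Phi c m' \<le> Phi c m"
    using ex_lexi_max[of "keys u" "Phi r" "Phi c"] by (metis finite_keys)
  have um: "lookup u m \<noteq> 0" using m by (simp add: in_keys_iff)
  have rows: "lookup m x \<le> lookup m y" if xy: "x \<in> ?I" "y \<in> ?I" "r x = r y" "c x < c y" for x y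
  proof (rule ccontr)
    assume gt: "\<not> lookup m x \<le> lookup m y"
    let ?t = "swp x y"
    have tp: "?t permutes ?I" using xy by (intro permutes_swap_id)
    hence t: "?t \<in> fibre_stab n r" using xy by (auto simp: fibre_stab_def Transposition.transpose_def)
    have "mperm ?t m \<in> keys u" using um u_inv[OF t] by (simp add: in_keys_iff)
    moreover have "Phi r (mperm ?t m) = Phi r m"
    proof -
      have "Phi r (mperm ?t m) = (\<Sum>z\<in>?I. r (?t z) * lookup m (?t z))"
        unfolding Phi_def using t by (intro sum.cong refl) (auto simp: fibre_stab_def)
      also have "\<dots> = Phi r m" unfolding Phi_def using sum.permute[OF tp, of "\<lambda>z. r z * lookup m z"] by (simp add: comp_def)
      finally show ?thesis .
    qed
    ultimately have le: "Phi c (mperm ?t m) \<le> Phi c m" by (rule maxc)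
    have split: "(\<Sum>z\<in>?I. h z) = h x + h y + (\<Sum>z\<in>?I - {x, y}. h z)" for h :: "nat \<Rightarrow> nat"
    proof -
      have "(\<Sum>z\<in>?I. h z) = (\<Sum>z\<in>{x, y}. h z) + (\<Sum>z\<in>?I - {x, y}. h z)"
        using xy by (metis add.commute empty_subsetI finite_atLeastAtMost insert_subset sum.subset_diff)
      moreover have "x \<noteq> y" using xy(4) by auto
      ultimately show ?thesis by simp
    qed
    have "(\<Sum>z\<in>?I - {x, y}. c z * lookup m (?t z)) = (\<Sum>z\<in>?I - {x, y}. c z * lookup m z)"
      by (intro sum.cong refl) auto
    moreover have "Phi c (mperm ?t m) = c x * lookup m y + c y * lookup m x
        + (\<Sum>z\<in>?I - {x, y}. c z * lookup m (?t z))" unfolding Phi_def split by simp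
    moreover have "Phi c m = c x * lookup m x + c y * lookup m y + (\<Sum>z\<in>?I - {x, y}. c z * lookup m z)"
      unfolding Phi_def split by simp
    ultimately have "c x * lookup m y + c y * lookup m x \<le> c x * lookup m x + c y * lookup m y"
      using le by linarith
    moreover define k where "k = c y - c x"
    have k: "c y = c x + k" "k > 0" using xy(4) by (simp_all add: k_def)
    ultimately have "k * lookup m x \<le> k * lookup m y" unfolding k(1) by (simp add: algebra_simps)
    thus False using gt k(2) by simp
  qed
  have cols: "lookup m x < lookup m y" if xy: "x \<in> ?I" "y \<in> ?I" "c x = c y" "r y = Suc (r x)" for x y
  proof (rule ccontr)
    assume "\<not> lookup m x < lookup m y"
    hence le: "lookup m y \<le> lookup m x" by simp
    define X where "X = {z \<in> ?I. r z = r x \<and> c x \<le> c z}"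
    define Y where "Y = {z \<in> ?I. r z = r y \<and> c z \<le> c y}"
    define S where "S = X \<union> Y"
    have fin: "finite X" "finite Y" "finite S" by (auto simp: X_def Y_def S_def)
    have dj: "X \<inter> Y = {}" using xy by (auto simp: X_def Y_def)
    have SI: "S \<subseteq> ?I" by (auto simp: S_def X_def Y_def)
    have Xv: "lookup m x \<le> lookup m z" if "z \<in> X" for z
      using that rows[OF xy(1), of z] inj[OF xy(1), of z] by (cases "c z = c x") (auto simp: X_def)
    have Yv: "lookup m z \<le> lookup m y" if "z \<in> Y" for z
      using that rows[of z y] xy(2) inj[OF xy(2), of z] by (cases "c z = c y") (auto simp: Y_def)
    \<comment> \<open>A permutation of \<open>S\<close> either increases the row-weighted total, or moves between the two rows
        equal exponents only and can then be replaced by one that preserves the rows.\<close>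
    have dich: "lookup u (mperm g m) = 0 \<or> lookup u (mperm g m) = lookup u m" if g: "g permutes S" for g
    proof -
      have gI: "g permutes ?I" using g SI by (rule permutes_subset)
      have bg: "bij g" using g by (rule permutes_bij)
      define A where "A = g ` Y \<inter> X"
      define B where "B = Y - g ` Y"
      have gY: "g ` Y \<subseteq> S" using permutes_image[OF g] by (auto simp: S_def)
      have finAB: "finite A" "finite B" using fin by (auto simp: A_def B_def)
      have gYs: "g ` Y = (g ` Y \<inter> Y) \<union> A" "(g ` Y \<inter> Y) \<inter> A = {}" using gY dj by (auto simp: A_def S_def)
      have Ys: "Y = (g ` Y \<inter> Y) \<union> B" "(g ` Y \<inter> Y) \<inter> B = {}" by (auto simp: B_def)
      have "card (g ` Y) = card Y" using bg by (meson bij_is_inj card_image inj_on_subset subset_UNIV)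
      hence cAB: "card A = card B" using gYs Ys fin finAB
        by (metis (no_types, lifting) add_left_cancel card_Un_disjoint finite_Int finite_imageI)
      have PhiS: "(\<Sum>z\<in>S. r z * lookup m (h z)) = r x * (\<Sum>z\<in>S. lookup m z) + (\<Sum>z\<in>h ` Y. lookup m z)"
        if h: "h permutes S" for h
      proof -
        have "(\<Sum>z\<in>S. r z * lookup m (h z)) = (\<Sum>z\<in>X. r z * lookup m (h z)) + (\<Sum>z\<in>Y. r z * lookup m (h z))"
          unfolding S_def using fin dj by (intro sum.union_disjoint)
        also have "(\<Sum>z\<in>X. r z * lookup m (h z)) = r x * (\<Sum>z\<in>X. lookup m (h z))"
          unfolding sum_distrib_left by (intro sum.cong refl) (auto simp: X_def)
        also have "(\<Sum>z\<in>Y. r z * lookup m (h z)) = r x * (\<Sum>z\<in>Y. lookup m (h z)) + (\<Sum>z\<in>Y. lookup m (h z))"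
          unfolding sum_distrib_left sum.distrib[symmetric] by (intro sum.cong refl) (auto simp: Y_def xy(4))
        also have "r x * (\<Sum>z\<in>X. lookup m (h z)) + (r x * (\<Sum>z\<in>Y. lookup m (h z)) + (\<Sum>z\<in>Y. lookup m (h z)))
           = r x * (\<Sum>z\<in>S. lookup m (h z)) + (\<Sum>z\<in>Y. lookup m (h z))"
          unfolding S_def using fin dj by (simp add: sum.union_disjoint distrib_left)
        also have "(\<Sum>z\<in>S. lookup m (h z)) = (\<Sum>z\<in>S. lookup m z)"
          using sum.permute[OF h, of "lookup m"] by (simp add: comp_def)
        also have "(\<Sum>z\<in>Y. lookup m (h z)) = (\<Sum>z\<in>h ` Y. lookup m z)"
          using permutes_inj[OF h] by (simp add: sum.reindex inj_on_subset[OF _ subset_UNIV])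
        finally show ?thesis .
      qed
      have PhiI: "Phi r (mperm h m) = (\<Sum>z\<in>S. r z * lookup m (h z)) + (\<Sum>z\<in>?I - S. r z * lookup m z)"
        if h: "h permutes S" for h
      proof -
        have "Phi r (mperm h m) = (\<Sum>z\<in>?I. r z * lookup m (h z))"
          using permutes_bij[OF h] by (simp add: Phi_def)
        also have "\<dots> = (\<Sum>z\<in>?I - S. r z * lookup m (h z)) + (\<Sum>z\<in>S. r z * lookup m (h z))"
          using SI by (intro sum.subset_diff) auto
        also have "(\<Sum>z\<in>?I - S. r z * lookup m (h z)) = (\<Sum>z\<in>?I - S. r z * lookup m z)"
          using permutes_not_in[OF h] by (intro sum.cong refl) auto
        finally show ?thesis by simp
      qed
      have id: "id permutes S" by (rule permutes_id)
      have sumA: "(\<Sum>z\<in>g ` Y. lookup m z) = (\<Sum>z\<in>g ` Y \<inter> Y. lookup m z) + (\<Sum>z\<in>A. lookup m z)"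
        by (subst gYs(1), rule sum.union_disjoint) (use gYs fin finAB in auto)
      have sumB: "(\<Sum>z\<in>Y. lookup m z) = (\<Sum>z\<in>g ` Y \<inter> Y. lookup m z) + (\<Sum>z\<in>B. lookup m z)"
        by (subst Ys(1), rule sum.union_disjoint) (use Ys fin finAB in auto)
      have A_ge: "card A * lookup m x \<le> (\<Sum>z\<in>A. lookup m z)"
        using sum_bounded_below[of A "lookup m x" "lookup m"] Xv by (simp add: A_def)
      have B_le: "(\<Sum>z\<in>B. lookup m z) \<le> card B * lookup m y"
        using sum_bounded_above[of B "lookup m" "lookup m y"] Yv by (simp add: B_def)
      have mid: "card B * lookup m y \<le> card A * lookup m x" using le cAB by simp
      show ?thesis
      proof (cases "mperm g m \<in> keys u")
        case False thus ?thesis by (simp add: in_keys_iff)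
      next
        case True
        have "Phi r (mperm g m) \<le> Phi r (mperm id m)" using maxr[OF True] by simp
        hence "(\<Sum>z\<in>A. lookup m z) \<le> (\<Sum>z\<in>B. lookup m z)"
          unfolding PhiI[OF g] PhiI[OF id] PhiS[OF g] PhiS[OF id] using sumA sumB by simp
        hence eqA: "(\<Sum>z\<in>A. lookup m z) = card A * lookup m x" and eqB: "(\<Sum>z\<in>B. lookup m z) = card B * lookup m y"
          and eqm: "card A * lookup m x = card B * lookup m y"
          using A_ge B_le mid by linarith+
        have Aeq: "lookup m z = lookup m x" if "z \<in> A" for z
        proof (rule ccontr)
          assume "lookup m z \<noteq> lookup m x"
          hence "lookup m x < lookup m z" using Xv[of z] that by (auto simp: A_def)
          hence "(\<Sum>z\<in>A. lookup m x) < (\<Sum>z\<in>A. lookup m z)"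
            using finAB Xv that by (intro sum_strict_mono_ex1) (auto simp: A_def)
          thus False using eqA by simp
        qed
        have Beq: "lookup m z = lookup m y" if "z \<in> B" for z
        proof (rule ccontr)
          assume "lookup m z \<noteq> lookup m y"
          hence "lookup m z < lookup m y" using Yv[of z] that by (auto simp: B_def)
          hence "(\<Sum>z\<in>B. lookup m z) < (\<Sum>z\<in>B. lookup m y)"
            using finAB Yv that by (intro sum_strict_mono_ex1) (auto simp: B_def)
          thus False using eqB by simp
        qed
        \<comment> \<open>\<open>h\<close> exchanges the two sets of equal exponents, so \<open>h \<circ> g\<close> preserves the rows.\<close>
        obtain h where h: "h permutes (A \<union> B)" "h ` A = B"
          using ex_permutes_image[of "A \<union> B" A B] finAB cAB by auto
        have const: "lookup m z = lookup m x" if "z \<in> A \<union> B" for z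
        proof (cases "card A = 0")
          case True thus ?thesis using that finAB cAB by auto
        next
          case False
          thus ?thesis using that Aeq Beq eqm cAB by auto
        qed
        have mh: "lookup m (h z) = lookup m z" for z
        proof (cases "z \<in> A \<union> B")
          case True
          hence "h z \<in> A \<union> B" using permutes_in_image[OF h(1)] by blast
          thus ?thesis using const True by metis
        qed (simp add: permutes_not_in[OF h(1)])
        have hS: "h permutes S" by (rule permutes_subset[OF h(1)]) (auto simp: A_def B_def S_def)
        define \<tau> where "\<tau> = h \<circ> g"
        have \<tau>S: "\<tau> permutes S" unfolding \<tau>_def using g hS by (rule permutes_compose)
        have "h z = z" if "z \<in> g ` Y \<inter> Y" for z
          using that gYs(2) Ys(2) by (intro permutes_not_in[OF h(1)]) blast
        hence "h ` (g ` Y \<inter> Y) = g ` Y \<inter> Y" by force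
        hence "\<tau> ` Y = Y" unfolding \<tau>_def image_comp[symmetric]
          using gYs(1) Ys(1) h(2) by (metis image_Un)
        hence \<tau>Y: "\<tau> z \<in> Y \<longleftrightarrow> z \<in> Y" for z
          using permutes_inj[OF \<tau>S] by (metis image_iff injD)
        have "r (\<tau> z) = r z" if "z \<in> ?I" for z
        proof (cases "z \<in> S")
          case True
          hence "\<tau> z \<in> S" using permutes_in_image[OF \<tau>S] by blast
          thus ?thesis using True \<tau>Y[of z] by (auto simp: S_def X_def Y_def)
        qed (simp add: permutes_not_in[OF \<tau>S])
        hence "\<tau> \<in> fibre_stab n r" using permutes_subset[OF \<tau>S SI] by (simp add: fibre_stab_def)
        moreover have "mperm g m = mperm \<tau> m"
          using bg permutes_bij[OF \<tau>S] by (intro poly_mapping_eqI) (simp add: \<tau>_def mh)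
        ultimately show ?thesis using u_inv by simp
      qed
    qed
    have "(\<Sum>g\<in>{g. g permutes S}. poly_act g u) = 0"
      unfolding u_def by (rule garnir[OF xy]) (simp add: S_def X_def Y_def)
    hence "(\<Sum>g\<in>{g. g permutes S}. lookup (poly_act g u) m) = 0"
      unfolding lookup_sum[symmetric] by simp
    moreover have "(\<Sum>g\<in>{g. g permutes S}. lookup u (mperm g m)) = (\<Sum>g\<in>{g. g permutes S}. lookup (poly_act g u) m)"
      by (intro sum.cong refl) (simp add: permutes_bij)
    ultimately have zero: "(\<Sum>g\<in>{g. g permutes S}. lookup u (mperm g m)) = 0" by (rule trans[rotated])
    define P where "P = {g. g permutes S}"
    have finP: "finite P" unfolding P_def using fin(3) by (rule finite_permutations)
    have idP: "id \<in> P" by (simp add: P_def permutes_id)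
    have "(\<Sum>g\<in>P. lookup u (mperm g m)) = (\<Sum>g\<in>P. if lookup u (mperm g m) = 0 then 0 else lookup u m)"
      using dich by (intro sum.cong refl) (auto simp: P_def)
    also have "\<dots> = (\<Sum>g\<in>P. (if lookup u (mperm g m) = 0 then 0 else 1)) * lookup u m"
      unfolding sum_distrib_right by (intro sum.cong refl) simp
    finally have "(\<Sum>g\<in>P. (if lookup u (mperm g m) = 0 then 0 else 1 :: rat)) = 0"
      using zero um by (simp add: P_def)
    hence "\<forall>g\<in>P. (if lookup u (mperm g m) = 0 then 0 else 1 :: rat) = 0"
      using finP by (subst (asm) sum_nonneg_eq_0_iff) auto
    thus False using idP um by auto
  qed
  show ?thesis
  proof (rule that[of m])
    show "lookup (symmetrizer False n r (symmetrizer True n c F)) m \<noteq> 0" using um by (simp add: u_def)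
    show "keys m \<subseteq> ?I" "mon_degree m = d" using uh m by (auto simp: hom_polys_def)
  qed (fact rows cols)+
qed

end

section \<open>The polynomials of semi-standard tableaux\<close>

lemma boxes_shape: "boxes M = {(i, j). i < length (shape M) \<and> j < shape M ! i}"
  by (auto simp: boxes_def shape_def)

lemma distinct_concat_nth:
  assumes "distinct (concat T)" "(i, j) \<in> boxes T" "(i', j') \<in> boxes T" "T ! i ! j = T ! i' ! j'"
  shows "i = i' \<and> j = j'"
  using assms
proof (induction T arbitrary: i i')
  case (Cons row T)
  have mem: "T ! k ! j \<in> set (concat T)" if "(k, j) \<in> boxes T" for k j
    using that by (auto simp: boxes_def intro!: bexI[of _ "T ! k"])
  have dj: "distinct row" "distinct (concat T)" "set row \<inter> set (concat T) = {}" using Cons.prems by auto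
  show ?case
  proof (cases i; cases i')
    assume "i = 0" "i' = 0"
    thus ?thesis using Cons.prems dj(1) by (auto simp: boxes_def nth_eq_iff_index_eq)
  next
    fix k assume k: "i = 0" "i' = Suc k"
    hence "T ! k ! j' \<in> set (concat T)" "T ! k ! j' \<in> set row"
      using Cons.prems mem[of k j'] by (auto simp: boxes_def) (metis nth_mem)
    thus ?thesis using dj(3) by blast
  next
    fix k assume k: "i = Suc k" "i' = 0"
    hence "T ! k ! j \<in> set (concat T)" "T ! k ! j \<in> set row"
      using Cons.prems mem[of k j] by (auto simp: boxes_def)
    thus ?thesis using dj(3) by blast
  next
    fix k k' assume k: "i = Suc k" "i' = Suc k'"
    thus ?thesis using Cons.IH[OF dj(2), of k k'] Cons.prems by (auto simp: boxes_def)
  qed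
qed (simp add: boxes_def)

lemma permutes_stabilizes_iff:
  fixes r :: "nat \<Rightarrow> nat"
  assumes "\<sigma> permutes I"
  shows "(\<forall>i. \<sigma> ` {x \<in> I. r x = i} = {x \<in> I. r x = i}) \<longleftrightarrow> (\<forall>x\<in>I. r (\<sigma> x) = r x)"
proof
  assume h: "\<forall>i. \<sigma> ` {x \<in> I. r x = i} = {x \<in> I. r x = i}"
  show "\<forall>x\<in>I. r (\<sigma> x) = r x"
  proof
    fix x assume "x \<in> I"
    hence "\<sigma> x \<in> \<sigma> ` {y \<in> I. r y = r x}" by simp
    thus "r (\<sigma> x) = r x" using h by auto
  qed
next
  assume h: "\<forall>x\<in>I. r (\<sigma> x) = r x"
  show "\<forall>i. \<sigma> ` {x \<in> I. r x = i} = {x \<in> I. r x = i}"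
  proof (intro allI equalityI subsetI)
    fix i y assume "y \<in> \<sigma> ` {x \<in> I. r x = i}"
    thus "y \<in> {x \<in> I. r x = i}" using h permutes_in_image[OF assms] by auto
  next
    fix i y assume y: "y \<in> {x \<in> I. r x = i}"
    have "inv \<sigma> y \<in> I" using y permutes_in_image[OF permutes_inv[OF assms]] by simp
    moreover from this have "r (inv \<sigma> y) = r y" using h permutes_inverses[OF assms] by metis
    ultimately have "inv \<sigma> y \<in> {x \<in> I. r x = i}" using y by simp
    hence "\<sigma> (inv \<sigma> y) \<in> \<sigma> ` {x \<in> I. r x = i}" by (rule imageI)
    thus "y \<in> \<sigma> ` {x \<in> I. r x = i}" using permutes_inverses[OF assms] by simp
  qed
qed

text \<open>
  A bijective filling \<open>T\<close> together with the functions \<open>r\<close> and \<open>c\<close> that give the row and the column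
  of an entry.
\<close>

locale filling =
  fixes T :: tableau and n :: nat and r c :: "nat \<Rightarrow> nat"
  assumes size: "sum_list (shape T) = n"
    and coord: "x \<in> {1..n} \<Longrightarrow> (r x, c x) \<in> boxes T \<and> T ! r x ! c x = x"
    and entry: "(i, j) \<in> boxes T \<Longrightarrow> T ! i ! j \<in> {1..n} \<and> r (T ! i ! j) = i \<and> c (T ! i ! j) = j"

lemma fillings_coords:
  assumes T: "T \<in> fillings l"
  obtains r c where "filling T (sum_list l) r c"
proof -
  let ?I = "{1..sum_list l}"
  have T': "shape T = l" "distinct (concat T)" "set (concat T) = ?I" using T by (auto simp: fillings_def)
  have mem: "T ! i ! j \<in> ?I" if "(i, j) \<in> boxes T" for i j
  proof -
    have "T ! i \<in> set T" "T ! i ! j \<in> set (T ! i)" using that by (auto simp: boxes_def)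
    hence "T ! i ! j \<in> set (concat T)" by auto
    thus ?thesis unfolding T'(3) .
  qed
  have "\<exists>p. p \<in> boxes T \<and> T ! fst p ! snd p = x" if x: "x \<in> ?I" for x
  proof -
    from x T'(3) have "x \<in> set (concat T)" by blast
    then obtain row where "row \<in> set T" "x \<in> set row" by auto
    then obtain i j where "i < length T" "j < length (T ! i)" "T ! i ! j = x" by (auto simp: in_set_conv_nth)
    thus ?thesis by (intro exI[of _ "(i, j)"]) (simp add: boxes_def)
  qed
  then obtain p where p: "p x \<in> boxes T" "T ! fst (p x) ! snd (p x) = x" if "x \<in> ?I" for x by metis
  have "filling T (sum_list l) (fst \<circ> p) (snd \<circ> p)"
  proof
    show "sum_list (shape T) = sum_list l" by (simp add: T'(1))
    show "((fst \<circ> p) x, (snd \<circ> p) x) \<in> boxes T \<and> T ! (fst \<circ> p) x ! (snd \<circ> p) x = x" if "x \<in> ?I" for x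
      using p[OF that] by simp
    show "T ! i ! j \<in> ?I \<and> (fst \<circ> p) (T ! i ! j) = i \<and> (snd \<circ> p) (T ! i ! j) = j" if ij: "(i, j) \<in> boxes T" for i j
    proof -
      have m: "T ! i ! j \<in> ?I" using mem[OF ij] .
      have "(fst (p (T ! i ! j)), snd (p (T ! i ! j))) \<in> boxes T" using p(1)[OF m] by simp
      from distinct_concat_nth[OF T'(2) this ij p(2)[OF m]] show ?thesis using m by simp
    qed
  qed
  thus ?thesis by (rule that)
qed

context filling
begin

abbreviation "I \<equiv> {1..n}"

lemma row_stab_eq: "row_stab T = fibre_stab n r"
proof -
  have row: "set (T ! i) = {x \<in> I. r x = i}" if "i < length T" for i
  proof (intro equalityI subsetI)
    fix x assume "x \<in> set (T ! i)"
    then obtain j where "j < length (T ! i)" "x = T ! i ! j" by (auto simp: in_set_conv_nth)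
    thus "x \<in> {x \<in> I. r x = i}" using entry[of i j] that by (simp add: boxes_def)
  next
    fix x assume "x \<in> {x \<in> I. r x = i}"
    hence x: "x \<in> I" "r x = i" by auto
    hence "c x < length (T ! i)" "T ! i ! c x = x" using coord[OF x(1)] by (auto simp: boxes_def)
    thus "x \<in> set (T ! i)" by (metis nth_mem)
  qed
  have empty: "{x \<in> I. r x = i} = {}" if "\<not> i < length T" for i
    using that coord unfolding boxes_def by blast
  have rows: "(\<forall>row\<in>set T. \<sigma> ` set row = set row) \<longleftrightarrow> (\<forall>i. \<sigma> ` {x \<in> I. r x = i} = {x \<in> I. r x = i})" for \<sigma>
  proof -
    have "(\<forall>row\<in>set T. \<sigma> ` set row = set row) \<longleftrightarrow> (\<forall>i<length T. \<sigma> ` set (T ! i) = set (T ! i))"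
      by (metis in_set_conv_nth)
    also have "\<dots> \<longleftrightarrow> (\<forall>i<length T. \<sigma> ` {x \<in> I. r x = i} = {x \<in> I. r x = i})" by (simp only: row cong: imp_cong)
    also have "\<dots> \<longleftrightarrow> (\<forall>i. \<sigma> ` {x \<in> I. r x = i} = {x \<in> I. r x = i})"
    proof
      assume h: "\<forall>i<length T. \<sigma> ` {x \<in> I. r x = i} = {x \<in> I. r x = i}"
      show "\<forall>i. \<sigma> ` {x \<in> I. r x = i} = {x \<in> I. r x = i}"
      proof
        fix i show "\<sigma> ` {x \<in> I. r x = i} = {x \<in> I. r x = i}"
        proof (cases "i < length T")
          case False
          show ?thesis unfolding empty[OF False] by (rule image_empty)
        qed (use h in blast)
      qed
    qed simp
    finally show ?thesis .
  qed
  show ?thesis unfolding row_stab_def fibre_stab_def size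
  proof (rule Collect_cong, rule conj_cong[OF refl])
    fix \<sigma> assume "\<sigma> permutes I"
    thus "(\<forall>row\<in>set T. \<sigma> ` set row = set row) \<longleftrightarrow> (\<forall>x\<in>I. r (\<sigma> x) = r x)"
      unfolding rows by (rule permutes_stabilizes_iff)
  qed
qed

lemma col_stab_eq: "col_stab T = fibre_stab n c"
proof -
  have col: "column T j = {x \<in> I. c x = j}" for j
  proof (intro equalityI subsetI)
    fix x assume "x \<in> column T j"
    then obtain i where "(i, j) \<in> boxes T" "x = T ! i ! j" by (auto simp: column_def)
    thus "x \<in> {x \<in> I. c x = j}" using entry[of i j] by simp
  next
    fix x assume "x \<in> {x \<in> I. c x = j}"
    hence x: "x \<in> I" "c x = j" by auto
    hence "(r x, j) \<in> boxes T" "x = T ! r x ! j" using coord[OF x(1)] by auto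
    thus "x \<in> column T j" unfolding column_def by blast
  qed
  show ?thesis unfolding col_stab_def fibre_stab_def size
  proof (rule Collect_cong, rule conj_cong[OF refl])
    fix \<sigma> assume "\<sigma> permutes I"
    thus "(\<forall>j. \<sigma> ` column T j = column T j) \<longleftrightarrow> (\<forall>x\<in>I. c (\<sigma> x) = c x)"
      unfolding col by (rule permutes_stabilizes_iff)
  qed
qed

lemma coords_bij: "bij_betw (\<lambda>x. (r x, c x)) I (boxes T)"
  by (rule bij_betwI[of _ _ _ "\<lambda>(i, j). T ! i ! j"]) (use coord entry in auto)

text \<open>The monomial of \<open>p_mon M T\<close>.\<close>

definition mon :: "tableau \<Rightarrow> monomial" where
  "mon M = (\<Sum>x\<in>I. Poly_Mapping.single x (M ! r x ! c x))"

lemma lookup_mon: "lookup (mon M) x = (if x \<in> I then M ! r x ! c x else 0)"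
  by (auto simp: mon_def lookup_sum lookup_single when_def sum.delta')

lemma p_mon_eq: "p_mon M T = Poly_Mapping.single (mon M) 1"
proof -
  have "p_mon M T = (\<Prod>x\<in>I. var (T ! r x ! c x) ^ (M ! r x ! c x))"
    unfolding p_mon_def by (subst prod.reindex_bij_betw[OF coords_bij, symmetric]) simp
  also have "\<dots> = (\<Prod>x\<in>I. Poly_Mapping.single (Poly_Mapping.single x (M ! r x ! c x)) 1)"
    by (intro prod.cong refl) (use coord in \<open>simp add: var_power\<close>)
  finally show ?thesis by (simp add: prod_single_monomials mon_def)
qed

text \<open>The orbit of this monomial under the row stabilizer, and the sum of its elements.\<close>

definition orbit :: "tableau \<Rightarrow> monomial set" where
  "orbit M = (\<lambda>\<tau>. mperm \<tau> (mon M)) ` fibre_stab n r"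

definition orbit_sum :: "tableau \<Rightarrow> qpoly" where
  "orbit_sum M = (\<Sum>m\<in>orbit M. Poly_Mapping.single m 1)"

lemma finite_orbit [simp]: "finite (orbit M)" by (simp add: orbit_def)

lemma lookup_orbit_sum: "lookup (orbit_sum M) m = (if m \<in> orbit M then 1 else 0)"
  by (simp add: orbit_sum_def lookup_sum lookup_single when_def)

lemma F_poly_eq: "F_poly M T = symmetrizer True n c (orbit_sum M)"
proof -
  have "(\<lambda>\<tau>. poly_act \<tau> (p_mon M T)) ` row_stab T = (\<lambda>m. Poly_Mapping.single m 1) ` orbit M"
  proof (intro equalityI subsetI)
    fix p assume "p \<in> (\<lambda>\<tau>. poly_act \<tau> (p_mon M T)) ` row_stab T"
    then obtain \<tau> where t: "\<tau> \<in> fibre_stab n r" "p = Poly_Mapping.single (mperm (inv \<tau>) (mon M)) 1"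
      by (auto simp: row_stab_eq p_mon_eq poly_act_single)
    thus "p \<in> (\<lambda>m. Poly_Mapping.single m 1) ` orbit M" using fibre_stab_inv[OF t(1)] by (auto simp: orbit_def)
  next
    fix p :: qpoly assume "p \<in> (\<lambda>m. Poly_Mapping.single m 1) ` orbit M"
    then obtain \<tau> where t: "\<tau> \<in> fibre_stab n r" "p = Poly_Mapping.single (mperm \<tau> (mon M)) 1" by (auto simp: orbit_def)
    have "p = poly_act (inv \<tau>) (p_mon M T)"
      using t by (simp add: p_mon_eq poly_act_single bij_imp_bij_inv inv_inv_eq)
    thus "p \<in> (\<lambda>\<tau>. poly_act \<tau> (p_mon M T)) ` row_stab T" using fibre_stab_inv[OF t(1)] by (simp add: row_stab_eq)
  qed
  moreover have "inj_on (\<lambda>m. Poly_Mapping.single m (1::rat)) (orbit M)"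
    by (rule inj_onI) (metis keys_single singleton_inject zero_neq_one)
  ultimately have "(\<Sum>p\<in>(\<lambda>\<tau>. poly_act \<tau> (p_mon M T)) ` row_stab T. p) = orbit_sum M"
    by (simp add: sum.reindex orbit_sum_def)
  thus ?thesis unfolding F_poly_def col_stab_eq symmetrizer_def sign_char_def by simp
qed

lemma ip_orbit_sum: "ip F (orbit_sum M) = (\<Sum>m\<in>orbit M. lookup F m)"
  by (simp add: orbit_sum_def ip_sum_right ip_single)

lemma orbit_sum_coefficient:
  "of_nat (card (orbit M)) * lookup (symmetrizer False n r (symmetrizer True n c F)) (mon M)
    = of_nat (card (fibre_stab n r)) * ip F (F_poly M T)"
proof -
  let ?v = "symmetrizer True n c F"
  have "of_nat (card (orbit M)) * lookup (symmetrizer False n r ?v) (mon M)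
      = (\<Sum>m\<in>orbit M. lookup (symmetrizer False n r ?v) (mon M))" by simp
  also have "\<dots> = (\<Sum>m\<in>orbit M. lookup (symmetrizer False n r ?v) m)"
    by (intro sum.cong refl) (auto simp: orbit_def lookup_symmetrizer_invariant)
  also have "\<dots> = ip ?v (symmetrizer False n r (orbit_sum M))" by (simp add: ip_sym flip: ip_orbit_sum)
  also have "symmetrizer False n r (orbit_sum M) = qscale (of_nat (card (fibre_stab n r))) (orbit_sum M)"
  proof -
    have "poly_act \<tau> (orbit_sum M) = orbit_sum M" if t: "\<tau> \<in> fibre_stab n r" for \<tau>
    proof (rule poly_mapping_eqI)
      fix m
      have "mperm \<tau> m \<in> orbit M \<longleftrightarrow> m \<in> orbit M"
      proof
        assume "m \<in> orbit M"
        thus "mperm \<tau> m \<in> orbit M" using t by (auto simp: orbit_def mperm_mperm intro: fibre_stab_comp)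
      next
        assume "mperm \<tau> m \<in> orbit M"
        then obtain \<sigma> where s: "\<sigma> \<in> fibre_stab n r" "mperm \<tau> m = mperm \<sigma> (mon M)" by (auto simp: orbit_def)
        hence "m = mperm (inv \<tau>) (mperm \<sigma> (mon M))" using t by (metis fibre_stab_bij mperm_inv(1))
        also have "\<dots> = mperm (\<sigma> \<circ> inv \<tau>) (mon M)" using s t by (simp add: mperm_mperm bij_imp_bij_inv)
        finally show "m \<in> orbit M" using s t by (auto simp: orbit_def intro: fibre_stab_comp fibre_stab_inv)
      qed
      thus "lookup (poly_act \<tau> (orbit_sum M)) m = lookup (orbit_sum M) m"
        using t by (simp add: lookup_orbit_sum)
    qed
    thus ?thesis by (simp only: symmetrizer_def sign_char_def if_False qpoly.scale_one sum_const_qpoly cong: sum.cong)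
  qed
  also have "ip ?v (qscale (of_nat (card (fibre_stab n r))) (orbit_sum M)) = of_nat (card (fibre_stab n r)) * ip F (F_poly M T)"
    by (simp add: ip_qscale_right F_poly_eq ip_sym)
  finally show ?thesis .
qed

end

text \<open>A bijective filling of the shape of a semi-standard tableau \<open>M\<close>.\<close>

locale filled_ssyt = filling +
  fixes M :: tableau and d :: nat
  assumes part: "is_partition (shape T) n" and M: "M \<in> SSYT d (shape T)" and n: "n \<ge> 1"
begin

abbreviation "m0 \<equiv> mon M"
abbreviation "f \<equiv> first_row_count M"

lemma shape_M: "shape M = shape T" using M by (simp add: SSYT_def)
lemma boxes_M: "boxes M = boxes T" by (simp add: boxes_shape shape_M)

lemma boxes_up: "(i, j) \<in> boxes T \<Longrightarrow> i' \<le> i \<Longrightarrow> (i', j) \<in> boxes T"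
proof -
  assume a: "(i, j) \<in> boxes T" "i' \<le> i"
  hence i: "i < length (shape T)" "j < shape T ! i" by (auto simp: boxes_shape)
  have "shape T ! i \<le> shape T ! i'"
    using part a(2) i(1) sorted_wrt_nth_less[of "(\<ge>)" "shape T" i' i]
    by (cases "i' = i") (auto simp: is_partition_def)
  thus ?thesis using i a(2) by (auto simp: boxes_shape)
qed

lemma T_nonempty: "T \<noteq> []" using size n by (auto simp: shape_def)

text \<open>
  The entries of \<open>T\<close> below the first row, and those in the first row. At the former the entries of
  \<open>M\<close> are positive.
\<close>

definition Low where "Low = {x \<in> I. r x > 0}"
definition Row0 where "Row0 = {x \<in> I. r x = 0}"

lemma I_split: "I = Low \<union> Row0" "Low \<inter> Row0 = {}" "finite Low" "finite Row0"
  by (auto simp: Low_def Row0_def)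

lemma inj_c_Row0: "inj_on c Row0"
  using coord by (intro inj_onI) (simp add: Row0_def, metis)

lemma c_Row0: "c ` Row0 = {..<length (hd M)}"
proof -
  have len: "length (hd M) = length (T ! 0)" "hd M = M ! 0"
    using shape_M T_nonempty by (cases M; cases T; auto simp: shape_def)+
  show ?thesis
  proof (intro equalityI subsetI)
    fix j assume "j \<in> c ` Row0"
    then obtain x where "x \<in> I" "r x = 0" "j = c x" by (auto simp: Row0_def)
    thus "j \<in> {..<length (hd M)}" using coord[of x] len by (auto simp: boxes_def)
  next
    fix j assume "j \<in> {..<length (hd M)}"
    hence "(0, j) \<in> boxes T" using T_nonempty len by (simp add: boxes_def)
    hence "T ! 0 ! j \<in> Row0" "c (T ! 0 ! j) = j" using entry[of 0 j] by (auto simp: Row0_def)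
    thus "j \<in> c ` Row0" by (metis imageI)
  qed
qed

lemma Low_positive: assumes "x \<in> Low" shows "lookup m0 x > 0"
proof -
  have x: "x \<in> I" "r x > 0" using assms by (auto simp: Low_def)
  then obtain i where i: "r x = Suc i" by (cases "r x") auto
  have b: "(Suc i, c x) \<in> boxes T" using coord[OF x(1)] i by simp
  moreover have "(i, c x) \<in> boxes T" using boxes_up[OF b] by simp
  ultimately have "M ! i ! c x < M ! Suc i ! c x" using M by (simp add: SSYT_def boxes_M)
  thus ?thesis using x i by (simp add: lookup_mon)
qed

lemma card_keys_m0: "card (keys m0) = card Low + f"
proof -
  have hd: "hd M = M ! 0" using shape_M T_nonempty by (cases M; cases T; auto simp: shape_def)
  let ?K = "{x \<in> Row0. lookup m0 x \<noteq> 0}"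
  have "keys m0 \<subseteq> I" by (auto simp: in_keys_iff lookup_mon split: if_splits)
  moreover have "Low \<subseteq> keys m0" using Low_positive by (auto simp: in_keys_iff)
  ultimately have "keys m0 = Low \<union> ?K" using I_split(1) by (auto simp: in_keys_iff)
  hence "card (keys m0) = card Low + card ?K"
    using I_split by (simp add: card_Un_disjoint disjoint_iff)
  also have "card ?K = card (c ` ?K)"
    by (rule card_image[symmetric], rule inj_on_subset[OF inj_c_Row0]) auto
  also have "c ` ?K = {j. j < length (hd M) \<and> hd M ! j \<noteq> 0}"
  proof (intro equalityI subsetI)
    fix j assume "j \<in> c ` ?K"
    then obtain x where x: "x \<in> Row0" "lookup m0 x \<noteq> 0" "j = c x" by auto
    hence "j < length (hd M)" using c_Row0 by blast
    moreover have "hd M ! j \<noteq> 0" using x by (simp add: lookup_mon hd Row0_def split: if_splits)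
    ultimately show "j \<in> {j. j < length (hd M) \<and> hd M ! j \<noteq> 0}" by simp
  next
    fix j assume j: "j \<in> {j. j < length (hd M) \<and> hd M ! j \<noteq> 0}"
    hence "j \<in> c ` Row0" using c_Row0 by blast
    then obtain x where "x \<in> Row0" "j = c x" by blast
    moreover from this have "lookup m0 x \<noteq> 0" using j by (simp add: lookup_mon hd Row0_def)
    ultimately show "j \<in> c ` ?K" by blast
  qed
  also have "card \<dots> = f" by (simp add: first_row_count_def length_filter_conv_card)
  finally show ?thesis .
qed

lemma orbit_facts:
  assumes "m \<in> orbit M"
  shows "keys m \<subseteq> I" "mon_content m = mon_content m0" "mon_degree m = mon_degree m0" "Low \<subseteq> keys m"
proof -
  obtain \<tau> where t: "\<tau> \<in> fibre_stab n r" "m = mperm \<tau> m0" using assms by (auto simp: orbit_def)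
  have p: "\<tau> permutes I" using t(1) by (rule fibre_stab_permutes)
  show "mon_content m = mon_content m0" "mon_degree m = mon_degree m0" using t by simp_all
  show "keys m \<subseteq> I"
  proof
    fix x assume "x \<in> keys m"
    hence "lookup m0 (\<tau> x) \<noteq> 0" using t by (simp add: in_keys_iff)
    hence "\<tau> x \<in> I" by (simp add: lookup_mon split: if_splits)
    thus "x \<in> I" using permutes_in_image[OF p] by blast
  qed
  show "Low \<subseteq> keys m"
  proof
    fix x assume x: "x \<in> Low"
    hence "\<tau> x \<in> I" using permutes_in_image[OF p, of x] by (simp add: Low_def)
    hence "\<tau> x \<in> Low" using x t(1) by (simp add: Low_def fibre_stab_def)
    hence "lookup m x > 0" using Low_positive t by simp
    thus "x \<in> keys m" by (simp add: in_keys_iff)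
  qed
qed

lemma mon_degree_m0: "mon_degree m0 = d"
proof -
  have "mon_degree m0 = (\<Sum>x\<in>I. lookup m0 x)" unfolding mon_degree_def
    by (rule sum.mono_neutral_left) (auto simp: in_keys_iff lookup_mon split: if_splits)
  also have "\<dots> = (\<Sum>x\<in>I. M ! r x ! c x)" by (simp add: lookup_mon)
  also have "\<dots> = (\<Sum>(i, j)\<in>boxes M. M ! i ! j)"
    unfolding boxes_M by (subst sum.reindex_bij_betw[OF coords_bij, symmetric]) simp
  also have "\<dots> = sum_list (concat M)"
  proof -
    have "boxes M = (SIGMA i:{..<length M}. {..<length (M ! i)})" by (auto simp: boxes_def)
    hence "(\<Sum>(i, j)\<in>boxes M. M ! i ! j) = (\<Sum>i<length M. \<Sum>j<length (M ! i). M ! i ! j)"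
      by (simp add: sum.Sigma)
    also have "\<dots> = (\<Sum>i<length M. sum_list (M ! i))"
      by (intro sum.cong refl) (simp add: sum_list_sum_nth atLeast0LessThan)
    also have "\<dots> = sum_list (map sum_list M)" by (simp add: sum_list_sum_nth[of "map sum_list M"] atLeast0LessThan)
    also have "sum_list (map sum_list M') = sum_list (concat M')" for M' :: "nat list list"
      by (induction M') auto
    finally show ?thesis .
  qed
  also have "\<dots> = d" using M by (simp add: SSYT_def)
  finally show ?thesis .
qed

lemma orbit_sum_hom: "orbit_sum M \<in> hom_polys I d"
  unfolding hom_polys_def
proof (intro CollectI ballI conjI)
  fix m assume "m \<in> keys (orbit_sum M)"
  hence m: "m \<in> orbit M" by (simp add: in_keys_iff lookup_orbit_sum split: if_splits)
  show "keys m \<subseteq> I" "mon_degree m = d" using orbit_facts(1,3)[OF m] mon_degree_m0 by simp_all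
qed

lemma F_poly_hom: "F_poly M T \<in> hom_polys I d"
  unfolding F_poly_eq by (rule hom_polys_symmetrizer[OF orbit_sum_hom])

text \<open>
  If \<open>q\<close> has fewer variables than \<open>T\<close> has entries below the first row, then there are more indices
  outside \<open>q\<close> than columns, so that two of them are in the same column.
\<close>

lemma F_poly_contr_filt: "F_poly M T \<in> contr_filt (int f)"
  unfolding contr_filt_def
proof (intro CollectI allI impI)
  fix \<mu> :: "nat multiset" and q :: monomial
  assume q: "int (card (keys q)) < int (size \<mu>) - int f"
  show "contr_coeff \<mu> q (F_poly M T) = 0"
  proof (cases "\<mu> = mon_content m0")
    case False
    show ?thesis
    proof (rule ccontr)
      assume "contr_coeff \<mu> q (F_poly M T) \<noteq> 0"
      then obtain m where m: "m \<in> keys (F_poly M T)" "mon_content m = \<mu>" by (rule contr_coeff_nonzero)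
      from m(1)[unfolded F_poly_eq] obtain \<sigma> where s: "\<sigma> \<in> fibre_stab n c" "mperm \<sigma> m \<in> keys (orbit_sum M)"
        by (rule keys_symmetrizer)
      hence "mperm \<sigma> m \<in> orbit M" by (simp add: in_keys_iff lookup_orbit_sum split: if_splits)
      hence "mon_content (mperm \<sigma> m) = mon_content m0" by (rule orbit_facts)
      thus False using s m False by simp
    qed
  next
    case True
    hence "card (keys q) < card Low" using q by (simp add: card_keys_m0)
    moreover have "card I = card Low + card Row0"
      using I_split by (metis card_Un_disjoint)
    ultimately have "card Row0 < card I - card (keys q)" by linarith
    also have "\<dots> \<le> card (I - keys q)" by (rule diff_card_le_card_Diff) simp
    finally have big: "card Row0 < card (I - keys q)" .
    have "c ` (I - keys q) \<subseteq> c ` Row0"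
    proof (rule image_subsetI)
      fix x assume "x \<in> I - keys q"
      hence "(0, c x) \<in> boxes T" using coord[of x] boxes_up[of "r x" "c x" 0] by auto
      hence "T ! 0 ! c x \<in> Row0" "c (T ! 0 ! c x) = c x" using entry[of 0 "c x"] by (auto simp: Row0_def)
      thus "c x \<in> c ` Row0" by (metis imageI)
    qed
    hence "card (c ` (I - keys q)) \<le> card (c ` Row0)" using I_split by (intro card_mono) auto
    also have "\<dots> \<le> card Row0" using I_split by (intro card_image_le)
    finally have "\<not> inj_on c (I - keys q)" using big by (intro pigeonhole) simp
    then obtain x y where xy: "x \<in> I - keys q" "y \<in> I - keys q" "x \<noteq> y" "c x = c y" by (auto simp: inj_on_def)
    have "swp x y permutes I" using xy by (intro permutes_swap_id) auto
    hence "swp x y \<in> fibre_stab n c" using xy by (auto simp: fibre_stab_def Transposition.transpose_def)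
    hence "poly_act (swp x y) (F_poly M T) = - F_poly M T"
      using symmetrizer_act_left[of "swp x y" n c True "orbit_sum M"] xy by (simp add: F_poly_eq sign_char_swp)
    moreover have "mperm (swp x y) q = q" using xy by (intro mperm_swp_fixed) auto
    ultimately have "contr_coeff \<mu> q (F_poly M T) = - contr_coeff \<mu> q (F_poly M T)"
      using contr_coeff_poly_act[of "swp x y" \<mu> q "F_poly M T"] by (simp add: contr_coeff_uminus)
    thus ?thesis by simp
  qed
qed

lemma image_mset_I:
  assumes "keys m \<subseteq> I"
  shows "image_mset (lookup m) (mset_set I) = mon_content m + replicate_mset (n - card (keys m)) 0"
proof -
  have "mset_set I = mset_set (keys m) + mset_set (I - keys m)"
    using assms by (subst mset_set_Union[symmetric]) (auto simp: Un_absorb1)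
  moreover have "image_mset (lookup m) (mset_set (I - keys m)) = replicate_mset (card (I - keys m)) 0"
  proof -
    have "image_mset (lookup m) (mset_set (I - keys m)) = image_mset (\<lambda>_. 0) (mset_set (I - keys m))"
      by (rule image_mset_cong) (simp add: in_keys_iff)
    thus ?thesis by (simp add: image_mset_const_eq)
  qed
  ultimately show ?thesis using assms by (simp add: mon_content_def card_Diff_subset)
qed

text \<open>
  Within the orbit, the monomials with given exponents below the first row are all monomials of the
  right content with these exponents.
\<close>

lemma orbit_block:
  assumes m1: "m1 \<in> orbit M" and q: "q = restrict_mon Low m1" and m: "keys m \<subseteq> I"
  shows "m \<in> orbit M \<and> restrict_mon Low m = q \<longleftrightarrow> mon_content m = mon_content m0 \<and> extends q m"
proof
  assume h: "m \<in> orbit M \<and> restrict_mon Low m = q"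
  hence "Low = keys q \<and> extends q m" using restrict_mon_eq_iff[of Low m q] orbit_facts(4)[of m] by blast
  thus "mon_content m = mon_content m0 \<and> extends q m" using h orbit_facts(2) by blast
next
  assume h: "mon_content m = mon_content m0 \<and> extends q m"
  have kq: "keys q = Low" using orbit_facts(4)[OF m1] by (auto simp: q keys_restrict_mon)
  hence Lm: "Low \<subseteq> keys m" using extends_keys[of q m] h by blast
  hence rq: "restrict_mon Low m = q" using h kq by (simp add: restrict_mon_eq_iff)
  have low: "lookup m x = lookup m1 x" if "x \<in> Low" for x
    using h that kq by (simp add: extends_def q)
  have cc: "mon_content m = mon_content m1" using h orbit_facts(2)[OF m1] by simp
  hence "card (keys m) = card (keys m1)" by (metis size_mon_content)
  hence "image_mset (lookup m) (mset_set I) = image_mset (lookup m1) (mset_set I)"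
    using image_mset_I[OF m] image_mset_I[OF orbit_facts(1)[OF m1]] cc by simp
  moreover have "mset_set I = mset_set Low + mset_set Row0"
    using I_split by (metis mset_set_Union)
  moreover have "image_mset (lookup m) (mset_set Low) = image_mset (lookup m1) (mset_set Low)"
    using low I_split by (intro image_mset_cong) auto
  ultimately have "image_mset (lookup m) (mset_set Row0) = image_mset (lookup m1) (mset_set Row0)" by simp
  then obtain p where p: "p permutes Row0" "\<forall>x\<in>Row0. lookup m x = lookup m1 (p x)"
    using image_mset_eq_implies_permutes[OF I_split(4)] by metis
  have pI: "p permutes I" by (rule permutes_subset[OF p(1)]) (auto simp: Row0_def)
  have "r (p x) = r x" if "x \<in> I" for x
  proof (cases "x \<in> Row0")
    case True
    hence "p x \<in> Row0" using permutes_in_image[OF p(1)] by blast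
    thus ?thesis using True by (simp add: Row0_def)
  qed (simp add: permutes_not_in[OF p(1)])
  hence pSt: "p \<in> fibre_stab n r" using pI by (simp add: fibre_stab_def)
  have "m = mperm p m1"
  proof (rule poly_mapping_eqI)
    fix x
    consider "x \<in> Low" | "x \<in> Row0" | "x \<notin> I" using I_split(1) by blast
    thus "lookup m x = lookup (mperm p m1) x"
    proof cases
      case 1
      hence "x \<notin> Row0" using I_split by blast
      thus ?thesis using low[OF 1] permutes_not_in[OF p(1)] pSt by simp
    next
      case 2 thus ?thesis using p(2) pSt by simp
    next
      case 3
      hence "x \<notin> Row0" by (auto simp: Row0_def)
      hence "p x = x" using permutes_not_in[OF p(1)] by simp
      moreover have "lookup m x = 0" "lookup m1 x = 0"
        using 3 m orbit_facts(1)[OF m1] by (metis in_keys_iff subsetD)+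
      ultimately show ?thesis using pSt by simp
    qed
  qed
  moreover obtain \<tau> where "\<tau> \<in> fibre_stab n r" "m1 = mperm \<tau> m0" using m1 by (auto simp: orbit_def)
  ultimately have "m \<in> orbit M" using pSt by (auto simp: orbit_def mperm_mperm intro: fibre_stab_comp)
  thus "m \<in> orbit M \<and> restrict_mon Low m = q" using rq by simp
qed

text \<open>
  Grouped according to the exponents below the first row, the sum over the orbit of the row
  stabilizer is a sum of contraction coefficients.
\<close>

lemma F_poly_orthogonal:
  assumes F: "F \<in> contr_filt g" "F \<in> hom_polys I d'" and g: "g < int f"
  shows "ip F (F_poly M T) = 0"
proof -
  define H where "H = symmetrizer True n c F"
  have H: "H \<in> contr_filt g" "H \<in> hom_polys I d'" 
    unfolding H_def by (rule contr_filt_symmetrizer[OF F(1)], rule hom_polys_symmetrizer[OF F(2)])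
  have "(\<Sum>m\<in>orbit M. lookup H m) = (\<Sum>q\<in>restrict_mon Low ` orbit M. \<Sum>m\<in>{m \<in> orbit M. restrict_mon Low m = q}. lookup H m)"
    by (rule sum.image_gen) simp
  also have "\<dots> = 0"
  proof (rule sum.neutral, rule ballI)
    fix q assume "q \<in> restrict_mon Low ` orbit M"
    then obtain m1 where m1: "m1 \<in> orbit M" "q = restrict_mon Low m1" by blast
    have kq: "keys q = Low" using orbit_facts(4)[OF m1(1)] by (auto simp: m1(2) keys_restrict_mon)
    let ?O = "{m \<in> orbit M. restrict_mon Low m = q}"
    have "(\<Sum>m\<in>?O. lookup H m) = (\<Sum>m\<in>?O \<union> keys H. if m \<in> ?O then lookup H m else 0)"
      by (simp add: sum.If_cases Int_absorb1 Int_Un_distrib2 Un_absorb2)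
    also have "\<dots> = (\<Sum>m\<in>?O \<union> keys H. lookup H m * (if mon_content m = mon_content m0 \<and> extends q m then 1 else 0))"
    proof (intro sum.cong refl)
      fix m assume "m \<in> ?O \<union> keys H"
      hence "keys m \<subseteq> I" using H(2) orbit_facts(1) by (auto simp: hom_polys_def)
      from orbit_block[OF m1 this]
      show "(if m \<in> ?O then lookup H m else 0)
          = lookup H m * (if mon_content m = mon_content m0 \<and> extends q m then 1 else 0)" by auto
    qed
    also have "\<dots> = contr_coeff (mon_content m0) q H"
      unfolding contr_coeff_def by (rule pair_superset[symmetric]) auto
    also have "\<dots> = 0" using H(1) g by (simp add: contr_filt_def kq card_keys_m0)
    finally show "(\<Sum>m\<in>?O. lookup H m) = 0" .
  qed
  finally have "ip H (orbit_sum M) = 0" by (simp add: ip_orbit_sum)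
  thus ?thesis by (simp add: F_poly_eq H_def ip_sym)
qed

end

section \<open>Comparison of the two descriptions of the filtration\<close>

lemma down_closed_eq_lessThan:
  fixes A :: "nat set"
  assumes "finite A" "\<And>x y. x \<in> A \<Longrightarrow> y < x \<Longrightarrow> y \<in> A"
  shows "A = {..<card A}"
proof (cases "A = {}")
  case False
  have "A = {..Max A}"
  proof (intro equalityI subsetI)
    fix y assume "y \<in> {..Max A}"
    thus "y \<in> A" using assms(2)[OF Max_in[OF assms(1) False], of y] Max_in[OF assms(1) False]
      by (cases "y = Max A") auto
  qed (use assms(1) in auto)
  hence "card A = Suc (Max A)" "A = {..Max A}" by (metis card_atMost, simp)
  thus ?thesis by (simp add: lessThan_Suc_atMost)
qed simp

text \<open>
  As the inner product is positive definite, this means that the polynomials \<open>F_poly M T\<close> span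
  all homogeneous polynomials of degree \<open>d\<close> in $x_1, \ldots, x_n$.
\<close>

lemma exists_F_poly_not_orthogonal:
  assumes n: "n \<ge> 1" and F: "F \<in> hom_polys {1..n} d" "F \<noteq> 0"
  obtains M T where "M \<in> SSYTs n d" "T \<in> fillings (shape M)" "ip F (F_poly M T) \<noteq> 0"
proof -
  let ?I = "{1..n}"
  obtain r c where rc: "symmetrizer False n r (symmetrizer True n c F) \<noteq> 0" "inj_on (\<lambda>x. (r x, c x)) ?I"
    "\<And>y i. y \<in> ?I \<Longrightarrow> i < r y \<Longrightarrow> \<exists>x\<in>?I. c x = c y \<and> r x = i"
    "\<And>y i. y \<in> ?I \<Longrightarrow> i < c y \<Longrightarrow> \<exists>x\<in>?I. r x = r y \<and> c x = i"
    using young_symmetrizer_exists[OF F(2), of n] by blast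
  have inj: "x = y" if "x \<in> ?I" "y \<in> ?I" "r x = r y" "c x = c y" for x y
    using rc(2) that unfolding inj_on_def by blast
  interpret yc: young_coords n r c
    by (unfold_locales) (fact inj rc(3,4))+
  obtain m where m: "lookup (symmetrizer False n r (symmetrizer True n c F)) m \<noteq> 0" "keys m \<subseteq> ?I" "mon_degree m = d"
    and rows: "\<And>x y. x \<in> ?I \<Longrightarrow> y \<in> ?I \<Longrightarrow> r x = r y \<Longrightarrow> c x < c y \<Longrightarrow> lookup m x \<le> lookup m y"
    and cols: "\<And>x y. x \<in> ?I \<Longrightarrow> y \<in> ?I \<Longrightarrow> c x = c y \<Longrightarrow> r y = Suc (r x) \<Longrightarrow> lookup m x < lookup m y"
    using yc.straighten[OF F(1) rc(1)] by blast
  define Row where "Row i = {x \<in> ?I. r x = i}" for i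
  define a where "a i = card (Row i)" for i
  define L where "L = card (r ` ?I)"
  have rI: "r ` ?I = {..<L}" unfolding L_def
  proof (rule down_closed_eq_lessThan)
    fix i j assume "i \<in> r ` ?I" "j < i"
    thus "j \<in> r ` ?I" using rc(3) by fastforce
  qed simp
  have finRow: "finite (Row i)" for i by (simp add: Row_def)
  have cR: "c ` Row i = {..<a i}" for i
  proof -
    have "inj_on c (Row i)" using inj by (auto simp: inj_on_def Row_def)
    hence "card (c ` Row i) = a i" by (simp add: a_def card_image)
    moreover have "c ` Row i = {..<card (c ` Row i)}"
    proof (rule down_closed_eq_lessThan)
      fix j k assume "j \<in> c ` Row i" "k < j"
      then obtain y where "y \<in> ?I" "r y = i" "k < c y" by (auto simp: Row_def)
      then obtain x where "x \<in> Row i" "c x = k" using rc(4)[of y k] by (auto simp: Row_def)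
      thus "k \<in> c ` Row i" by blast
    qed (simp add: finRow)
    ultimately show ?thesis by simp
  qed
  \<comment> \<open>\<open>e i j\<close> is the entry in the box \<open>(i, j)\<close>.\<close>
  define e where "e i j = (SOME x. x \<in> ?I \<and> r x = i \<and> c x = j)" for i j
  have e: "e i j \<in> ?I \<and> r (e i j) = i \<and> c (e i j) = j" if "j < a i" for i j
  proof -
    have "j \<in> c ` Row i" using that cR by simp
    hence "\<exists>x. x \<in> ?I \<and> r x = i \<and> c x = j" by (auto simp: Row_def)
    thus ?thesis unfolding e_def by (rule someI_ex)
  qed
  have ec: "r x < L" "c x < a (r x)" "e (r x) (c x) = x" if x: "x \<in> ?I" for x
  proof -
    show "r x < L" using rI x by blast
    have "x \<in> Row (r x)" using x by (simp add: Row_def)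
    hence "c x \<in> c ` Row (r x)" by (rule imageI)
    thus ca: "c x < a (r x)" unfolding cR by simp
    show "e (r x) (c x) = x" using inj[of "e (r x) (c x)" x] e[OF ca] x by simp
  qed
  define T where "T = map (\<lambda>i. map (e i) [0..<a i]) [0..<L]"
  have lenT: "length T = L" "\<And>i. i < L \<Longrightarrow> length (T ! i) = a i" by (simp_all add: T_def)
  have nthT: "T ! i ! j = e i j" if "i < L" "j < a i" for i j using that by (simp add: T_def)
  have bT: "(i, j) \<in> boxes T \<longleftrightarrow> i < L \<and> j < a i" for i j
    using lenT by (auto simp: boxes_def)
  have shT: "shape T = map a [0..<L]" by (simp add: shape_def T_def comp_def)
  have size: "sum_list (shape T) = n"
  proof -
    have "sum_list (shape T) = (\<Sum>i<L. a i)" by (simp add: shT interv_sum_list_conv_sum_set_nat atLeast0LessThan)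
    also have "\<dots> = (\<Sum>i\<in>r ` ?I. \<Sum>x\<in>{x \<in> ?I. r x = i}. 1)" unfolding rI by (simp add: a_def Row_def)
    also have "\<dots> = (\<Sum>x\<in>?I. 1)" by (rule sum.image_gen[symmetric]) simp
    finally show ?thesis by simp
  qed
  interpret fi: filling T n r c
  proof
    show "sum_list (shape T) = n" by (rule size)
    show "(r x, c x) \<in> boxes T \<and> T ! r x ! c x = x" if "x \<in> ?I" for x
      using ec[OF that] by (simp add: bT nthT)
    show "T ! i ! j \<in> ?I \<and> r (T ! i ! j) = i \<and> c (T ! i ! j) = j" if "(i, j) \<in> boxes T" for i j
      using that e[of j i] by (simp add: bT nthT)
  qed
  have setT: "set (concat T) = ?I"
  proof (intro equalityI subsetI)
    fix x assume "x \<in> set (concat T)"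
    then obtain i j where "i < L" "j < a i" "x = e i j" by (auto simp: T_def)
    thus "x \<in> ?I" using e by blast
  next
    fix x assume "x \<in> ?I"
    thus "x \<in> set (concat T)" using ec[of x] by (force simp: T_def)
  qed
  have distT: "distinct (concat T)"
    by (rule card_distinct) (use setT size in \<open>simp add: length_concat shape_def\<close>)
  have T: "T \<in> fillings (shape T)" using setT distT size by (simp add: fillings_def)
  have part: "is_partition (shape T) n" unfolding is_partition_def
  proof (intro conjI size)
    have "a i' \<le> a i" if ii: "i < i'" for i i'
    proof -
      have "c ` Row i' \<subseteq> c ` Row i"
      proof (rule image_subsetI)
        fix y assume "y \<in> Row i'"
        hence "y \<in> ?I" "i < r y" using ii by (simp_all add: Row_def)
        then obtain x where "x \<in> Row i" "c x = c y" using rc(3)[of y i] by (auto simp: Row_def)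
        thus "c y \<in> c ` Row i" by (metis imageI)
      qed
      thus ?thesis unfolding cR by simp
    qed
    thus "sorted_wrt (\<ge>) (shape T)" by (simp add: shT sorted_wrt_iff_nth_less)
    have "a i > 0" if "i < L" for i
    proof -
      have "i \<in> r ` ?I" using that rI by simp
      hence "Row i \<noteq> {}" by (auto simp: Row_def)
      thus ?thesis using finRow by (simp add: a_def card_gt_0_iff)
    qed
    thus "0 \<notin> set (shape T)" by (fastforce simp: shT)
  qed
  define M where "M = map (map (lookup m)) T"
  have shM: "shape M = shape T" by (simp add: M_def shape_def comp_def)
  have nthM: "M ! i ! j = lookup m (e i j)" if "i < L" "j < a i" for i j
    using that lenT by (simp add: M_def nthT)
  have "M \<in> SSYT d (shape T)" unfolding SSYT_def
  proof (intro CollectI conjI shM ballI allI impI)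
    fix row assume "row \<in> set M"
    then obtain i where i: "i < L" "row = map (lookup m) (map (e i) [0..<a i])" by (auto simp: M_def T_def)
    show "sorted row"
    proof (rule sorted_iff_nth_mono_less[THEN iffD2], intro allI impI)
      fix j k assume jk: "j < k" "k < length row"
      hence "e i j \<in> ?I \<and> r (e i j) = i \<and> c (e i j) = j" "e i k \<in> ?I \<and> r (e i k) = i \<and> c (e i k) = k"
        using e i by simp_all
      hence "lookup m (e i j) \<le> lookup m (e i k)" using rows jk(1) by simp
      thus "row ! j \<le> row ! k" using i jk by simp
    qed
  next
    fix i j assume h: "(i, j) \<in> boxes M \<and> (Suc i, j) \<in> boxes M"
    have bM: "boxes M = boxes T" by (simp only: boxes_shape shM)
    have h': "i < L" "j < a i" "Suc i < L" "j < a (Suc i)" using h unfolding bM bT by blast+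
    have "lookup m (e i j) < lookup m (e (Suc i) j)"
      using e[OF h'(2)] e[OF h'(4)] by (intro cols) auto
    thus "M ! i ! j < M ! Suc i ! j" using h' by (simp add: nthM)
  next
    have "sum_list (concat M) = (\<Sum>x\<in>?I. lookup m x)"
      using sum_list_distinct_conv_sum_set[OF distT, of "lookup m"] setT by (simp add: M_def map_concat)
    also have "\<dots> = mon_degree m" unfolding mon_degree_def
      using m(2) by (intro sum.mono_neutral_right) (auto simp: in_keys_iff)
    finally show "sum_list (concat M) = d" using m(3) by simp
  qed
  hence MS: "M \<in> SSYTs n d" using part by (auto simp: SSYTs_def)
  have "fi.mon M = m"
  proof (rule poly_mapping_eqI)
    fix x show "lookup (fi.mon M) x = lookup m x"
    proof (cases "x \<in> ?I")
      case True thus ?thesis using ec[OF True] by (simp add: fi.lookup_mon nthM)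
    next
      case False
      hence "lookup m x = 0" using m(2) by (metis in_keys_iff subsetD)
      thus ?thesis using False by (simp only: fi.lookup_mon if_False)
    qed
  qed
  moreover have "mperm id (fi.mon M) \<in> fi.orbit M" unfolding fi.orbit_def by (rule imageI) (rule fibre_stab_id)
  hence "card (fi.orbit M) \<noteq> 0" by (auto simp: card_eq_0_iff)
  ultimately have "ip F (F_poly M T) \<noteq> 0"
    using fi.orbit_sum_coefficient[of M F] m(1) by auto
  thus ?thesis using that MS T shM by simp
qed

lemma ssyt_filled:
  assumes "M \<in> SSYTs n d" "n \<ge> 1" "T \<in> fillings (shape M)"
  obtains r c where "filled_ssyt T n r c M d"
proof -
  from assms(1) obtain l where l: "is_partition l n" "M \<in> SSYT d l" by (auto simp: SSYTs_def)
  have sh: "shape M = l" "shape T = l" "sum_list l = n"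
    using l assms(3) by (auto simp: SSYT_def fillings_def is_partition_def)
  obtain r c where "filling T (sum_list l) r c" using fillings_coords assms(3) sh by metis
  hence "filled_ssyt T n r c M d"
    using l assms(2) sh by (simp add: filled_ssyt_def filled_ssyt_axioms_def)
  thus ?thesis by (rule that)
qed

lemma filt_n_subset:
  assumes n: "n \<ge> 1"
  shows "filt_n n d g \<subseteq> contr_filt g \<inter> hom_polys {1..n} d"
  unfolding filt_n_def
proof (rule qpoly.span_minimal)
  show "qpoly.subspace (contr_filt g \<inter> hom_polys {1..n} d)"
    by (intro qpoly.subspace_inter contr_filt_subspace hom_polys_subspace)
  show "(\<Union>M\<in>{M \<in> SSYTs n d. int (first_row_count M) \<le> g}. V_rep M) \<subseteq> contr_filt g \<inter> hom_polys {1..n} d"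
  proof (rule UN_least)
    fix M assume "M \<in> {M \<in> SSYTs n d. int (first_row_count M) \<le> g}"
    hence MS: "M \<in> SSYTs n d" "int (first_row_count M) \<le> g" by auto
    show "V_rep M \<subseteq> contr_filt g \<inter> hom_polys {1..n} d" unfolding V_rep_def
    proof (rule qpoly.span_minimal)
      show "F_poly M ` fillings (shape M) \<subseteq> contr_filt g \<inter> hom_polys {1..n} d"
      proof (rule image_subsetI)
        fix T assume "T \<in> fillings (shape M)"
        then obtain r c where "filled_ssyt T n r c M d" using ssyt_filled[OF MS(1) n] by blast
        then interpret filled_ssyt T n r c M d .
        show "F_poly M T \<in> contr_filt g \<inter> hom_polys {1..n} d"
          using F_poly_contr_filt F_poly_hom contr_filt_mono[OF MS(2)] by blast
      qed
    qed (intro qpoly.subspace_inter contr_filt_subspace hom_polys_subspace)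
  qed
qed

text \<open>
  The components in the spaces \<open>V_rep M\<close> with \<open>first_row_count M > g\<close> add up to an element of
  \<open>contr_filt g\<close> that is orthogonal to itself.
\<close>

lemma filt_n_superset:
  assumes n: "n \<ge> 1" and F: "F \<in> contr_filt g" "F \<in> hom_polys {1..n} d"
  shows "F \<in> filt_n n d g"
proof -
  define A where "A = (\<Union>M\<in>{M \<in> SSYTs n d. int (first_row_count M) \<le> g}. V_rep M)"
  define A' where "A' = (\<Union>M\<in>{M \<in> SSYTs n d. \<not> int (first_row_count M) \<le> g}. V_rep M)"
  let ?W = "qpoly.span (A \<union> A')"
  have V_hom: "V_rep M \<subseteq> hom_polys {1..n} d" if M: "M \<in> SSYTs n d" for M
    unfolding V_rep_def
  proof (rule qpoly.span_minimal[OF _ hom_polys_subspace], rule image_subsetI)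
    fix T assume "T \<in> fillings (shape M)"
    then obtain r c where "filled_ssyt T n r c M d" using ssyt_filled[OF M n] by blast
    then interpret filled_ssyt T n r c M d .
    show "F_poly M T \<in> hom_polys {1..n} d" by (rule F_poly_hom)
  qed
  have W_hom: "?W \<subseteq> hom_polys {1..n} d"
    using V_hom by (intro qpoly.span_minimal hom_polys_subspace) (auto simp: A_def A'_def)
  define \<Theta> where "\<Theta> = {m :: monomial. keys m \<subseteq> {1..n} \<and> mon_degree m \<le> d}"
  have fin: "finite ((\<lambda>m. Poly_Mapping.single m (1::rat)) ` \<Theta>)"
    unfolding \<Theta>_def by (intro finite_imageI finite_monomials) simp
  have sp: "?W \<subseteq> qpoly.span ((\<lambda>m. Poly_Mapping.single m 1) ` \<Theta>)"
  proof
    fix H assume "H \<in> ?W"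
    hence "H \<in> hom_polys {1..n} d" using W_hom by blast
    thus "H \<in> qpoly.span ((\<lambda>m. Poly_Mapping.single m 1) ` \<Theta>)"
      by (intro span_singles) (auto simp: hom_polys_def \<Theta>_def)
  qed
  obtain y0 where y0: "y0 \<in> ?W" "\<forall>w\<in>?W. ip (F - y0) w = 0"
    using orth_decomp[OF qpoly.subspace_span sp fin] by blast
  have hom: "F - y0 \<in> hom_polys {1..n} d"
    using F(2) y0(1) W_hom by (intro qpoly.subspace_diff hom_polys_subspace) auto
  have "F - y0 = 0"
  proof (rule ccontr)
    assume "F - y0 \<noteq> 0"
    then obtain M T where MT: "M \<in> SSYTs n d" "T \<in> fillings (shape M)" "ip (F - y0) (F_poly M T) \<noteq> 0"
      using exists_F_poly_not_orthogonal[OF n hom] by blast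
    have "F_poly M T \<in> V_rep M" unfolding V_rep_def using MT(2) by (intro qpoly.span_base imageI)
    hence "F_poly M T \<in> A \<union> A'" using MT(1) by (auto simp: A_def A'_def)
    hence "F_poly M T \<in> ?W" by (rule qpoly.span_base)
    thus False using y0(2) MT(3) by blast
  qed
  hence "F \<in> ?W" using y0(1) by simp
  then obtain H1 H2 where H: "H1 \<in> qpoly.span A" "H2 \<in> qpoly.span A'" "F = H1 + H2"
    unfolding qpoly.span_Un by blast
  have H1: "H1 \<in> contr_filt g" "H1 \<in> hom_polys {1..n} d"
    using H(1) filt_n_subset[OF n, of d g] by (auto simp: filt_n_def A_def)
  have "H2 = F - H1" using H(3) by simp
  hence H2: "H2 \<in> contr_filt g" "H2 \<in> hom_polys {1..n} d"
    using F H1 qpoly.subspace_diff[OF contr_filt_subspace] qpoly.subspace_diff[OF hom_polys_subspace] by blast+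
  have "ip H2 H2 = 0"
  proof (rule ip_span_right[OF H(2)])
    fix s assume "s \<in> A'"
    then obtain M where MS: "M \<in> SSYTs n d" "\<not> int (first_row_count M) \<le> g" "s \<in> V_rep M"
      by (auto simp: A'_def)
    show "ip H2 s = 0"
    proof (rule ip_span_right[OF MS(3)[unfolded V_rep_def]])
      fix s assume "s \<in> F_poly M ` fillings (shape M)"
      then obtain T where T: "T \<in> fillings (shape M)" "s = F_poly M T" by blast
      then obtain r c where "filled_ssyt T n r c M d" using ssyt_filled[OF MS(1) n] by blast
      then interpret filled_ssyt T n r c M d .
      show "ip H2 s = 0" unfolding T(2) using MS(2) by (intro F_poly_orthogonal[OF H2]) simp
    qed
  qed
  hence "F = H1" using H(3) by simp
  thus ?thesis using H(1) by (simp add: filt_n_def A_def)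
qed

text \<open>The filtration in terms of contraction coefficients.\<close>

theorem filt_eq: "filt d g = contr_filt g \<inter> hom_polys {1..} d"
proof (intro equalityI subsetI)
  fix F assume "F \<in> filt d g"
  then obtain n where "n \<ge> 1" "F \<in> filt_n n d g" "F \<in> hom_polys {1..} d" by (auto simp: filt_def)
  thus "F \<in> contr_filt g \<inter> hom_polys {1..} d" using filt_n_subset by blast
next
  fix F assume F: "F \<in> contr_filt g \<inter> hom_polys {1..} d"
  define n where "n = Max (insert 1 (vars F))"
  have n: "n \<ge> 1" by (simp add: n_def)
  have vn: "x \<le> n" if "x \<in> vars F" for x using that by (simp add: n_def)
  have "F \<in> hom_polys {1..n} d" unfolding hom_polys_def
  proof (intro CollectI ballI conjI subsetI)
    fix m x assume m: "m \<in> keys F" and "x \<in> keys m"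
    hence "x \<in> vars F" "x \<in> {1..}" using F by (auto simp: vars_def hom_polys_def)
    thus "x \<in> {1..n}" using vn by auto
  qed (use F in \<open>auto simp: hom_polys_def\<close>)
  moreover from this n have "F \<in> filt_n n d g" using F by (intro filt_n_superset) auto
  ultimately show "F \<in> filt d g" using F n by (auto simp: filt_def)
qed

section \<open>The maximal completely reducible sub-representations\<close>

lemma content_polys_eq: "content_polys \<mu> = polys_with (sum_mset \<mu>) {\<mu>}"
proof
  show "content_polys \<mu> \<subseteq> polys_with (sum_mset \<mu>) {\<mu>}" unfolding content_polys_def
    by (rule qpoly.span_minimal[OF _ polys_with_subspace]) (auto simp: polys_with_iff)
  show "polys_with (sum_mset \<mu>) {\<mu>} \<subseteq> content_polys \<mu>"
  proof
    fix F assume "F \<in> polys_with (sum_mset \<mu>) {\<mu>}"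
    hence "keys F \<subseteq> {m. keys m \<subseteq> {1..} \<and> mon_content m = \<mu>}" by (auto simp: polys_with_iff)
    from span_singles[OF this] show "F \<in> content_polys \<mu>" unfolding content_polys_def
      by (simp add: image_Collect)
  qed
qed

lemma polys_with_UNIV: "polys_with d UNIV = hom_polys {1..} d"
  by (simp add: polys_with_def)

lemma var_group_cases:
  assumes "G = Sym_infty \<or> G = Sym_N"
  shows "var_group G"
  using assms
proof
  assume G: "G = Sym_infty"
  show ?thesis
  proof
    fix \<sigma> assume "\<sigma> \<in> G"
    then obtain n where n: "\<sigma> permutes {1..n}" by (auto simp: G Sym_infty_def)
    show "\<sigma> permutes {1..}" by (rule permutes_subset[OF n]) auto
    show "inv \<sigma> \<in> G" using permutes_inv[OF n] by (auto simp: G Sym_infty_def)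
    fix \<tau> assume "\<tau> \<in> G"
    then obtain k where k: "\<tau> permutes {1..k}" by (auto simp: G Sym_infty_def)
    have "\<sigma> permutes {1..max n k}" "\<tau> permutes {1..max n k}"
      by (rule permutes_subset[OF n], auto, rule permutes_subset[OF k], auto)
    thus "\<sigma> \<circ> \<tau> \<in> G" unfolding G Sym_infty_def by (blast intro: permutes_compose)
  qed (auto simp: G Sym_infty_def)
next
  assume G: "G = Sym_N"
  show ?thesis
  proof
    show "\<sigma> \<in> G" if "\<sigma> permutes {1..n}" for \<sigma> n
      unfolding G Sym_N_def using permutes_subset[OF that, of "{1..}"] by auto
  qed (auto simp: G Sym_N_def permutes_compose permutes_inv)
qed

theorem theorem4p17:
  fixes d k :: nat and \<mu> :: "nat multiset" and G :: "(nat \<Rightarrow> nat) set"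
  assumes "stability_conjecture"
    and "0 \<notin># \<mu>" and "size \<mu> = k" and "sum_mset \<mu> = d"
    and "G = Sym_infty \<or> G = Sym_N"
  shows "(\<forall>f::int. 0 \<le> f \<and> f \<le> int d \<longrightarrow>
            maximal_completely_reducible
              (quotient_rep (poly_rep G (hom_polys {1..} d)) (filt d (f - 1)))
              (quotient_space (poly_rep G (hom_polys {1..} d)) (filt d f) (filt d (f - 1))))
       \<and> (\<forall>f::int. 0 \<le> f \<and> f \<le> int k \<longrightarrow>
            maximal_completely_reducible
              (quotient_rep (poly_rep G (content_polys \<mu>)) (filt_content \<mu> (f - 1)))
              (quotient_space (poly_rep G (content_polys \<mu>))
                 (filt_content \<mu> f) (filt_content \<mu> (f - 1))))"
proof -
  interpret var_group G using assms(5) by (rule var_group_cases)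
  have *: "maximal_completely_reducible
        (quotient_rep (poly_rep G (polys_with d M)) (contr_filt (f - 1) \<inter> polys_with d M))
        (quotient_space (poly_rep G (polys_with d M)) (contr_filt f \<inter> polys_with d M) (contr_filt (f - 1) \<inter> polys_with d M))"
    if "0 \<le> f" for f :: int and M
  proof -
    interpret filtered_rep G d M f ..
    show ?thesis using maximal_quo[OF that] unfolding R_def C_def B_def .
  qed
  have content: "filt_content \<mu> g = contr_filt g \<inter> polys_with d {\<mu>}" for g
    unfolding filt_content_def content_polys_eq filt_eq assms(4) by (auto simp: polys_with_def)
  show ?thesis
  proof (intro conjI allI impI)
    fix f :: int assume f: "0 \<le> f \<and> f \<le> int d"
    show "maximal_completely_reducible
              (quotient_rep (poly_rep G (hom_polys {1..} d)) (filt d (f - 1)))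
              (quotient_space (poly_rep G (hom_polys {1..} d)) (filt d f) (filt d (f - 1)))"
      using *[of f UNIV] f unfolding filt_eq polys_with_UNIV by simp
  next
    fix f :: int assume f: "0 \<le> f \<and> f \<le> int k"
    show "maximal_completely_reducible
              (quotient_rep (poly_rep G (content_polys \<mu>)) (filt_content \<mu> (f - 1)))
              (quotient_space (poly_rep G (content_polys \<mu>))
                 (filt_content \<mu> f) (filt_content \<mu> (f - 1)))"
      using *[of f "{\<mu>}"] f unfolding content content_polys_eq assms(4) by simp
  qed
qed

end
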